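(* Let $g\in\mathcal{C}^2(\mathbb{R})$ be bounded and strictly increasing, with $g(0)=0$, strictly concave on $(0,+\infty)$ and strictly convex on $(-\infty,0)$; put $g_\pm=\lim_{s\to\pm\infty}g(s)$. Let $p:\mathbb{R}\to\mathbb{R}$ be continuous and bounded, with asymptotic average $A(p)$ satisfying $g_-<A(p)<g_+$. Then there exists a sequence $(u_m)$ of solutions of $$\ddot u(t)+g(u(t))=p(t)$$ defined on the whole of $\mathbb{R}$, with $u_m,\dot u_m\in L^\infty(\mathbb{R})$ for every $m$ and $\|u_m\|_\infty\to\infty$ as $m\to\infty$. Moreover, each $u_m$ has infinitely many zeros in $\mathbb{R}$.
   Context: $p$ has asymptotic average $A(p)\in\mathbb{R}$ if $\lim_{T\to+\infty}\frac1T\int_t^{t+T}p(s)\,ds=A(p)$ uniformly in $t\in\mathbb{R}$. *)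

theory Defs
  imports "HOL-Analysis.Analysis" "HOL-Probability.Essential_Supremum"
begin

definition C2_real :: "(real \<Rightarrow> real) \<Rightarrow> bool" where
  "C2_real g \<longleftrightarrow>
     g differentiable_on UNIV \<and> deriv g differentiable_on UNIV \<and>
     continuous_on UNIV (deriv (deriv g))"

definition strictly_convex_on :: "real set \<Rightarrow> (real \<Rightarrow> real) \<Rightarrow> bool" where
  "strictly_convex_on S f \<longleftrightarrow> convex S \<and>
     (\<forall>x\<in>S. \<forall>y\<in>S. \<forall>l. x \<noteq> y \<longrightarrow> 0 < l \<longrightarrow> l < 1 \<longrightarrow>
        f ((1 - l) * x + l * y) < (1 - l) * f x + l * f y)"

definition strictly_concave_on :: "real set \<Rightarrow> (real \<Rightarrow> real) \<Rightarrow> bool" where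
  "strictly_concave_on S f \<longleftrightarrow> strictly_convex_on S (\<lambda>x. - f x)"

text \<open>The limit is taken as \<open>T\<close> tends to infinity, uniformly in the base point \<open>t\<close>. The
  Henstock-Kurzweil integral \<^const>\<open>integral\<close> agrees with the Riemann integral for the continuous
  functions this is applied to.\<close>
definition has_asymptotic_average :: "(real \<Rightarrow> real) \<Rightarrow> real \<Rightarrow> bool" where
  "has_asymptotic_average p A \<longleftrightarrow>
     uniform_limit UNIV (\<lambda>T t. (1 / T) * integral {t..t + T} p) (\<lambda>_. A) at_top"

definition Linf_norm :: "(real \<Rightarrow> real) \<Rightarrow> ereal" where
  "Linf_norm u = esssup lebesgue (\<lambda>t. ereal \<bar>u t\<bar>)"

definition in_Linf :: "(real \<Rightarrow> real) \<Rightarrow> bool" where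
  "in_Linf u \<longleftrightarrow> u \<in> borel_measurable lebesgue \<and> Linf_norm u < \<infinity>"

definition is_global_solution :: "(real \<Rightarrow> real) \<Rightarrow> (real \<Rightarrow> real) \<Rightarrow> (real \<Rightarrow> real) \<Rightarrow> bool" where
  "is_global_solution g p u \<longleftrightarrow>
     u differentiable_on UNIV \<and> deriv u differentiable_on UNIV \<and>
     (\<forall>t. deriv (deriv u) t + g (u t) = p t)"

end

theory Submission
  imports Defs
begin

text \<open>
  Solutions of \<open>u'' + g(u) = p\<close> are glued from arcs of constant sign between consecutive zeros. On a
  long interval \<open>[s, t]\<close> a contraction argument for the Green operator gives exactly one positive
  Dirichlet solution that dominates a fixed multiple of \<open>(x - s)(t - x)\<close>; with \<open>a = g\<^sub>+ - A\<close> its end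
  velocities are \<open>a(t - s)/2\<close> to leading order and its action \<open>\<phi>(s, t)\<close> is \<open>- a\<^sup>2(t - s)\<^sup>3/24\<close> to leading
  order, because \<open>p\<close> only acts through its average on long intervals. The reflection \<open>u \<mapsto> -u\<close> gives
  the negative arcs.

  Since \<open>\<partial>\<phi>/\<partial>t = - u'(t)\<^sup>2/2\<close> and \<open>\<partial>\<phi>/\<partial>s = u'(s)\<^sup>2/2\<close>, a chain of zeros that is critical for the sum of
  the actions glues to a solution. On \<open>[-X, X]\<close> one maximises this sum minus a constant cost per arc,
  over chains with a free number of arcs and with normalised gaps restricted to \<open>[\<tau>, 5\<tau>]\<close>. The action
  is cubic and the cost is of order \<open>\<tau>\<^sup>3\<close>, so a maximiser cannot touch the constraint: otherwise
  neighbouring gaps would all be nearly extremal, and splitting two arcs into four, or merging four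
  into two, would increase the sum. Letting \<open>X\<close> tend to infinity gives a bi-infinite chain and a
  bounded solution of size of order \<open>\<tau>\<^sup>2\<close>.
\<close>

section \<open>The Dirichlet problem on an interval\<close>

lemma fundamental_theorem_of_calculus_real:
  fixes F f :: "real \<Rightarrow> real"
  assumes "a \<le> b" "\<And>x. x \<in> {a..b} \<Longrightarrow> (F has_real_derivative f x) (at x within {a..b})"
  shows "(f has_integral (F b - F a)) {a..b}"
  using assms
  by (intro fundamental_theorem_of_calculus)
    (auto simp: has_real_derivative_iff_has_vector_derivative)

definition second_primitive ::
    "real \<Rightarrow> real \<Rightarrow> (real \<Rightarrow> real) \<Rightarrow> (real \<Rightarrow> real) \<Rightarrow> (real \<Rightarrow> real) \<Rightarrow> bool" where
  "second_primitive s t h y y' \<longleftrightarrow>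
     (\<forall>x\<in>{s..t}. (y has_real_derivative y' x) (at x within {s..t})) \<and>
     (\<forall>x\<in>{s..t}. (y' has_real_derivative h x) (at x within {s..t}))"

lemma second_primitiveD:
  assumes "second_primitive s t h y y'" "x \<in> {s..t}"
  shows "(y has_real_derivative y' x) (at x within {s..t})"
    "(y' has_real_derivative h x) (at x within {s..t})"
  using assms unfolding second_primitive_def by auto

lemma second_primitive_subset:
  assumes "second_primitive s t h y y'" "{a..b} \<subseteq> {s..t}"
  shows "second_primitive a b h y y'"
  using assms unfolding second_primitive_def by (meson DERIV_subset subsetD)

lemma second_primitive_continuous_on:
  assumes "second_primitive s t h y y'"
  shows "continuous_on {s..t} y" "continuous_on {s..t} y'"
  using assms unfolding second_primitive_def by (auto intro!: DERIV_continuous_on)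

lemma second_primitive_diff:
  assumes "second_primitive s t h y y'" "second_primitive s t k z z'"
  shows "second_primitive s t (\<lambda>x. h x - k x) (\<lambda>x. y x - z x) (\<lambda>x. y' x - z' x)"
  using assms unfolding second_primitive_def by (auto intro!: derivative_intros)

lemma second_primitive_cmult:
  assumes "second_primitive s t h y y'"
  shows "second_primitive s t (\<lambda>x. c * h x) (\<lambda>x. c * y x) (\<lambda>x. c * y' x)"
  using assms unfolding second_primitive_def by (auto intro!: DERIV_cmult)

lemma second_primitive_reflect:
  assumes y: "second_primitive s t h y y'"
  shows "second_primitive (- t) (- s) (\<lambda>x. h (- x)) (\<lambda>x. y (- x)) (\<lambda>x. - y' (- x))"
proof -
  have reflect: "((\<lambda>x. f (- x)) has_real_derivative - f' (- x)) (at x within {-t..-s})"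
    if "\<And>x. x \<in> {s..t} \<Longrightarrow> (f has_real_derivative f' x) (at x within {s..t})" "x \<in> {-t..-s}"
    for f f' :: "real \<Rightarrow> real" and x
  proof -
    have "uminus ` {-t..-s} = {s..t}" by simp
    then have "(f \<circ> uminus has_real_derivative f' (- x) * (- 1)) (at x within {-t..-s})"
      using that by (intro DERIV_image_chain) (auto intro!: derivative_eq_intros)
    then show ?thesis by (simp add: o_def)
  qed
  have "((\<lambda>x. - y' (- x)) has_real_derivative h (- x)) (at x within {-t..-s})"
    if "x \<in> {-t..-s}" for x
    using DERIV_minus[OF reflect[OF second_primitiveD(2)[OF y] that]] by simp
  then show ?thesis
    using reflect[OF second_primitiveD(1)[OF y]] unfolding second_primitive_def by blast
qed

lemma second_primitive_deriv_diff_le: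
  assumes y: "second_primitive s t h y y'" and B: "\<And>x. x \<in> {s..t} \<Longrightarrow> \<bar>h x\<bar> \<le> B"
    and "x \<in> {s..t}" "z \<in> {s..t}"
  shows "\<bar>y' x - y' z\<bar> \<le> B * \<bar>x - z\<bar>"
  using field_differentiable_bound[of "{s..t}" y' h B x z] assms second_primitiveD[OF y] by auto

lemma second_primitive_diff_le:
  assumes y: "second_primitive s t h y y'" and B: "\<And>x. x \<in> {s..t} \<Longrightarrow> \<bar>y' x\<bar> \<le> B"
    and "x \<in> {s..t}" "z \<in> {s..t}"
  shows "\<bar>y x - y z\<bar> \<le> B * \<bar>x - z\<bar>"
  using field_differentiable_bound[of "{s..t}" y y' B x z] assms second_primitiveD[OF y] by auto

lemma second_primitive_mvt:
  assumes y: "second_primitive s t h y y'" and ab: "a \<in> {s..t}" "b \<in> {s..t}" "a \<le> b"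
  obtains \<xi> where "\<xi> \<in> {a..b}" "y b - y a = (b - a) * y' \<xi>"
proof -
  have "\<exists>\<xi>\<in>{a..b}. y b - y a = y' \<xi> * (b - a)"
    using ab second_primitiveD(1)[OF second_primitive_subset[OF y, of a b]]
    by (intro mvt_very_simple[where f' = "\<lambda>x. (*) (y' x)"]) (auto simp: has_field_derivative_def)
  then show ?thesis using that by (auto simp: mult.commute)
qed

lemma second_primitive_deriv_le_osc:
  assumes y: "second_primitive s t h y y'" and "s < t" "y s = y t"
    and osc: "\<And>x z. x \<in> {s..t} \<Longrightarrow> z \<in> {s..t} \<Longrightarrow> \<bar>y' x - y' z\<bar> \<le> D" and x: "x \<in> {s..t}"
  shows "\<bar>y' x\<bar> \<le> D"
proof -
  obtain \<xi> where \<xi>: "\<xi> \<in> {s..t}" "y t - y s = (t - s) * y' \<xi>"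
    using second_primitive_mvt[OF y, of s t] \<open>s < t\<close> by auto
  with assms have "y' \<xi> = 0" by simp
  with osc[OF x \<xi>(1)] show ?thesis by simp
qed

lemma dirichlet_second_primitive_exists:
  fixes h :: "real \<Rightarrow> real"
  assumes "s < t" and h: "continuous_on {s..t} h"
  obtains y y' where "second_primitive s t h y y'" "y s = 0" "y t = 0"
proof
  define H where "H r = integral {s..r} h" for r
  have dH: "(H has_real_derivative h x) (at x within {s..t})" if "x \<in> {s..t}" for x
    unfolding H_def using integral_has_real_derivative[OF h that] .
  then have cH: "continuous_on {s..t} H" by (rule DERIV_continuous_on)
  define HH where "HH r = integral {s..r} H" for r
  have dHH: "(HH has_real_derivative H x) (at x within {s..t})" if "x \<in> {s..t}" for x
    unfolding HH_def using integral_has_real_derivative[OF cH that] .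
  define c where "c = HH t / (t - s)"
  show "second_primitive s t h (\<lambda>r. HH r - c * (r - s)) (\<lambda>r. H r - c)"
    unfolding second_primitive_def by (auto intro!: derivative_eq_intros dHH dH)
  show "HH s - c * (s - s) = 0" by (simp add: HH_def)
  show "HH t - c * (t - s) = 0" using \<open>s < t\<close> by (simp add: c_def)
qed

lemma dirichlet_bcontfun_exists:
  fixes h :: "real \<Rightarrow> real"
  assumes "s < t" and h: "continuous_on {s..t} h"
  obtains v :: "real \<Rightarrow>\<^sub>C real" and v' where
    "second_primitive s t h v v'" "v s = 0" "v t = 0" "\<And>x. v x = v (clamp s t x)"
proof -
  obtain y y' where y: "second_primitive s t h y y'" "y s = 0" "y t = 0"
    using dirichlet_second_primitive_exists[OF assms] .
  obtain v :: "real \<Rightarrow>\<^sub>C real" where v: "\<And>x. x \<in> cbox s t \<Longrightarrow> v x = y x" "\<And>x. v x = y (clamp s t x)"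
    using continuous_on_cbox_bcontfunE[of s t y] second_primitive_continuous_on(1)[OF y(1)] by auto
  show ?thesis
  proof (rule that)
    have "(v has_real_derivative y' x) (at x within {s..t})" if x: "x \<in> {s..t}" for x
      using has_derivative_transform[OF x _
        second_primitiveD(1)[OF y(1) x, unfolded has_field_derivative_def]] v
      unfolding has_field_derivative_def by auto
    then show "second_primitive s t h v y'"
      using y(1) unfolding second_primitive_def by blast
    show "v s = 0" "v t = 0" using v y \<open>s < t\<close> by auto
    show "v x = v (clamp s t x)" for x
      using v(1)[of "clamp s t x"] v(2)[of x] clamp_in_interval[of s t x] \<open>s < t\<close> by auto
  qed
qed

lemma dirichlet_abs_le_parabola:
  assumes y: "second_primitive s t h y y'" and "s < t" and bc: "y s = 0" "y t = 0"
    and D: "\<And>x. x \<in> {s..t} \<Longrightarrow> \<bar>y' x\<bar> \<le> D" and r: "r \<in> {s..t}"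
  shows "\<bar>y r\<bar> \<le> 2 * D / (t - s) * ((r - s) * (t - r))"
proof -
  have "\<bar>y r\<bar> \<le> D * (r - s)" "\<bar>y r\<bar> \<le> D * (t - r)"
    using second_primitive_diff_le[OF y D r, of s] second_primitive_diff_le[OF y D r, of t] bc r
    by auto
  then have "(t - r) * \<bar>y r\<bar> + (r - s) * \<bar>y r\<bar> \<le> (t - r) * (D * (r - s)) + (r - s) * (D * (t - r))"
    using r by (intro add_mono mult_left_mono) auto
  then have "(t - s) * \<bar>y r\<bar> \<le> 2 * D * ((r - s) * (t - r))" by (simp add: algebra_simps)
  then show ?thesis using \<open>s < t\<close> by (simp add: field_simps)
qed

text \<open>Only the mean of \<open>h\<close> matters: the derivative of the difference to the parabola vanishes
  somewhere and oscillates by at most \<open>D\<close>.\<close>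
lemma dirichlet_parabola_approx:
  assumes y: "second_primitive s t (\<lambda>x. - h x) y y'" and "s < t" and bc: "y s = 0" "y t = 0"
    and D: "\<And>x z. s \<le> x \<Longrightarrow> x \<le> z \<Longrightarrow> z \<le> t \<Longrightarrow> \<bar>integral {x..z} (\<lambda>x. h x - a)\<bar> \<le> D"
  shows "r \<in> {s..t} \<Longrightarrow> \<bar>y r - a / 2 * ((r - s) * (t - r))\<bar> \<le> 2 * D / (t - s) * ((r - s) * (t - r))"
    and "\<bar>y' s - a / 2 * (t - s)\<bar> \<le> D" and "\<bar>- y' t - a / 2 * (t - s)\<bar> \<le> D"
proof -
  define z where "z r = y r - a / 2 * ((r - s) * (t - r))" for r
  define z' where "z' r = y' r - a / 2 * (t + s - 2 * r)" for r
  have z: "second_primitive s t (\<lambda>x. - (h x - a)) z z'"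
    unfolding second_primitive_def z_def z'_def
    by (auto intro!: derivative_eq_intros second_primitiveD[OF y] simp: algebra_simps)
  have z_bc: "z s = 0" "z t = 0" by (auto simp: z_def bc)
  have increasing_osc: "\<bar>z' x2 - z' x1\<bar> \<le> D" if "s \<le> x1" "x1 \<le> x2" "x2 \<le> t" for x1 x2
  proof -
    have "((\<lambda>x. - (h x - a)) has_integral (z' x2 - z' x1)) {x1..x2}"
      using that second_primitiveD(2)[OF second_primitive_subset[OF z, of x1 x2]]
      by (intro fundamental_theorem_of_calculus_real) auto
    from integral_unique[OF has_integral_neg[OF this]] show ?thesis using D[OF that] by simp
  qed
  have osc: "\<bar>z' x1 - z' x2\<bar> \<le> D" if "x1 \<in> {s..t}" "x2 \<in> {s..t}" for x1 x2
    using increasing_osc[of x1 x2] increasing_osc[of x2 x1] that by (cases "x1 \<le> x2") auto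
  have z'_le: "\<bar>z' x\<bar> \<le> D" if "x \<in> {s..t}" for x
    using second_primitive_deriv_le_osc[OF z \<open>s < t\<close> _ osc that] z_bc by simp
  show "\<bar>y r - a / 2 * ((r - s) * (t - r))\<bar> \<le> 2 * D / (t - s) * ((r - s) * (t - r))" if "r \<in> {s..t}"
    using dirichlet_abs_le_parabola[OF z \<open>s < t\<close> z_bc z'_le that] by (simp add: z_def)
  show "\<bar>y' s - a / 2 * (t - s)\<bar> \<le> D" using z'_le[of s] \<open>s < t\<close> by (simp add: z'_def)
  have "- y' t - a / 2 * (t - s) = - z' t" by (simp add: z'_def field_simps)
  then show "\<bar>- y' t - a / 2 * (t - s)\<bar> \<le> D" using z'_le[of t] \<open>s < t\<close> by simp
qed

lemma green_representation:
  assumes y: "second_primitive s t (\<lambda>x. - h x) y y'" and r: "r \<in> {s..t}"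
  shows "(t - s) * y r = (t - r) * integral {s..r} (\<lambda>x. (x - s) * h x)
     + (r - s) * integral {r..t} (\<lambda>x. (t - x) * h x) + (t - r) * y s + (r - s) * y t"
proof -
  have "((\<lambda>x. (x - s) * h x) has_integral (y r - (r - s) * y' r - (y s - (s - s) * y' s))) {s..r}"
    using r second_primitiveD[OF second_primitive_subset[OF y, of s r]]
    by (intro fundamental_theorem_of_calculus_real)
      (auto intro!: derivative_eq_intros simp: algebra_simps)
  moreover have "((\<lambda>x. (t - x) * h x) has_integral
      (- ((t - t) * y' t) - y t - (- ((t - r) * y' r) - y r))) {r..t}"
    using r second_primitiveD[OF second_primitive_subset[OF y, of r t]]
    by (intro fundamental_theorem_of_calculus_real)
      (auto intro!: derivative_eq_intros simp: algebra_simps)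
  ultimately show ?thesis
    by (simp add: integral_unique algebra_simps)
qed

lemma green_abs_bound:
  assumes "s < t" and h: "continuous_on {s..t} h"
    and y: "second_primitive s t (\<lambda>x. - h x) y y'" and r: "r \<in> {s..t}"
  shows "(t - s) * \<bar>y r\<bar> \<le> integral {s..t} (\<lambda>x. (x - s) * (t - x) * \<bar>h x\<bar>)
     + (t - r) * \<bar>y s\<bar> + (r - s) * \<bar>y t\<bar>"
proof -
  let ?m = "\<lambda>x. (x - s) * (t - x) * \<bar>h x\<bar>"
  have ch: "continuous_on {s..r} h" "continuous_on {r..t} h"
    using r by (auto intro!: continuous_on_subset[OF h])
  have "norm (integral {s..r} (\<lambda>x. (t - r) * ((x - s) * h x))) \<le> integral {s..r} ?m"
    by (rule integral_norm_bound_integral)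
      (use r in \<open>auto intro!: integrable_continuous_real continuous_intros ch mult_right_mono
        mult_left_mono simp: abs_mult mult.commute mult.left_commute\<close>)
  then have left: "\<bar>(t - r) * integral {s..r} (\<lambda>x. (x - s) * h x)\<bar> \<le> integral {s..r} ?m"
    by simp
  have "norm (integral {r..t} (\<lambda>x. (r - s) * ((t - x) * h x))) \<le> integral {r..t} ?m"
    by (rule integral_norm_bound_integral)
      (use r in \<open>auto intro!: integrable_continuous_real continuous_intros ch mult_right_mono
        mult_left_mono simp: abs_mult mult.assoc\<close>)
  then have right: "\<bar>(r - s) * integral {r..t} (\<lambda>x. (t - x) * h x)\<bar> \<le> integral {r..t} ?m"
    by simp
  have combine: "integral {s..t} ?m = integral {s..r} ?m + integral {r..t} ?m"
    using r by (intro Henstock_Kurzweil_Integration.integral_combine[symmetric])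
      (auto intro!: integrable_continuous_real continuous_intros h)
  have "\<bar>(t - s) * y r\<bar> \<le> integral {s..t} ?m + \<bar>(t - r) * y s\<bar> + \<bar>(r - s) * y t\<bar>"
    unfolding green_representation[OF y r] combine using left right by linarith
  then show ?thesis using r \<open>s < t\<close> by (simp add: abs_mult)
qed

lemma integral_le_middle_plus_ends:
  fixes m :: "real \<Rightarrow> real"
  assumes m: "continuous_on {s..t} m" and d: "0 \<le> d" "2 * d \<le> t - s" and \<eta>: "0 \<le> \<eta>"
    and ends: "\<And>x. x \<in> {s..t} \<Longrightarrow> x \<le> s + d \<or> t - d \<le> x \<Longrightarrow> m x \<le> B"
    and middle: "\<And>x. x \<in> {s + d..t - d} \<Longrightarrow> m x \<le> \<eta>"
  shows "integral {s..t} m \<le> \<eta> * (t - s) + 2 * d * B"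
proof -
  have integrable: "m integrable_on {x..y}" if "s \<le> x" "y \<le> t" for x y
    using that by (intro integrable_continuous_real continuous_on_subset[OF m]) auto
  have const_bound: "integral {x..y} m \<le> c * (y - x)"
    if "s \<le> x" "x \<le> y" "y \<le> t" "\<And>r. r \<in> {x..y} \<Longrightarrow> m r \<le> c" for x y c
    using integral_le[of m "{x..y}" "\<lambda>_. c"] integrable[of x y] that by (auto simp: mult.commute)
  have "integral {s..t} m = integral {s..s+d} m + integral {s+d..t-d} m + integral {t-d..t} m"
    using Henstock_Kurzweil_Integration.integral_combine[of s "s+d" t m]
      Henstock_Kurzweil_Integration.integral_combine[of "s+d" "t-d" t m] integrable d by auto
  also have "\<dots> \<le> B * d + \<eta> * (t - d - (s + d)) + B * d"
    using const_bound[of s "s+d" B] const_bound[of "s+d" "t-d" \<eta>] const_bound[of "t-d" t B]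
      d ends middle by force
  also have "\<dots> \<le> \<eta> * (t - s) + 2 * d * B"
    using mult_nonneg_nonneg[OF \<eta> d(1)] by (simp add: algebra_simps)
  finally show ?thesis .
qed

lemma interior_product_ge:
  fixes x :: real
  assumes "0 \<le> d" "2 * d \<le> t - s" "x \<in> {s + d..t - d}"
  shows "d * (t - s) / 2 \<le> (x - s) * (t - x)"
proof -
  have "0 \<le> (x - s - d) * (t - x - d)" using assms by (intro mult_nonneg_nonneg) auto
  then have "d * (t - s) - d * d \<le> (x - s) * (t - x)" by (simp add: algebra_simps)
  moreover have "d * (2 * d) \<le> d * (t - s)" using assms by (intro mult_left_mono) auto
  ultimately show ?thesis by simp
qed

lemma boundary_product_le:
  fixes x :: real
  assumes "0 \<le> d" "x \<in> {s..t}" "x \<le> s + d \<or> t - d \<le> x"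
  shows "(x - s) * (t - x) \<le> d * (t - s)"
  using assms(3)
proof
  assume "x \<le> s + d"
  then show ?thesis using assms by (intro mult_mono) auto
next
  assume "t - d \<le> x"
  then have "(t - x) * (x - s) \<le> d * (t - s)" using assms by (intro mult_mono) auto
  then show ?thesis by (simp add: mult.commute)
qed

section \<open>Forcing by a saturating nonlinearity\<close>

locale saturating_oscillator =
  fixes g p :: "real \<Rightarrow> real" and g_inf avg Lip p_max :: real
  assumes g_cont: "continuous_on UNIV g"
    and g_bounds: "\<And>x. 0 \<le> x \<Longrightarrow> 0 \<le> g x \<and> g x \<le> g_inf"
    and g_lim: "(g \<longlongrightarrow> g_inf) at_top"
    and g_lipschitz: "\<And>x y. 0 \<le> x \<Longrightarrow> 0 \<le> y \<Longrightarrow> \<bar>g x - g y\<bar> \<le> Lip * \<bar>x - y\<bar>"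
    and g_lipschitz_decay: "\<And>\<eta>. 0 < \<eta> \<Longrightarrow>
      \<exists>Y>0. \<forall>z\<ge>Y. \<forall>x\<ge>z. \<forall>y\<ge>z. z * \<bar>g x - g y\<bar> \<le> \<eta> * \<bar>x - y\<bar>"
    and p_cont: "continuous_on UNIV p"
    and p_bound: "\<And>x. \<bar>p x\<bar> \<le> p_max"
    and p_avg: "\<And>\<eta>. 0 < \<eta> \<Longrightarrow>
      \<exists>B. \<forall>x y. x \<le> y \<longrightarrow> \<bar>integral {x..y} p - avg * (y - x)\<bar> \<le> \<eta> * (y - x) + B"
    and avg_less: "avg < g_inf"
begin

definition excess :: real where
  "excess = g_inf - avg"

definition arc_profile :: "real \<Rightarrow> real \<Rightarrow> (real \<Rightarrow> real) \<Rightarrow> bool" where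
  "arc_profile s t u \<longleftrightarrow>
     continuous_on {s..t} u \<and> (\<forall>x\<in>{s..t}. excess / 4 * ((x - s) * (t - x)) \<le> u x)"

definition force_bound :: real where
  "force_bound = g_inf + p_max"

lemma excess_pos: "0 < excess" using avg_less by (simp add: excess_def)
lemma Lip_nonneg: "0 \<le> Lip" using g_lipschitz[of 0 1] by simp
lemma g_inf_nonneg: "0 \<le> g_inf" using g_bounds[of 0] by simp
lemma p_max_nonneg: "0 \<le> p_max" using p_bound[of 0] by linarith
lemma force_bound_nonneg: "0 \<le> force_bound"
  using g_inf_nonneg p_max_nonneg by (simp add: force_bound_def)

lemma continuous_on_g_comp: "continuous_on S u \<Longrightarrow> continuous_on S (\<lambda>x. g (u x))"
  by (rule continuous_on_compose2[OF g_cont]) auto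

lemma continuous_on_p: "continuous_on S p"
  using p_cont continuous_on_subset by blast

lemma arc_profile_continuous_on: "arc_profile s t u \<Longrightarrow> continuous_on {s..t} u"
  and arc_profile_ge: "arc_profile s t u \<Longrightarrow> x \<in> {s..t} \<Longrightarrow> excess / 4 * ((x - s) * (t - x)) \<le> u x"
  by (auto simp: arc_profile_def)

lemma arc_profile_nonneg: "arc_profile s t u \<Longrightarrow> x \<in> {s..t} \<Longrightarrow> 0 \<le> u x"
  by (rule order_trans[OF _ arc_profile_ge[of s t u x]]) (use excess_pos in auto)

lemma arc_profile_subinterval:
  assumes v: "arc_profile s' t' v" and "s' \<le> s" "t \<le> t'"
  shows "arc_profile s t v"
  unfolding arc_profile_def
proof (intro conjI ballI)
  show "continuous_on {s..t} v"
    using assms by (intro continuous_on_subset[OF arc_profile_continuous_on[OF v]]) auto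
  fix x assume x: "x \<in> {s..t}"
  have "excess / 4 * ((x - s) * (t - x)) \<le> excess / 4 * ((x - s') * (t' - x))"
    using excess_pos assms x by (intro mult_left_mono mult_mono) auto
  also have "\<dots> \<le> v x" using assms x by (intro arc_profile_ge[OF v]) auto
  finally show "excess / 4 * ((x - s) * (t - x)) \<le> v x" .
qed

lemma arc_profile_reflect: "arc_profile (- t) (- s) (\<lambda>x. u (- x)) \<longleftrightarrow> arc_profile s t u"
proof -
  have reflect: "arc_profile (- t) (- s) (\<lambda>x. u (- x))" if "arc_profile s t u" for s t u
  proof -
    have "continuous_on {-t..-s} (\<lambda>x. u (- x))"
      by (rule continuous_on_compose2[OF arc_profile_continuous_on[OF that]])
        (auto intro!: continuous_intros)
    moreover have "(x - - t) * (- s - x) = (- x - s) * (t - - x)" for x by (simp add: algebra_simps)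
    then have "excess / 4 * ((x - - t) * (- s - x)) \<le> u (- x)" if "x \<in> {-t..-s}" for x
      using arc_profile_ge[OF \<open>arc_profile s t u\<close>, of "- x"] that by simp
    ultimately show ?thesis by (simp add: arc_profile_def)
  qed
  show ?thesis using reflect[of s t u] reflect[of "- t" "- s" "\<lambda>x. u (- x)"] by auto
qed

lemma eventually_saturation_defect:
  assumes "0 < \<eta>"
  shows "\<forall>\<^sub>F T in at_top. \<forall>s u. arc_profile s (s + T) u \<longrightarrow>
    integral {s..s + T} (\<lambda>r. \<bar>g (u r) - g_inf\<bar>) \<le> \<eta> * T"
proof -
  have "\<forall>\<^sub>F z in at_top. dist (g z) g_inf < \<eta> / 2"
    using g_lim assms by (intro tendstoD) auto
  then obtain Y where Y: "\<And>z. Y \<le> z \<Longrightarrow> \<bar>g z - g_inf\<bar> \<le> \<eta> / 2"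
    by (force simp: eventually_at_top_linorder dist_real_def)
  show ?thesis
    using eventually_ge_at_top[of 2] eventually_ge_at_top[of "8 * Y / excess"]
      eventually_ge_at_top[of "4 * g_inf / \<eta>"]
  proof (eventually_elim, intro allI impI)
    fix T s u assume T: "2 \<le> T" "8 * Y / excess \<le> T" "4 * g_inf / \<eta> \<le> T"
      and u: "arc_profile s (s + T) u"
    let ?m = "\<lambda>r. \<bar>g (u r) - g_inf\<bar>"
    have "integral {s..s + T} ?m \<le> \<eta> / 2 * (s + T - s) + 2 * 1 * g_inf"
    proof (rule integral_le_middle_plus_ends)
      show "continuous_on {s..s + T} ?m"
        by (intro continuous_intros continuous_on_g_comp arc_profile_continuous_on u)
      show "?m r \<le> g_inf" if "r \<in> {s..s + T}" for r
        using g_bounds[OF arc_profile_nonneg[OF u that]] by simp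
      show "?m r \<le> \<eta> / 2" if r: "r \<in> {s + 1..s + T - 1}" for r
      proof (rule Y)
        have "Y \<le> excess / 4 * (1 * (s + T - s) / 2)" using T excess_pos by (simp add: field_simps)
        also have "\<dots> \<le> excess / 4 * ((r - s) * (s + T - r))"
          using excess_pos r T by (intro mult_left_mono interior_product_ge) auto
        also have "\<dots> \<le> u r" using r by (intro arc_profile_ge[OF u]) auto
        finally show "Y \<le> u r" .
      qed
    qed (use T assms in auto)
    also have "\<dots> \<le> \<eta> * T" using T assms by (simp add: field_simps)
    finally show "integral {s..s + T} ?m \<le> \<eta> * T" .
  qed
qed

lemma eventually_forcing_mean:
  assumes "0 < \<eta>"
  shows "\<forall>\<^sub>F T in at_top. \<forall>s u. arc_profile s (s + T) u \<longrightarrow>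
    (\<forall>x y. s \<le> x \<longrightarrow> x \<le> y \<longrightarrow> y \<le> s + T \<longrightarrow> \<bar>integral {x..y} (\<lambda>r. g (u r) - p r - excess)\<bar> \<le> \<eta> * T)"
proof -
  have \<eta>3: "0 < \<eta> / 3" using assms by simp
  obtain B where B: "\<And>x y. x \<le> y \<Longrightarrow> \<bar>integral {x..y} p - avg * (y - x)\<bar> \<le> \<eta> / 3 * (y - x) + B"
    using p_avg[OF \<eta>3] by auto
  show ?thesis
    using eventually_ge_at_top[of "3 * B / \<eta>"] eventually_saturation_defect[OF \<eta>3]
  proof (eventually_elim, intro allI impI)
    fix T s u x y
    assume T: "3 * B / \<eta> \<le> T"
      "\<forall>s u. arc_profile s (s + T) u \<longrightarrow> integral {s..s + T} (\<lambda>r. \<bar>g (u r) - g_inf\<bar>) \<le> \<eta> / 3 * T"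
      and u: "arc_profile s (s + T) u" and xy: "s \<le> x" "x \<le> y" "y \<le> s + T"
    let ?d = "\<lambda>r. g (u r) - g_inf"
    have sub: "{x..y} \<subseteq> {s..s + T}" using xy by auto
    have d_cont: "continuous_on {s..s + T} ?d"
      by (intro continuous_intros continuous_on_g_comp arc_profile_continuous_on u)
    note integrable = integrable_continuous_real[OF continuous_on_subset[OF d_cont sub]]
      integrable_continuous_real[OF continuous_on_p, of x y]
    have "\<bar>integral {x..y} ?d\<bar> \<le> integral {x..y} (\<lambda>r. \<bar>?d r\<bar>)"
      using integral_norm_bound_integral[OF integrable(1), of "\<lambda>r. \<bar>?d r\<bar>"]
        integrable_continuous_real[OF continuous_on_rabs[OF continuous_on_subset[OF d_cont sub]]]
      by simp
    also have "\<dots> \<le> integral {s..s + T} (\<lambda>r. \<bar>?d r\<bar>)"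
      by (intro integral_subset_le sub integrable_continuous_real continuous_on_rabs
          continuous_on_subset[OF d_cont]) auto
    also have "\<dots> \<le> \<eta> / 3 * T" using T(2) u by blast
    finally have defect: "\<bar>integral {x..y} ?d\<bar> \<le> \<eta> / 3 * T" .
    have "integral {x..y} (\<lambda>r. g (u r) - p r - excess) = integral {x..y} (\<lambda>r. ?d r - (p r - avg))"
      by (simp add: excess_def algebra_simps)
    also have "\<dots> = integral {x..y} ?d - (integral {x..y} p - avg * (y - x))"
      using integral_diff[OF integrable(1) integrable_diff[OF integrable(2) integrable_const_ivl]]
        integral_diff[OF integrable(2) integrable_const_ivl[of avg]] xy by (simp add: mult.commute)
    finally have "\<bar>integral {x..y} (\<lambda>r. g (u r) - p r - excess)\<bar>
        \<le> \<eta> / 3 * T + (\<eta> / 3 * (y - x) + B)"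
      using defect B[OF xy(2)] by linarith
    moreover have "\<eta> / 3 * (y - x) \<le> \<eta> / 3 * T" using xy assms by (intro mult_left_mono) auto
    moreover have "B \<le> \<eta> / 3 * T" using T(1) assms by (simp add: field_simps)
    ultimately show "\<bar>integral {x..y} (\<lambda>r. g (u r) - p r - excess)\<bar> \<le> \<eta> * T" by linarith
  qed
qed

text \<open>This is where concavity enters: the Lipschitz constant of \<open>g\<close> beyond \<open>z\<close> is \<open>o(1/z)\<close>, which
  compensates the weight \<open>(x - s)(t - x)\<close> of the Green function away from the end points.\<close>
lemma weighted_g_diff_le:
  assumes Y: "\<And>z x y. Y \<le> z \<Longrightarrow> z \<le> x \<Longrightarrow> z \<le> y \<Longrightarrow> z * \<bar>g x - g y\<bar> \<le> excess / 16 * \<bar>x - y\<bar>"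
    and u: "arc_profile s t u" and v: "arc_profile s t v" and x: "x \<in> {s..t}"
    and "Y \<le> excess / 4 * ((x - s) * (t - x))"
  shows "(x - s) * (t - x) * \<bar>g (u x) - g (v x)\<bar> \<le> \<bar>u x - v x\<bar> / 4"
proof -
  have "excess / 4 * ((x - s) * (t - x)) * \<bar>g (u x) - g (v x)\<bar> \<le> excess / 16 * \<bar>u x - v x\<bar>"
    using assms arc_profile_ge by (intro Y) auto
  then have "excess / 4 * ((x - s) * (t - x) * \<bar>g (u x) - g (v x)\<bar>)
      \<le> excess / 4 * (\<bar>u x - v x\<bar> / 4)"
    by (simp add: mult.assoc)
  then show ?thesis by (rule mult_left_le_imp_le) (use excess_pos in simp)
qed

lemma weighted_g_diff_le_boundary:
  assumes u: "arc_profile s t u" and v: "arc_profile s t v" and x: "x \<in> {s..t}"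
    and "0 \<le> d" "x \<le> s + d \<or> t - d \<le> x" and D: "\<bar>u x - v x\<bar> \<le> D"
  shows "(x - s) * (t - x) * \<bar>g (u x) - g (v x)\<bar> \<le> d * (t - s) * (Lip * D)"
proof (rule mult_mono)
  show "(x - s) * (t - x) \<le> d * (t - s)" by (rule boundary_product_le) fact+
  have "\<bar>g (u x) - g (v x)\<bar> \<le> Lip * \<bar>u x - v x\<bar>"
    by (intro g_lipschitz arc_profile_nonneg[OF u x] arc_profile_nonneg[OF v x])
  also have "\<dots> \<le> Lip * D" using D Lip_nonneg by (intro mult_left_mono)
  finally show "\<bar>g (u x) - g (v x)\<bar> \<le> Lip * D" .
qed (use assms in auto)

lemma eventually_forcing_contraction:
  "\<forall>\<^sub>F T in at_top. \<forall>s u v D. arc_profile s (s + T) u \<longrightarrow> arc_profile s (s + T) v \<longrightarrow>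
    (\<forall>x\<in>{s..s + T}. \<bar>u x - v x\<bar> \<le> D) \<longrightarrow>
    integral {s..s + T} (\<lambda>x. (x - s) * (s + T - x) * \<bar>g (u x) - g (v x)\<bar>) \<le> T * D / 2"
proof -
  define d where "d = 1 / (8 * (Lip + 1))"
  have d: "0 < d" "d * Lip \<le> 1 / 8" "d \<le> 1"
    using Lip_nonneg by (auto simp: d_def field_simps)
  have "d * (d * Lip) \<le> 1 * (d * Lip)" using d Lip_nonneg by (intro mult_right_mono) auto
  then have ddK: "2 * d * (d * Lip) \<le> 1 / 4" using d by linarith
  obtain Y where Y: "\<And>z x y. Y \<le> z \<Longrightarrow> z \<le> x \<Longrightarrow> z \<le> y \<Longrightarrow> z * \<bar>g x - g y\<bar> \<le> excess / 16 * \<bar>x - y\<bar>"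
    using g_lipschitz_decay[of "excess / 16"] excess_pos by auto
  show ?thesis
    using eventually_ge_at_top[of "2 * d"] eventually_ge_at_top[of "8 * Y / (excess * d)"]
  proof (eventually_elim, intro allI impI)
    fix T s u v D
    assume T: "2 * d \<le> T" "8 * Y / (excess * d) \<le> T"
      and uv: "arc_profile s (s + T) u" "arc_profile s (s + T) v"
      and D: "\<forall>x\<in>{s..s + T}. \<bar>u x - v x\<bar> \<le> D"
    have D_nonneg: "0 \<le> D" using bspec[OF D, of s] d T by auto
    let ?m = "\<lambda>x. (x - s) * (s + T - x) * \<bar>g (u x) - g (v x)\<bar>"
    have "integral {s..s + T} ?m \<le> D / 4 * (s + T - s) + 2 * d * (d * (s + T - s) * (Lip * D))"
    proof (rule integral_le_middle_plus_ends)
      show "continuous_on {s..s + T} ?m"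
        using uv
        by (intro continuous_intros continuous_on_g_comp) (auto intro: arc_profile_continuous_on)
      show "?m x \<le> d * (s + T - s) * (Lip * D)"
        if "x \<in> {s..s + T}" "x \<le> s + d \<or> s + T - d \<le> x" for x
        using that d D uv by (intro weighted_g_diff_le_boundary) auto
      show "?m x \<le> D / 4" if x: "x \<in> {s + d..s + T - d}" for x
      proof -
        have "Y \<le> excess / 4 * (d * (s + T - s) / 2)" using T excess_pos d
          by (simp add: field_simps)
        also have "\<dots> \<le> excess / 4 * ((x - s) * (s + T - x))"
          using excess_pos d T x by (intro mult_left_mono interior_product_ge) auto
        finally have "?m x \<le> \<bar>u x - v x\<bar> / 4"
          using uv x d by (intro weighted_g_diff_le[OF Y]) auto
        also have "\<dots> \<le> D / 4" using D x d by auto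
        finally show ?thesis .
      qed
    qed (use d T D_nonneg in auto)
    also have "\<dots> = D / 4 * T + (2 * d * (d * Lip)) * (D * T)" by (simp add: algebra_simps)
    also have "\<dots> \<le> D / 4 * T + 1 / 4 * (D * T)"
      using d ddK D_nonneg T by (intro add_left_mono mult_right_mono) auto
    finally show "integral {s..s + T} ?m \<le> T * D / 2" by (simp add: mult.commute)
  qed
qed

end

section \<open>Positive arcs\<close>

locale arc_threshold = saturating_oscillator +
  fixes T0 :: real
  assumes T0_pos: "0 < T0"
    and forcing_mean: "\<And>s t u x y. T0 \<le> t - s \<Longrightarrow> arc_profile s t u \<Longrightarrow> s \<le> x \<Longrightarrow> x \<le> y \<Longrightarrow> y \<le> t \<Longrightarrow>
       \<bar>integral {x..y} (\<lambda>r. g (u r) - p r - excess)\<bar> \<le> excess / 8 * (t - s)"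
    and forcing_contraction: "\<And>s t u v D. T0 \<le> t - s \<Longrightarrow> arc_profile s t u \<Longrightarrow> arc_profile s t v \<Longrightarrow>
       (\<And>x. x \<in> {s..t} \<Longrightarrow> \<bar>u x - v x\<bar> \<le> D) \<Longrightarrow>
       integral {s..t} (\<lambda>x. (x - s) * (t - x) * \<bar>g (u x) - g (v x)\<bar>) \<le> (t - s) * D / 2"

lemma (in saturating_oscillator) arc_threshold_exists:
  "\<exists>T0. arc_threshold g p g_inf avg Lip p_max T0"
proof -
  have "0 < excess / 8" using excess_pos by simp
  then obtain T0 where T0: "0 < T0"
    "\<And>T s u x y. T0 \<le> T \<Longrightarrow> arc_profile s (s + T) u \<Longrightarrow> s \<le> x \<Longrightarrow> x \<le> y \<Longrightarrow> y \<le> s + T \<Longrightarrow>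
      \<bar>integral {x..y} (\<lambda>r. g (u r) - p r - excess)\<bar> \<le> excess / 8 * T"
    "\<And>T s u v D. T0 \<le> T \<Longrightarrow> arc_profile s (s + T) u \<Longrightarrow> arc_profile s (s + T) v \<Longrightarrow>
      (\<forall>x\<in>{s..s + T}. \<bar>u x - v x\<bar> \<le> D) \<Longrightarrow>
      integral {s..s + T} (\<lambda>x. (x - s) * (s + T - x) * \<bar>g (u x) - g (v x)\<bar>) \<le> T * D / 2"
    using eventually_conj[OF eventually_gt_at_top[of 0]
        eventually_conj[OF eventually_forcing_mean eventually_forcing_contraction]]
    unfolding eventually_at_top_linorder by (smt (verit))
  have "arc_threshold g p g_inf avg Lip p_max T0"
  proof
    show "0 < T0" by fact
    show "\<bar>integral {x..y} (\<lambda>r. g (u r) - p r - excess)\<bar> \<le> excess / 8 * (t - s)"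
      if "T0 \<le> t - s" "arc_profile s t u" "s \<le> x" "x \<le> y" "y \<le> t" for s t u x y
      using T0(2)[of "t - s" s u x y] that by simp
    show "integral {s..t} (\<lambda>x. (x - s) * (t - x) * \<bar>g (u x) - g (v x)\<bar>) \<le> (t - s) * D / 2"
      if "T0 \<le> t - s" "arc_profile s t u" "arc_profile s t v" "\<And>x. x \<in> {s..t} \<Longrightarrow> \<bar>u x - v x\<bar> \<le> D"
      for s t u v D
      using T0(3)[of "t - s" s u v D] that by simp
  qed
  then show ?thesis by blast
qed

context arc_threshold
begin

definition positive_arc :: "real \<Rightarrow> real \<Rightarrow> (real \<Rightarrow> real) \<Rightarrow> (real \<Rightarrow> real) \<Rightarrow> bool" where
  "positive_arc s t u u' \<longleftrightarrow>
     second_primitive s t (\<lambda>x. p x - g (u x)) u u' \<and> u s = 0 \<and> u t = 0 \<and> arc_profile s t u"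

lemma positive_arcD:
  assumes "positive_arc s t u u'"
  shows "second_primitive s t (\<lambda>x. p x - g (u x)) u u'" "u s = 0" "u t = 0" "arc_profile s t u"
  using assms by (auto simp: positive_arc_def)

lemma dirichlet_solution_profile:
  assumes T: "T0 \<le> t - s" and u: "arc_profile s t u"
    and y: "second_primitive s t (\<lambda>x. p x - g (u x)) y y'" "y s = 0" "y t = 0"
  shows "arc_profile s t y"
  unfolding arc_profile_def
proof (intro conjI ballI)
  show "continuous_on {s..t} y" using second_primitive_continuous_on(1)[OF y(1)] .
  fix x assume x: "x \<in> {s..t}"
  let ?q = "(x - s) * (t - x)"
  have "s < t" using T T0_pos by simp
  have "second_primitive s t (\<lambda>x. - (g (u x) - p x)) y y'" using y(1) by simp
  from dirichlet_parabola_approx(1)[OF this \<open>s < t\<close> y(2,3) forcing_mean[OF T u] x]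
  have "\<bar>y x - excess / 2 * ?q\<bar> \<le> 2 * (excess / 8 * (t - s)) / (t - s) * ?q" .
  also have "2 * (excess / 8 * (t - s)) / (t - s) = excess / 4"
    using \<open>s < t\<close> by (simp add: field_simps)
  finally have "excess / 2 * ?q - excess / 4 * ?q \<le> y x" by linarith
  moreover have "excess / 2 * ?q = excess / 4 * ?q + excess / 4 * ?q" by simp
  ultimately show "excess / 4 * ?q \<le> y x" by linarith
qed

lemma dirichlet_solution_contraction:
  assumes T: "T0 \<le> t - s" and uv: "arc_profile s t u" "arc_profile s t v"
    and D: "\<And>x. x \<in> {s..t} \<Longrightarrow> \<bar>u x - v x\<bar> \<le> D"
    and y: "second_primitive s t (\<lambda>x. p x - g (u x)) y y'"
    and z: "second_primitive s t (\<lambda>x. p x - g (v x)) z z'"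
    and bc: "\<bar>y s - z s\<bar> \<le> M" "\<bar>y t - z t\<bar> \<le> M" and x: "x \<in> {s..t}"
  shows "\<bar>y x - z x\<bar> \<le> D / 2 + M"
proof -
  let ?h = "\<lambda>x. g (u x) - g (v x)"
  have "s < t" using T T0_pos by simp
  have h: "continuous_on {s..t} ?h"
    using uv by (intro continuous_intros continuous_on_g_comp arc_profile_continuous_on)
  have "second_primitive s t (\<lambda>x. - ?h x) (\<lambda>x. y x - z x) (\<lambda>x. y' x - z' x)"
    using second_primitive_diff[OF y z] by simp
  from green_abs_bound[OF \<open>s < t\<close> h this x]
  have "(t - s) * \<bar>y x - z x\<bar> \<le> integral {s..t} (\<lambda>x. (x - s) * (t - x) * \<bar>?h x\<bar>)
      + (t - x) * \<bar>y s - z s\<bar> + (x - s) * \<bar>y t - z t\<bar>" .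
  also have "\<dots> \<le> (t - s) * D / 2 + (t - x) * M + (x - s) * M"
    using bc x by (intro add_mono mult_left_mono forcing_contraction[OF T uv D]) auto
  finally have "(t - s) * \<bar>y x - z x\<bar> \<le> (t - s) * (D / 2 + M)" by (simp add: field_simps)
  then show ?thesis by (rule mult_left_le_imp_le) (use \<open>s < t\<close> in simp)
qed

lemma positive_arc_exists:
  assumes T: "T0 \<le> t - s"
  shows "\<exists>u u'. positive_arc s t u u'"
proof -
  have "s < t" using T T0_pos by simp
  define S where "S = {u :: real \<Rightarrow>\<^sub>C real. arc_profile s t u}"
  have S_eq_PiC: "S = PiC {s..t} (\<lambda>x. {excess / 4 * ((x - s) * (t - x))..})"
    by (auto simp: S_def mem_PiC_iff arc_profile_def Pi_iff)
  have "\<exists>v v'. second_primitive s t (\<lambda>x. p x - g (u x)) (apply_bcontfun v) v' \<and>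
      v s = 0 \<and> v t = 0 \<and> (\<forall>x. v x = v (clamp s t x))" for u :: "real \<Rightarrow>\<^sub>C real"
    by (rule dirichlet_bcontfun_exists[OF \<open>s < t\<close>, of "\<lambda>x. p x - g (u x)"])
      (auto intro!: continuous_intros continuous_on_g_comp continuous_on_p)
  then obtain \<Phi> :: "(real \<Rightarrow>\<^sub>C real) \<Rightarrow> (real \<Rightarrow>\<^sub>C real)" and \<Phi>'
    where \<Phi>: "\<And>u. second_primitive s t (\<lambda>x. p x - g (apply_bcontfun u x))
        (apply_bcontfun (\<Phi> u)) (\<Phi>' u)"
      "\<And>u. \<Phi> u s = 0" "\<And>u. \<Phi> u t = 0" and \<Phi>_clamp: "\<And>u x. \<Phi> u x = \<Phi> u (clamp s t x)"
    by metis
  have "\<exists>!u\<in>S. \<Phi> u = u"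
  proof (rule Banach_fix[where c = "1/2"])
    show "complete S" unfolding S_eq_PiC by (simp add: complete_eq_closed closed_PiC)
    have "continuous_on (cbox s t) (\<lambda>x. excess / 4 * ((x - s) * (t - x)))"
      by (intro continuous_intros)
    then obtain v :: "real \<Rightarrow>\<^sub>C real"
      where "\<And>x. x \<in> cbox s t \<Longrightarrow> v x = excess / 4 * ((x - s) * (t - x))"
      using continuous_on_cbox_bcontfunE by blast
    then have "v \<in> S" by (simp add: S_def arc_profile_def)
    then show "S \<noteq> {}" by auto
    show "\<Phi> ` S \<subseteq> S"
      using dirichlet_solution_profile[OF T _ \<Phi>] by (auto simp: S_def)
    show "dist (\<Phi> u) (\<Phi> v) \<le> 1 / 2 * dist u v" if "u \<in> S" "v \<in> S" for u v
    proof (rule dist_bound)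
      fix x
      have "clamp s t x \<in> {s..t}" using clamp_in_interval[of s t x] \<open>s < t\<close> by auto
      then have "\<bar>\<Phi> u (clamp s t x) - \<Phi> v (clamp s t x)\<bar> \<le> dist u v / 2 + 0"
        using that dist_bounded[of u _ v] \<Phi>
        by (intro dirichlet_solution_contraction[OF T, of u v]) (auto simp: S_def dist_real_def)
      then show "dist (\<Phi> u x) (\<Phi> v x) \<le> 1 / 2 * dist u v"
        by (simp add: dist_real_def \<Phi>_clamp[of _ x])
    qed
  qed auto
  then obtain u where "u \<in> S" "\<Phi> u = u" by auto
  then have "positive_arc s t u (\<Phi>' u)"
    using \<Phi>[of u] by (auto simp: positive_arc_def S_def)
  then show ?thesis by blast
qed

lemma positive_arc_deriv_diff_le:
  assumes u: "positive_arc s t u u'" and "x \<in> {s..t}" "z \<in> {s..t}"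
  shows "\<bar>u' x - u' z\<bar> \<le> force_bound * \<bar>x - z\<bar>"
proof (rule second_primitive_deriv_diff_le[OF positive_arcD(1)[OF u]])
  show "\<bar>p x - g (u x)\<bar> \<le> force_bound" if "x \<in> {s..t}" for x
    using g_bounds[OF arc_profile_nonneg[OF positive_arcD(4)[OF u] that]] p_bound[of x]
    by (auto simp: force_bound_def abs_le_iff)
qed fact+

lemma positive_arc_deriv_le:
  assumes u: "positive_arc s t u u'" and x: "x \<in> {s..t}" and "s < t"
  shows "\<bar>u' x\<bar> \<le> force_bound * (t - s)"
proof (rule second_primitive_deriv_le_osc[OF positive_arcD(1)[OF u] \<open>s < t\<close> _ _ x])
  show "u s = u t" by (simp add: positive_arcD(2,3)[OF u])
  fix x z assume xz: "x \<in> {s..t}" "z \<in> {s..t}"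
  have "\<bar>u' x - u' z\<bar> \<le> force_bound * \<bar>x - z\<bar>" using u xz by (rule positive_arc_deriv_diff_le)
  also have "\<dots> \<le> force_bound * (t - s)" using xz force_bound_nonneg by (intro mult_left_mono) auto
  finally show "\<bar>u' x - u' z\<bar> \<le> force_bound * (t - s)" .
qed

lemma positive_arc_le:
  assumes u: "positive_arc s t u u'" and x: "x \<in> {s..t}" and "s < t"
  shows "u x \<le> force_bound * (t - s)\<^sup>2"
proof -
  have "\<bar>u x - u s\<bar> \<le> force_bound * (t - s) * \<bar>x - s\<bar>"
    using positive_arc_deriv_le[OF u _ \<open>s < t\<close>] x
    by (intro second_primitive_diff_le[OF positive_arcD(1)[OF u]]) auto
  also have "\<dots> \<le> force_bound * (t - s) * (t - s)" using x force_bound_nonneg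
    by (intro mult_left_mono) auto
  finally show ?thesis by (simp add: positive_arcD(2)[OF u] power2_eq_square)
qed

lemma arc_comparison:
  assumes u: "positive_arc s t u u'"
    and v: "second_primitive s t (\<lambda>x. p x - g (v x)) v v'" "arc_profile s t v"
    and T: "T0 \<le> t - s" and M: "\<bar>v s\<bar> \<le> M" "\<bar>v t\<bar> \<le> M" and x: "x \<in> {s..t}"
  shows "\<bar>v x - u x\<bar> \<le> 2 * M"
proof -
  note u_profile = positive_arcD(4)[OF u]
  have "continuous_on {s..t} (\<lambda>x. \<bar>v x - u x\<bar>)"
    using u_profile v(2) by (intro continuous_intros arc_profile_continuous_on)
  then obtain z where z: "z \<in> {s..t}" "\<And>x. x \<in> {s..t} \<Longrightarrow> \<bar>v x - u x\<bar> \<le> \<bar>v z - u z\<bar>"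
    using continuous_attains_sup[of "{s..t}" "\<lambda>x. \<bar>v x - u x\<bar>"] x by auto
  have "\<bar>v z - u z\<bar> \<le> \<bar>v z - u z\<bar> / 2 + M"
    using M positive_arcD(2,3)[OF u] z
    by (intro dirichlet_solution_contraction[OF T v(2) u_profile z(2) v(1) positive_arcD(1)[OF u]])
      auto
  then show ?thesis using z(2)[OF x] by simp
qed

lemma arc_comparison_deriv:
  assumes u: "positive_arc s t u u'"
    and v: "second_primitive s t (\<lambda>x. p x - g (v x)) v v'" "arc_profile s t v"
    and T: "T0 \<le> t - s" and M: "\<bar>v s\<bar> \<le> M" "\<bar>v t\<bar> \<le> M" and x: "x \<in> {s..t}"
  shows "\<bar>v' x - u' x\<bar> \<le> (2 / T0 + 2 * Lip * (t - s)) * M"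
proof -
  have "s < t" using T T0_pos by simp
  have M_nonneg: "0 \<le> M" using M by linarith
  let ?h = "\<lambda>x. (p x - g (v x)) - (p x - g (u x))"
  have w: "second_primitive s t ?h (\<lambda>x. v x - u x) (\<lambda>x. v' x - u' x)"
    by (rule second_primitive_diff[OF v(1) positive_arcD(1)[OF u]])
  have h_le: "\<bar>?h x\<bar> \<le> Lip * (2 * M)" if x: "x \<in> {s..t}" for x
  proof -
    have "\<bar>?h x\<bar> \<le> Lip * \<bar>u x - v x\<bar>"
      using g_lipschitz[of "u x" "v x"] arc_profile_nonneg v(2) positive_arcD(4)[OF u] x by auto
    also have "\<dots> \<le> Lip * (2 * M)"
      using arc_comparison[OF u v T M x] Lip_nonneg by (intro mult_left_mono) auto
    finally show ?thesis .
  qed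
  obtain \<xi> where \<xi>: "\<xi> \<in> {s..t}" "(v t - u t) - (v s - u s) = (t - s) * (v' \<xi> - u' \<xi>)"
    using second_primitive_mvt[OF w, of s t] \<open>s < t\<close> by auto
  have "T0 * \<bar>v' \<xi> - u' \<xi>\<bar> \<le> (t - s) * \<bar>v' \<xi> - u' \<xi>\<bar>" using T by (intro mult_right_mono) auto
  also have "\<dots> = \<bar>v t - v s\<bar>"
    using \<xi>(2) \<open>s < t\<close> positive_arcD(2,3)[OF u] by (simp add: abs_mult)
  also have "\<dots> \<le> 2 * M" using M by linarith
  finally have "\<bar>v' \<xi> - u' \<xi>\<bar> \<le> 2 / T0 * M" using T0_pos by (simp add: field_simps)
  moreover have "\<bar>(v' x - u' x) - (v' \<xi> - u' \<xi>)\<bar> \<le> Lip * (2 * M) * \<bar>x - \<xi>\<bar>"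
    by (rule second_primitive_deriv_diff_le[OF w h_le x \<xi>(1)])
  moreover have "Lip * (2 * M) * \<bar>x - \<xi>\<bar> \<le> Lip * (2 * M) * (t - s)"
    using x \<xi>(1) Lip_nonneg M_nonneg by (intro mult_left_mono) auto
  ultimately show ?thesis by (simp add: algebra_simps)
qed

lemma positive_arc_unique:
  assumes u: "positive_arc s t u u'" and v: "positive_arc s t v v'" and T: "T0 \<le> t - s"
    and x: "x \<in> {s..t}"
  shows "v x = u x" "v' x = u' x"
  using arc_comparison[OF u _ _ T _ _ x, of v v' 0]
    arc_comparison_deriv[OF u _ _ T _ _ x, of v v' 0] positive_arcD[OF v] by auto

end

section \<open>The action of an arc and its extension to the right\<close>

context saturating_oscillator
begin

definition potential :: "real \<Rightarrow> real" where
  "potential y = integral {0..y} g"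

lemma potential_mvt:
  assumes "0 \<le> x" "0 \<le> y"
  obtains \<xi> where "min x y \<le> \<xi>" "\<xi> \<le> max x y" "potential y - potential x = (y - x) * g \<xi>"
proof -
  have increasing: "\<exists>\<xi>\<in>{x..y}. potential y - potential x = (y - x) * g \<xi>" if "0 \<le> x" "x \<le> y" for x y
  proof -
    have "(potential has_real_derivative g \<xi>) (at \<xi> within {x..y})" if "\<xi> \<in> {x..y}" for \<xi>
      unfolding potential_def
      using that \<open>0 \<le> x\<close> DERIV_subset[OF integral_has_real_derivative[of 0 y g \<xi>], of "{x..y}"]
        continuous_on_subset[OF g_cont] by auto
    then have "\<exists>\<xi>\<in>{x..y}. potential y - potential x = g \<xi> * (y - x)"
      using \<open>x \<le> y\<close> by (intro mvt_very_simple[where f' = "\<lambda>x. (*) (g x)"])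
        (auto simp: has_field_derivative_def)
    then show ?thesis by (simp add: mult.commute)
  qed
  show ?thesis
  proof (cases "x \<le> y")
    case True
    then show ?thesis using increasing[of x y] assms that by auto
  next
    case False
    then obtain \<xi> where "\<xi> \<in> {y..x}" "potential x - potential y = (x - y) * g \<xi>"
      using increasing[of y x] assms by auto
    moreover from this have "potential y - potential x = (y - x) * g \<xi>" by (simp add: algebra_simps)
    ultimately show ?thesis using False that by auto
  qed
qed

lemma potential_diff_le:
  assumes "0 \<le> x" "0 \<le> y"
  shows "\<bar>potential y - potential x\<bar> \<le> g_inf * \<bar>y - x\<bar>"
proof -
  obtain \<xi> where "min x y \<le> \<xi>" "potential y - potential x = (y - x) * g \<xi>"
    using potential_mvt[OF assms] .
  moreover from this have "\<bar>g \<xi>\<bar> \<le> g_inf" using g_bounds[of \<xi>] assms by auto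
  ultimately show ?thesis by (simp add: abs_mult mult.commute mult_right_mono)
qed

lemma potential_trapezoid:
  assumes "0 \<le> x" "0 \<le> y"
  shows "\<bar>1 / 2 * (y - x) * (g y + g x) - (potential y - potential x)\<bar> \<le> Lip * (y - x)\<^sup>2"
proof -
  obtain \<xi> where \<xi>: "min x y \<le> \<xi>" "\<xi> \<le> max x y" "potential y - potential x = (y - x) * g \<xi>"
    using potential_mvt[OF assms] .
  have near: "\<bar>g z - g \<xi>\<bar> \<le> Lip * \<bar>y - x\<bar>" if "z = x \<or> z = y" for z
  proof -
    have "\<bar>g z - g \<xi>\<bar> \<le> Lip * \<bar>z - \<xi>\<bar>" using that \<xi> assms by (intro g_lipschitz) auto
    also have "\<dots> \<le> Lip * \<bar>y - x\<bar>" using that \<xi> Lip_nonneg by (intro mult_left_mono) auto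
    finally show ?thesis .
  qed
  have "1 / 2 * (y - x) * (g y + g x) - (potential y - potential x) =
      (y - x) * (((g y - g \<xi>) + (g x - g \<xi>)) / 2)"
    unfolding \<xi>(3) by (simp add: field_simps)
  also have "\<bar>\<dots>\<bar> \<le> \<bar>y - x\<bar> * (Lip * \<bar>y - x\<bar>)"
    unfolding abs_mult using near[of x] near[of y] by (intro mult_left_mono) auto
  also have "\<dots> = Lip * (y - x)\<^sup>2" by (simp add: power2_eq_square)
  finally show ?thesis .
qed

text \<open>On a Dirichlet solution, integration by parts turns the Lagrangian \<open>u'\<^sup>2/2 - G(u) + pu\<close> into the
  density below, which avoids the derivative of \<open>u\<close>.\<close>
definition action_density :: "(real \<Rightarrow> real) \<Rightarrow> real \<Rightarrow> real" where
  "action_density u x = 1 / 2 * u x * g (u x) - potential (u x) + 1 / 2 * p x * u x"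

lemma continuous_on_action_density:
  assumes "continuous_on S u" "\<And>x. x \<in> S \<Longrightarrow> 0 \<le> u x"
  shows "continuous_on S (action_density u)"
proof -
  have "g_inf-lipschitz_on {0..} potential"
    using potential_diff_le g_inf_nonneg by (auto intro!: lipschitz_onI simp: dist_real_def)
  from continuous_on_compose2[OF lipschitz_on_continuous_on[OF this] assms(1)]
  have "continuous_on S (\<lambda>x. potential (u x))" using assms(2) by auto
  then show ?thesis
    unfolding action_density_def
    by (intro continuous_intros continuous_on_g_comp continuous_on_p assms(1))
qed

lemma action_density_le:
  assumes "0 \<le> u x"
  shows "\<bar>action_density u x\<bar> \<le> 2 * force_bound * u x"
proof -
  have "\<bar>u x * g (u x)\<bar> \<le> u x * g_inf" using g_bounds assms
    by (auto simp: abs_mult intro!: mult_left_mono)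
  moreover have "\<bar>potential (u x)\<bar> \<le> g_inf * u x"
    using potential_diff_le[of 0 "u x"] assms by (simp add: potential_def)
  moreover have "\<bar>p x * u x\<bar> \<le> p_max * u x" using p_bound[of x] assms
    by (auto simp: abs_mult intro!: mult_right_mono)
  moreover have "0 \<le> g_inf * u x" "0 \<le> p_max * u x" using g_inf_nonneg p_max_nonneg assms by auto
  ultimately show ?thesis unfolding action_density_def force_bound_def
    by (simp add: algebra_simps abs_le_iff)
qed

lemma action_integral_le:
  assumes "s \<le> t" and u: "continuous_on {s..t} u" "\<And>x. x \<in> {s..t} \<Longrightarrow> 0 \<le> u x \<and> u x \<le> M"
  shows "\<bar>integral {s..t} (action_density u)\<bar> \<le> 2 * force_bound * M * (t - s)"
proof -
  have "norm (action_density u x) \<le> 2 * force_bound * M" if "x \<in> {s..t}" for x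
  proof -
    have "\<bar>action_density u x\<bar> \<le> 2 * force_bound * u x" using u(2)[OF that]
      by (intro action_density_le) simp
    also have "\<dots> \<le> 2 * force_bound * M" using u(2)[OF that] force_bound_nonneg
      by (intro mult_left_mono) auto
    finally show ?thesis by simp
  qed
  then show ?thesis
    using integral_bound[OF \<open>s \<le> t\<close> continuous_on_action_density[OF u(1)]] u(2) by simp
qed

text \<open>The Wronskian identity for \<open>v u' - u v'\<close> removes the terms of first order in \<open>v - u\<close> up to a
  trapezoidal error of second order.\<close>
lemma action_wronskian:
  assumes u: "second_primitive s t (\<lambda>x. p x - g (u x)) u u'" "u s = 0" "u t = 0"
    "\<And>x. x \<in> {s..t} \<Longrightarrow> 0 \<le> u x"
    and v: "second_primitive s t (\<lambda>x. p x - g (v x)) v v'" "\<And>x. x \<in> {s..t} \<Longrightarrow> 0 \<le> v x"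
    and "s \<le> t" and D: "\<And>x. x \<in> {s..t} \<Longrightarrow> \<bar>v x - u x\<bar> \<le> D"
  shows "\<bar>integral {s..t} (action_density v) - integral {s..t} (action_density u)
      - 1 / 2 * (v t * u' t - v s * u' s)\<bar> \<le> Lip * D\<^sup>2 * (t - s)"
proof -
  let ?I = "integral {s..t} (action_density v) - integral {s..t} (action_density u)
      - 1 / 2 * (v t * u' t - v s * u' s)"
  let ?wronskian = "\<lambda>x. u x * g (v x) - v x * g (u x) + p x * (v x - u x)"
  let ?error = "\<lambda>x. 1 / 2 * (v x - u x) * (g (v x) + g (u x)) - (potential (v x) - potential (u x))"
  have wronskian: "(?wronskian has_integral (v t * u' t - u t * v' t - (v s * u' s - u s * v' s))) {s..t}"
    using \<open>s \<le> t\<close> by (intro fundamental_theorem_of_calculus_real)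
      (auto intro!: derivative_eq_intros second_primitiveD[OF u(1)] second_primitiveD[OF v(1)]
        simp: algebra_simps)
  have integrable: "action_density v integrable_on {s..t}" "action_density u integrable_on {s..t}"
    using u(4) v(2) second_primitive_continuous_on(1)[OF u(1)]
      second_primitive_continuous_on(1)[OF v(1)]
    by (auto intro!: integrable_continuous_real continuous_on_action_density)
  have "((\<lambda>x. action_density v x - action_density u x - 1 / 2 * ?wronskian x) has_integral ?I) {s..t}"
    using has_integral_diff[OF has_integral_diff[OF integrable[THEN integrable_integral]]
        has_integral_mult_right[OF wronskian, of "1 / 2"]] u(2,3) by simp
  moreover have "action_density v x - action_density u x - 1 / 2 * ?wronskian x = ?error x" for x
    by (simp add: action_density_def field_simps)
  ultimately have "(?error has_integral ?I) (cbox s t)" by simp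
  moreover have "norm (?error x) \<le> Lip * D\<^sup>2" if "x \<in> cbox s t" for x
  proof -
    have x: "x \<in> {s..t}" using that by simp
    have "\<bar>?error x\<bar> \<le> Lip * (v x - u x)\<^sup>2" using u(4) v(2) x by (intro potential_trapezoid)
    also have "\<dots> \<le> Lip * D\<^sup>2" using D[OF x] Lip_nonneg
      by (intro mult_left_mono) (auto simp: abs_le_square_iff[symmetric])
    finally show ?thesis by simp
  qed
  ultimately have "norm ?I \<le> Lip * D\<^sup>2 * measure lborel (cbox s t)"
    using Lip_nonneg by (intro has_integral_bound) auto
  then show ?thesis using \<open>s \<le> t\<close> by simp
qed

end

context arc_threshold
begin

definition speed_modulus :: "real \<Rightarrow> real" where
  "speed_modulus T_max = force_bound + (2 / T0 + 2 * Lip * T_max) * (force_bound * T_max)"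

definition action_remainder :: "real \<Rightarrow> real" where
  "action_remainder T_max = 2 * force_bound * (force_bound * T_max)
     + Lip * (2 * (force_bound * T_max))\<^sup>2 * T_max
     + force_bound * T_max * (force_bound + speed_modulus T_max)"

context
  fixes s t t' T_max :: real and u u' v v' :: "real \<Rightarrow> real"
  assumes u: "positive_arc s t u u'" and v: "positive_arc s t' v v'"
    and extends: "t \<le> t'" and T0_le: "T0 \<le> t - s" and le_T_max: "t' - s \<le> T_max"
begin

private lemma ends_less: "s < t" "s < t'" using T0_le T0_pos extends by auto

private lemma T_max_nonneg: "0 \<le> T_max" using ends_less le_T_max by simp

private lemma v_on_left: "second_primitive s t (\<lambda>x. p x - g (v x)) v v'" "arc_profile s t v"
  using second_primitive_subset[OF positive_arcD(1)[OF v], of s t] extends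
    arc_profile_subinterval[OF positive_arcD(4)[OF v], of s t] by auto

private lemma v_deriv_le: "x \<in> {s..t'} \<Longrightarrow> \<bar>v' x\<bar> \<le> force_bound * T_max"
  using positive_arc_deriv_le[OF v _ ends_less(2)] mult_left_mono[OF le_T_max force_bound_nonneg]
  by fastforce

private lemma u_deriv_le: "x \<in> {s..t} \<Longrightarrow> \<bar>u' x\<bar> \<le> force_bound * T_max"
  using positive_arc_deriv_le[OF u _ ends_less(1)] mult_left_mono[of "t - s" T_max force_bound]
    force_bound_nonneg le_T_max extends by fastforce

private lemma v_on_extension_le:
  assumes x: "x \<in> {t..t'}"
  shows "0 \<le> v x \<and> v x \<le> force_bound * T_max * (t' - t)"
proof
  show "0 \<le> v x" using arc_profile_nonneg[OF positive_arcD(4)[OF v]] x ends_less by simp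
  have "\<bar>v x - v t'\<bar> \<le> force_bound * T_max * \<bar>x - t'\<bar>"
    using x ends_less by (intro second_primitive_diff_le[OF positive_arcD(1)[OF v] v_deriv_le]) auto
  also have "\<dots> \<le> force_bound * T_max * (t' - t)"
    using x force_bound_nonneg T_max_nonneg by (intro mult_left_mono) auto
  finally show "v x \<le> force_bound * T_max * (t' - t)" using positive_arcD(3)[OF v] by simp
qed

private lemma v_ends_le:
  "\<bar>v s\<bar> \<le> force_bound * T_max * (t' - t)"
  "\<bar>v t\<bar> \<le> force_bound * T_max * (t' - t)"
  using v_on_extension_le[of t] extends positive_arcD(2)[OF v] force_bound_nonneg T_max_nonneg
  by auto

private lemma deriv_diff_le:
  assumes x: "x \<in> {s..t}"
  shows "\<bar>v' x - u' x\<bar> \<le> (2 / T0 + 2 * Lip * T_max) * (force_bound * T_max) * (t' - t)"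
proof -
  have "\<bar>v' x - u' x\<bar> \<le> (2 / T0 + 2 * Lip * (t - s)) * (force_bound * T_max * (t' - t))"
    by (rule arc_comparison_deriv[OF u v_on_left T0_le v_ends_le x])
  also have "\<dots> \<le> (2 / T0 + 2 * Lip * T_max) * (force_bound * T_max * (t' - t))"
    using Lip_nonneg force_bound_nonneg T_max_nonneg extends le_T_max
    by (intro mult_right_mono add_left_mono mult_left_mono) auto
  finally show ?thesis by (simp add: mult.assoc)
qed

lemma extension_deriv_left_le: "\<bar>v' s - u' s\<bar> \<le> speed_modulus T_max * (t' - t)"
proof -
  have "0 \<le> force_bound * (t' - t)" using force_bound_nonneg extends by simp
  then show ?thesis
    using deriv_diff_le[of s] ends_less by (simp add: speed_modulus_def distrib_right)
qed

lemma extension_deriv_right_le: "\<bar>v' t' - u' t\<bar> \<le> speed_modulus T_max * (t' - t)"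
proof -
  have "\<bar>v' t' - v' t\<bar> \<le> force_bound * \<bar>t' - t\<bar>"
    by (rule positive_arc_deriv_diff_le[OF v]) (use ends_less extends in auto)
  then show ?thesis
    using deriv_diff_le[of t] ends_less extends by (simp add: speed_modulus_def distrib_right)
qed

private lemma crossing_expansion:
  "\<bar>v t * u' t + (u' t)\<^sup>2 * (t' - t)\<bar>
      \<le> force_bound * T_max * ((force_bound + speed_modulus T_max) * (t' - t)\<^sup>2)"
proof -
  obtain \<xi> where \<xi>: "\<xi> \<in> {t..t'}" "v t' - v t = (t' - t) * v' \<xi>"
    using second_primitive_mvt[OF positive_arcD(1)[OF v], of t t'] extends ends_less by auto
  have "\<bar>v' \<xi> - v' t'\<bar> \<le> force_bound * \<bar>\<xi> - t'\<bar>"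
    by (rule positive_arc_deriv_diff_le[OF v]) (use \<xi> ends_less in auto)
  also have "\<dots> \<le> force_bound * (t' - t)" using \<xi> force_bound_nonneg by (intro mult_left_mono) auto
  finally have slope: "\<bar>u' t - v' \<xi>\<bar> \<le> (force_bound + speed_modulus T_max) * (t' - t)"
    using extension_deriv_right_le by (simp add: distrib_right)
  have "v t * u' t + (u' t)\<^sup>2 * (t' - t) = u' t * ((u' t - v' \<xi>) * (t' - t))"
    using \<xi>(2) positive_arcD(3)[OF v] by (simp add: algebra_simps power2_eq_square)
  also have "\<bar>\<dots>\<bar>
      \<le> force_bound * T_max * ((force_bound + speed_modulus T_max) * (t' - t) * (t' - t))"
    unfolding abs_mult
    using slope u_deriv_le[of t] ends_less extends force_bound_nonneg T_max_nonneg
    by (intro mult_mono) auto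
  finally show ?thesis by (simp add: power2_eq_square mult.assoc)
qed

private lemma action_common_part:
  "\<bar>integral {s..t} (action_density v) - integral {s..t} (action_density u) - 1 / 2 * (v t * u' t)\<bar>
     \<le> Lip * (2 * (force_bound * T_max))\<^sup>2 * T_max * (t' - t)\<^sup>2"
proof -
  let ?M = "force_bound * T_max * (t' - t)"
  have "\<bar>integral {s..t} (action_density v) - integral {s..t} (action_density u)
      - 1 / 2 * (v t * u' t - v s * u' s)\<bar> \<le> Lip * (2 * ?M)\<^sup>2 * (t - s)"
    using arc_profile_nonneg[OF positive_arcD(4)[OF u]] arc_profile_nonneg[OF v_on_left(2)]
      ends_less
    by (intro action_wronskian[OF positive_arcD(1-3)[OF u] _ v_on_left(1)]
        arc_comparison[OF u v_on_left T0_le v_ends_le]) auto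
  also have "\<dots> \<le> Lip * (2 * ?M)\<^sup>2 * T_max" using Lip_nonneg extends le_T_max
    by (intro mult_left_mono) auto
  also have "\<dots> = Lip * (2 * (force_bound * T_max))\<^sup>2 * T_max * (t' - t)\<^sup>2"
    by (simp add: power_mult_distrib)
  finally show ?thesis using positive_arcD(2)[OF v] by simp
qed

lemma extension_action_expansion:
  "\<bar>integral {s..t'} (action_density v) - integral {s..t} (action_density u)
      + 1 / 2 * (u' t)\<^sup>2 * (t' - t)\<bar>
     \<le> action_remainder T_max * (t' - t)\<^sup>2"
proof -
  have v_cont: "continuous_on {s..t'} v"
    by (rule arc_profile_continuous_on[OF positive_arcD(4)[OF v]])
  have "action_density v integrable_on {s..t'}"
    using arc_profile_nonneg[OF positive_arcD(4)[OF v]] v_cont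
    by (intro integrable_continuous_real continuous_on_action_density)
  then have combine: "integral {s..t'} (action_density v) =
      integral {s..t} (action_density v) + integral {t..t'} (action_density v)"
    using Henstock_Kurzweil_Integration.integral_combine[of s t t'] ends_less extends by fastforce
  have "\<bar>integral {t..t'} (action_density v)\<bar>
      \<le> 2 * force_bound * (force_bound * T_max * (t' - t)) * (t' - t)"
    using v_on_extension_le extends ends_less
    by (intro action_integral_le continuous_on_subset[OF v_cont]) auto
  then have outer: "\<bar>integral {t..t'} (action_density v)\<bar>
      \<le> 2 * force_bound * (force_bound * T_max) * (t' - t)\<^sup>2"
    by (simp add: power2_eq_square mult.assoc)
  have "action_remainder T_max * (t' - t)\<^sup>2 = 2 * force_bound * (force_bound * T_max) * (t' - t)\<^sup>2
      + Lip * (2 * (force_bound * T_max))\<^sup>2 * T_max * (t' - t)\<^sup>2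
      + force_bound * T_max * ((force_bound + speed_modulus T_max) * (t' - t)\<^sup>2)"
    by (simp add: action_remainder_def distrib_right mult.assoc)
  then show ?thesis
    unfolding combine using outer action_common_part crossing_expansion by linarith
qed

end

end

section \<open>Dependence of the arc on its end points\<close>

context arc_threshold
begin

definition arc :: "real \<Rightarrow> real \<Rightarrow> real \<Rightarrow> real" where
  "arc s t = (SOME u. \<exists>u'. positive_arc s t u u')"

definition arc_deriv :: "real \<Rightarrow> real \<Rightarrow> real \<Rightarrow> real" where
  "arc_deriv s t = (SOME u'. positive_arc s t (arc s t) u')"

definition launch_speed :: "real \<Rightarrow> real \<Rightarrow> real" where
  "launch_speed s t = arc_deriv s t s"

definition landing_speed :: "real \<Rightarrow> real \<Rightarrow> real" where
  "landing_speed s t = - arc_deriv s t t"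

definition arc_action :: "real \<Rightarrow> real \<Rightarrow> real" where
  "arc_action s t = integral {s..t} (action_density (arc s t))"

definition action_modulus :: "real \<Rightarrow> real" where
  "action_modulus T_max = 1 / 2 * (force_bound * T_max)\<^sup>2 + action_remainder T_max * T_max"

lemma positive_arc_arc: "T0 \<le> t - s \<Longrightarrow> positive_arc s t (arc s t) (arc_deriv s t)"
  using someI_ex[OF positive_arc_exists[where s = s and t = t]]
    someI_ex[of "\<lambda>u'. positive_arc s t (arc s t) u'"] by (simp add: arc_def arc_deriv_def)

lemma arc_eq:
  assumes "positive_arc s t u u'" "T0 \<le> t - s" "x \<in> {s..t}"
  shows "arc s t x = u x" "arc_deriv s t x = u' x"
  using positive_arc_unique[OF assms(1) positive_arc_arc assms(2,3)] assms(2) by auto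

lemma arc_action_eq:
  assumes "positive_arc s t u u'" "T0 \<le> t - s"
  shows "arc_action s t = integral {s..t} (action_density u)"
  unfolding arc_action_def action_density_def using arc_eq(1)[OF assms]
  by (intro integral_cong) auto

lemma landing_speed_le:
  assumes "T0 \<le> t - s"
  shows "\<bar>landing_speed s t\<bar> \<le> force_bound * (t - s)"
  using positive_arc_deriv_le[OF positive_arc_arc[OF assms], of t] assms T0_pos
  by (auto simp: landing_speed_def)

lemma arc_action_le:
  assumes T: "T0 \<le> t - s"
  shows "\<bar>arc_action s t\<bar> \<le> 2 * force_bound * (force_bound * (t - s)\<^sup>2) * (t - s)"
  unfolding arc_action_def
proof (rule action_integral_le)
  note arc = positive_arc_arc[OF T] and profile = positive_arcD(4)[OF positive_arc_arc[OF T]]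
  show "s \<le> t" using T T0_pos by simp
  show "continuous_on {s..t} (arc s t)" by (rule arc_profile_continuous_on[OF profile])
  show "0 \<le> arc s t x \<and> arc s t x \<le> force_bound * (t - s)\<^sup>2" if "x \<in> {s..t}" for x
    using positive_arc_le[OF arc that] arc_profile_nonneg[OF profile that] T T0_pos by auto
qed

lemma
  assumes "T0 \<le> t - s" "t \<le> t'" "t' - s \<le> T_max"
  shows landing_speed_extend_right:
      "\<bar>landing_speed s t' - landing_speed s t\<bar> \<le> speed_modulus T_max * (t' - t)"
    and launch_speed_extend_right:
      "\<bar>launch_speed s t' - launch_speed s t\<bar> \<le> speed_modulus T_max * (t' - t)"
    and arc_action_expand_right:
      "\<bar>arc_action s t' - arc_action s t + 1 / 2 * (landing_speed s t)\<^sup>2 * (t' - t)\<bar>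
        \<le> action_remainder T_max * (t' - t)\<^sup>2"
proof -
  have "T0 \<le> t' - s" using assms by simp
  note arcs = positive_arc_arc[OF assms(1)] positive_arc_arc[OF this]
  show "\<bar>landing_speed s t' - landing_speed s t\<bar> \<le> speed_modulus T_max * (t' - t)"
    using extension_deriv_right_le[OF arcs assms(2,1,3)] by (simp add: landing_speed_def)
  show "\<bar>launch_speed s t' - launch_speed s t\<bar> \<le> speed_modulus T_max * (t' - t)"
    using extension_deriv_left_le[OF arcs assms(2,1,3)] by (simp add: launch_speed_def)
  show "\<bar>arc_action s t' - arc_action s t + 1 / 2 * (landing_speed s t)\<^sup>2 * (t' - t)\<bar>
      \<le> action_remainder T_max * (t' - t)\<^sup>2"
    using extension_action_expansion[OF arcs assms(2,1,3)]
    by (simp add: landing_speed_def arc_action_def)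
qed

lemma landing_speed_square_le:
  assumes "T0 \<le> t - s" "t - s \<le> T_max"
  shows "(landing_speed s t)\<^sup>2 \<le> (force_bound * T_max)\<^sup>2"
proof -
  have "force_bound * (t - s) \<le> force_bound * T_max" using assms force_bound_nonneg
    by (intro mult_left_mono)
  then have "\<bar>landing_speed s t\<bar> \<le> \<bar>force_bound * T_max\<bar>" using landing_speed_le[OF assms(1)]
    by linarith
  then show ?thesis by (simp only: abs_le_square_iff)
qed

lemma arc_action_extend_right:
  assumes "T0 \<le> t - s" "t \<le> t'" "t' - s \<le> T_max"
  shows "\<bar>arc_action s t' - arc_action s t\<bar> \<le> action_modulus T_max * (t' - t)"
proof -
  have expansion: "\<bar>arc_action s t' - arc_action s t + 1 / 2 * (landing_speed s t)\<^sup>2 * (t' - t)\<bar>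
      \<le> action_remainder T_max * (t' - t)\<^sup>2" by (rule arc_action_expand_right[OF assms])
  have "0 \<le> action_remainder T_max"
    using assms T0_pos Lip_nonneg force_bound_nonneg
    by (simp add: action_remainder_def speed_modulus_def)
  then have "action_remainder T_max * ((t' - t) * (t' - t))
      \<le> action_remainder T_max * (T_max * (t' - t))"
    using assms T0_pos by (intro mult_left_mono mult_right_mono) auto
  moreover have "0 \<le> 1 / 2 * (landing_speed s t)\<^sup>2 * (t' - t)" using assms by simp
  moreover have "1 / 2 * (landing_speed s t)\<^sup>2 * (t' - t)
      \<le> 1 / 2 * (force_bound * T_max)\<^sup>2 * (t' - t)"
    using landing_speed_square_le[of t s T_max] assms by (intro mult_left_mono mult_right_mono) auto
  moreover have "action_modulus T_max * (t' - t) =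
      1 / 2 * (force_bound * T_max)\<^sup>2 * (t' - t) + action_remainder T_max * (T_max * (t' - t))"
    by (simp add: action_modulus_def distrib_right)
  ultimately show ?thesis using expansion unfolding power2_eq_square[of "t' - t"] by linarith
qed

lemma arc_threshold_reflect: "arc_threshold g (\<lambda>x. p (- x)) g_inf avg Lip p_max T0"
proof unfold_locales
  show "continuous_on UNIV (\<lambda>x. p (- x))"
    by (rule continuous_on_compose2[OF p_cont]) (auto intro!: continuous_intros)
  have reflect: "integral {x..y} (\<lambda>r. p (- r)) = integral {-y..-x} p" for x y
    using Henstock_Kurzweil_Integration.integral_reflect_real[of "- x" "- y" p] by simp
  show "\<exists>B. \<forall>x y. x \<le> y \<longrightarrow> \<bar>integral {x..y} (\<lambda>r. p (- r)) - avg * (y - x)\<bar> \<le> \<eta> * (y - x) + B"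
    if \<eta>: "0 < \<eta>" for \<eta>
  proof -
    obtain B where B: "\<And>x y. x \<le> y \<Longrightarrow> \<bar>integral {x..y} p - avg * (y - x)\<bar> \<le> \<eta> * (y - x) + B"
      using p_avg[OF \<eta>] by blast
    show ?thesis using B[of "- y" "- x" for x y] unfolding reflect by (intro exI[of _ B]) auto
  qed
  show "\<bar>integral {x..y} (\<lambda>r. g (u r) - p (- r) - excess)\<bar> \<le> excess / 8 * (t - s)"
    if "T0 \<le> t - s" "arc_profile s t u" "s \<le> x" "x \<le> y" "y \<le> t" for s t u x y
    using forcing_mean[of "- s" "- t" "\<lambda>x. u (- x)" "- y" "- x"] that
      Henstock_Kurzweil_Integration.integral_reflect_real[of "- x" "- y"
        "\<lambda>r. g (u (- r)) - p r - excess"]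
    by (simp add: arc_profile_reflect)
qed (use g_bounds g_lim g_lipschitz g_lipschitz_decay g_cont p_bound avg_less T0_pos
    forcing_contraction in auto)

end

text \<open>Time reversal exchanges the two end points of an arc, so the left end point needs no separate
  treatment.\<close>
context arc_threshold
begin

interpretation reflected: arc_threshold g "\<lambda>x. p (- x)" g_inf avg Lip p_max T0
  by (rule arc_threshold_reflect)

lemma positive_arc_reflect:
  "positive_arc s t u u' \<Longrightarrow> reflected.positive_arc (- t) (- s) (\<lambda>x. u (- x)) (\<lambda>x. - u' (- x))"
  using second_primitive_reflect
  by (fastforce simp: positive_arc_def reflected.positive_arc_def arc_profile_reflect)

lemma
  assumes "T0 \<le> t - s"
  shows reflected_landing_speed: "reflected.landing_speed (- t) (- s) = launch_speed s t"
    and reflected_launch_speed: "reflected.launch_speed (- t) (- s) = landing_speed s t"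
    and reflected_arc_action: "reflected.arc_action (- t) (- s) = arc_action s t"
proof -
  have "s < t" "T0 \<le> - s - - t" using assms T0_pos by auto
  note arc = positive_arc_reflect[OF positive_arc_arc[OF assms]]
  note eq = reflected.arc_eq(2)[OF arc \<open>T0 \<le> - s - - t\<close>]
  show "reflected.landing_speed (- t) (- s) = launch_speed s t"
    using eq[of "- s"] \<open>s < t\<close> by (simp add: reflected.landing_speed_def launch_speed_def)
  show "reflected.launch_speed (- t) (- s) = landing_speed s t"
    using eq[of "- t"] \<open>s < t\<close> by (simp add: reflected.launch_speed_def landing_speed_def)
  have "reflected.action_density (\<lambda>x. arc s t (- x)) = (\<lambda>x. action_density (arc s t) (- x))"
    by (simp add: fun_eq_iff reflected.action_density_def action_density_def)
  then show "reflected.arc_action (- t) (- s) = arc_action s t"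
    using reflected.arc_action_eq[OF arc] assms by (simp add: arc_action_def)
qed

lemma
  assumes "T0 \<le> t - s" "s' \<le> s" "t - s' \<le> T_max"
  shows landing_speed_extend_left:
      "\<bar>landing_speed s' t - landing_speed s t\<bar> \<le> speed_modulus T_max * (s - s')"
    and launch_speed_extend_left:
      "\<bar>launch_speed s' t - launch_speed s t\<bar> \<le> speed_modulus T_max * (s - s')"
    and arc_action_extend_left:
      "\<bar>arc_action s' t - arc_action s t\<bar> \<le> action_modulus T_max * (s - s')"
proof -
  have "T0 \<le> - s - - t" "- s \<le> - s'" "- s' - - t \<le> T_max" "T0 \<le> t - s'" using assms by auto
  note extend = this(1-3) and T = assms(1) \<open>T0 \<le> t - s'\<close>
  show "\<bar>landing_speed s' t - landing_speed s t\<bar> \<le> speed_modulus T_max * (s - s')"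
    using reflected.launch_speed_extend_right[OF extend] T by (simp add: reflected_launch_speed)
  show "\<bar>launch_speed s' t - launch_speed s t\<bar> \<le> speed_modulus T_max * (s - s')"
    using reflected.landing_speed_extend_right[OF extend] T by (simp add: reflected_landing_speed)
  show "\<bar>arc_action s' t - arc_action s t\<bar> \<le> action_modulus T_max * (s - s')"
    using reflected.arc_action_extend_right[OF extend] T by (simp add: reflected_arc_action)
qed

end

lemma continuous_on_endpoint_lipschitz:
  fixes f :: "real \<Rightarrow> real \<Rightarrow> real" and L :: "real \<Rightarrow> real"
  assumes right: "\<And>s t t' T_max. T0 \<le> t - s \<Longrightarrow> t \<le> t' \<Longrightarrow> t' - s \<le> T_max \<Longrightarrow>
      \<bar>f s t' - f s t\<bar> \<le> L T_max * (t' - t)"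
    and left: "\<And>s t s' T_max. T0 \<le> t - s \<Longrightarrow> s' \<le> s \<Longrightarrow> t - s' \<le> T_max \<Longrightarrow>
      \<bar>f s' t - f s t\<bar> \<le> L T_max * (s - s')"
  shows "continuous_on {x. T0 \<le> snd x - fst x} (\<lambda>x. f (fst x) (snd x))"
  unfolding continuous_on_def
proof
  fix x :: "real \<times> real" assume x: "x \<in> {x. T0 \<le> snd x - fst x}"
  define T_max where "T_max = snd x - fst x + 2"
  have nested: "\<bar>f s' t' - f s t\<bar> \<le> L T_max * (s - s') + L T_max * (t' - t)"
    if "T0 \<le> t - s" "s' \<le> s" "t \<le> t'" "t' - s' \<le> T_max" for s t s' t'
    using left[of t' s s' T_max] right[of t s t' T_max] that by linarith
  let ?h = "\<lambda>y. L T_max * (\<bar>fst y - fst x\<bar> + \<bar>snd y - snd x\<bar>)"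
  have close: "norm (f (fst y) (snd y) - f (fst x) (snd x)) \<le> ?h y"
    if y: "T0 \<le> snd y - fst y" "dist y x < 1" for y
  proof -
    have d: "\<bar>fst y - fst x\<bar> < 1" "\<bar>snd y - snd x\<bar> < 1"
      using dist_fst_le[of y x] dist_snd_le[of y x] y(2) by (auto simp: dist_real_def)
    define s' t' where "s' = min (fst y) (fst x)" "t' = max (snd y) (snd x)"
    have "t' - s' \<le> T_max" using d x by (auto simp: s'_t'_def T_max_def)
    then have "\<bar>f s' t' - f (fst x) (snd x)\<bar> \<le> L T_max * (fst x - s') + L T_max * (t' - snd x)"
      "\<bar>f s' t' - f (fst y) (snd y)\<bar> \<le> L T_max * (fst y - s') + L T_max * (t' - snd y)"
      using x y(1) by (auto intro!: nested simp: s'_t'_def)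
    then have "\<bar>f (fst y) (snd y) - f (fst x) (snd x)\<bar> \<le>
        L T_max * (fst x - s') + L T_max * (t' - snd x) +
        (L T_max * (fst y - s') + L T_max * (t' - snd y))"
      by linarith
    also have "\<dots> = L T_max * ((fst x - s') + (t' - snd x) + (fst y - s') + (t' - snd y))"
      by (simp add: algebra_simps)
    also have "(fst x - s') + (t' - snd x) + (fst y - s') + (t' - snd y)
        = \<bar>fst y - fst x\<bar> + \<bar>snd y - snd x\<bar>"
      by (auto simp: s'_t'_def min_def max_def)
    finally show ?thesis by simp
  qed
  let ?F = "at x within {x. T0 \<le> snd x - fst x}"
  have "\<forall>\<^sub>F y in ?F. norm (f (fst y) (snd y) - f (fst x) (snd x)) \<le> ?h y"
    unfolding eventually_at by (intro exI[of _ 1]) (use close in auto)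
  moreover have "(?h \<longlongrightarrow> L T_max * (\<bar>fst x - fst x\<bar> + \<bar>snd x - snd x\<bar>)) ?F"
    by (intro tendsto_intros)
  then have "(?h \<longlongrightarrow> 0) ?F" by simp
  ultimately have "((\<lambda>y. f (fst y) (snd y) - f (fst x) (snd x)) \<longlongrightarrow> 0) ?F"
    by (rule Lim_null_comparison)
  then show "((\<lambda>y. f (fst y) (snd y)) \<longlongrightarrow> f (fst x) (snd x)) ?F"
    by (simp add: Lim_null[symmetric])
qed

lemma has_real_derivative_forward_expansion:
  fixes f D :: "real \<Rightarrow> real"
  assumes "0 < \<delta>" and D: "isCont D x"
    and expand: "\<And>y z. y \<in> ball x \<delta> \<Longrightarrow> z \<in> ball x \<delta> \<Longrightarrow> y \<le> z \<Longrightarrow>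
      \<bar>f z - f y - D y * (z - y)\<bar> \<le> C * (z - y)\<^sup>2"
  shows "(f has_real_derivative D x) (at x)"
proof -
  have close: "norm ((f y - f x) / (y - x) - D x) \<le> C * \<bar>y - x\<bar> + \<bar>D y - D x\<bar>"
    if y: "y \<in> ball x \<delta>" "y \<noteq> x" for y
  proof -
    have "\<bar>f y - f x - D x * (y - x)\<bar> \<le> C * (y - x)\<^sup>2 + \<bar>D y - D x\<bar> * \<bar>y - x\<bar>"
    proof (cases "x \<le> y")
      case True
      then show ?thesis using expand[of x y] y \<open>0 < \<delta>\<close> by (simp add: add_increasing2)
    next
      case False
      have "f y - f x - D x * (y - x) = - (f x - f y - D y * (x - y)) + (D y - D x) * (y - x)"
        by (simp add: algebra_simps)
      also have "\<bar>\<dots>\<bar> \<le> \<bar>f x - f y - D y * (x - y)\<bar> + \<bar>D y - D x\<bar> * \<bar>y - x\<bar>"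
        using abs_triangle_ineq[of "- (f x - f y - D y * (x - y))" "(D y - D x) * (y - x)"]
        by (simp only: abs_mult abs_minus_cancel)
      also have "\<bar>f x - f y - D y * (x - y)\<bar> \<le> C * (y - x)\<^sup>2"
        using expand[of y x] y False \<open>0 < \<delta>\<close> by (simp add: power2_commute)
      finally show ?thesis by simp
    qed
    also have "\<dots> = (C * \<bar>y - x\<bar> + \<bar>D y - D x\<bar>) * \<bar>y - x\<bar>"
      by (simp add: distrib_right mult.assoc power2_eq_square flip: abs_mult)
    finally have "\<bar>f y - f x - D x * (y - x)\<bar> / \<bar>y - x\<bar> \<le> C * \<bar>y - x\<bar> + \<bar>D y - D x\<bar>"
      using y by (simp add: divide_le_eq)
    moreover have "(f y - f x) / (y - x) - D x = (f y - f x - D x * (y - x)) / (y - x)"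
      using y by (simp add: diff_divide_distrib)
    ultimately show ?thesis by (simp add: abs_divide)
  qed
  have "\<forall>\<^sub>F y in at x. norm ((f y - f x) / (y - x) - D x) \<le> C * \<bar>y - x\<bar> + \<bar>D y - D x\<bar>"
    unfolding eventually_at by (intro exI[of _ \<delta>]) (use close \<open>0 < \<delta>\<close> in \<open>auto simp: dist_commute\<close>)
  moreover have "((\<lambda>y. C * \<bar>y - x\<bar> + \<bar>D y - D x\<bar>) \<longlongrightarrow> C * \<bar>x - x\<bar> + \<bar>D x - D x\<bar>) (at x)"
    by (intro tendsto_intros isContD[OF D])
  then have "((\<lambda>y. C * \<bar>y - x\<bar> + \<bar>D y - D x\<bar>) \<longlongrightarrow> 0) (at x)" by simp
  ultimately have "((\<lambda>y. (f y - f x) / (y - x) - D x) \<longlongrightarrow> 0) (at x)" by (rule Lim_null_comparison)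
  then show ?thesis by (simp add: has_field_derivative_iff Lim_null[symmetric])
qed

context arc_threshold
begin

lemma continuous_on_landing_speed:
  "continuous_on {x. T0 \<le> snd x - fst x} (\<lambda>x. landing_speed (fst x) (snd x))"
  using landing_speed_extend_right landing_speed_extend_left
  by (rule continuous_on_endpoint_lipschitz)

lemma continuous_on_launch_speed:
  "continuous_on {x. T0 \<le> snd x - fst x} (\<lambda>x. launch_speed (fst x) (snd x))"
  using launch_speed_extend_right launch_speed_extend_left
  by (rule continuous_on_endpoint_lipschitz)

lemma continuous_on_arc_action:
  "continuous_on {x. T0 \<le> snd x - fst x} (\<lambda>x. arc_action (fst x) (snd x))"
  using arc_action_extend_right arc_action_extend_left by (rule continuous_on_endpoint_lipschitz)

lemma arc_action_deriv_right:
  assumes "T0 < t - s"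
  shows "(arc_action s has_real_derivative - (1 / 2 * (landing_speed s t)\<^sup>2)) (at t)"
proof (rule has_real_derivative_forward_expansion)
  define \<delta> where "\<delta> = min 1 (t - s - T0)"
  show "0 < \<delta>" using assms by (simp add: \<delta>_def)
  have "continuous_on {s + T0<..} (\<lambda>r. landing_speed (fst (s, r)) (snd (s, r)))"
    by (intro continuous_on_compose2[OF continuous_on_landing_speed] continuous_on_Pair
        continuous_on_const continuous_on_id) auto
  then have "isCont (landing_speed s) t"
    using continuous_on_interior[of "{s + T0<..}" "landing_speed s" t] assms
    by (simp add: interior_open)
  then show "isCont (\<lambda>r. - (1 / 2 * (landing_speed s r)\<^sup>2)) t" by (intro continuous_intros)
  show "\<bar>arc_action s z - arc_action s y - - (1 / 2 * (landing_speed s y)\<^sup>2) * (z - y)\<bar>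
      \<le> action_remainder (t - s + 1) * (z - y)\<^sup>2"
    if "y \<in> ball t \<delta>" "z \<in> ball t \<delta>" "y \<le> z" for y z
    using arc_action_expand_right[of y s z "t - s + 1"] that by (auto simp: \<delta>_def dist_real_def)
qed

lemma arc_action_deriv_left:
  assumes "T0 < t - s"
  shows "((\<lambda>s. arc_action s t) has_real_derivative 1 / 2 * (launch_speed s t)\<^sup>2) (at s)"
proof -
  interpret reflected: arc_threshold g "\<lambda>x. p (- x)" g_inf avg Lip p_max T0
    by (rule arc_threshold_reflect)
  have "((\<lambda>r. reflected.arc_action (- t) (- r)) has_real_derivative 1 / 2 * (launch_speed s t)\<^sup>2) (at s)"
    using reflected.arc_action_deriv_right[of "- s" "- t"] assms
    by (simp add: DERIV_mirror reflected_landing_speed)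
  then show ?thesis
  proof (rule DERIV_cong_ev[THEN iffD1, rotated -1])
    have "\<forall>\<^sub>F r in nhds s. r < t - T0" using assms
      by (intro order_tendstoD(2)[OF filterlim_ident]) auto
    then show "\<forall>\<^sub>F r in nhds s. reflected.arc_action (- t) (- r) = arc_action r t"
      by eventually_elim (simp add: reflected_arc_action)
  qed auto
qed

end

lemma abs_power2_diff_le:
  fixes x y :: "'a :: linordered_idom"
  assumes "\<bar>x\<bar> \<le> b" "\<bar>y\<bar> \<le> c"
  shows "\<bar>x\<^sup>2 - y\<^sup>2\<bar> \<le> (b + c) * \<bar>x - y\<bar>"
proof -
  have "\<bar>x\<^sup>2 - y\<^sup>2\<bar> = \<bar>x + y\<bar> * \<bar>x - y\<bar>"
    by (simp add: power2_eq_square square_diff_square_factored abs_mult mult.commute)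
  also have "\<dots> \<le> (b + c) * \<bar>x - y\<bar>" using assms by (intro mult_right_mono) auto
  finally show ?thesis .
qed

context arc_threshold
begin

lemma eventually_speeds:
  assumes "0 < \<eta>"
  shows "\<forall>\<^sub>F T in at_top. \<forall>s. \<bar>landing_speed s (s + T) - excess / 2 * T\<bar> \<le> \<eta> * T \<and>
    \<bar>launch_speed s (s + T) - excess / 2 * T\<bar> \<le> \<eta> * T"
  using eventually_forcing_mean[OF assms] eventually_ge_at_top[of T0]
proof (eventually_elim, intro allI)
  fix T s
  assume mean: "\<forall>s u. arc_profile s (s + T) u \<longrightarrow> (\<forall>x y. s \<le> x \<longrightarrow> x \<le> y \<longrightarrow> y \<le> s + T \<longrightarrow>
      \<bar>integral {x..y} (\<lambda>r. g (u r) - p r - excess)\<bar> \<le> \<eta> * T)" and "T0 \<le> T"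
  let ?u = "arc s (s + T)" and ?u' = "arc_deriv s (s + T)"
  have arc: "positive_arc s (s + T) ?u ?u'" using \<open>T0 \<le> T\<close> by (intro positive_arc_arc) simp
  have second: "second_primitive s (s + T) (\<lambda>x. - (g (?u x) - p x)) ?u ?u'"
    using positive_arcD(1)[OF arc] by simp
  have "\<bar>integral {x..y} (\<lambda>r. g (?u r) - p r - excess)\<bar> \<le> \<eta> * T"
    if "s \<le> x" "x \<le> y" "y \<le> s + T" for x y
    using mean positive_arcD(4)[OF arc] that by blast
  from dirichlet_parabola_approx(2,3)[OF second _ positive_arcD(2,3)[OF arc] this]
  show "\<bar>landing_speed s (s + T) - excess / 2 * T\<bar> \<le> \<eta> * T \<and>
      \<bar>launch_speed s (s + T) - excess / 2 * T\<bar> \<le> \<eta> * T"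
    using \<open>T0 \<le> T\<close> T0_pos by (simp add: landing_speed_def launch_speed_def)
qed

lemma eventually_landing_speed_square:
  assumes "0 < \<eta>"
  shows "\<forall>\<^sub>F T in at_top. \<forall>s. \<bar>(landing_speed s (s + T))\<^sup>2 - (excess / 2 * T)\<^sup>2\<bar> \<le> \<eta> * T\<^sup>2"
proof -
  define c where "c = force_bound + excess / 2"
  have "0 < c" using force_bound_nonneg excess_pos by (simp add: c_def)
  show ?thesis
    using eventually_speeds[OF divide_pos_pos[OF assms \<open>0 < c\<close>]] eventually_ge_at_top[of T0]
  proof (eventually_elim, intro allI)
    fix T s
    let ?V = "landing_speed s (s + T)"
    assume "\<forall>s. \<bar>landing_speed s (s + T) - excess / 2 * T\<bar> \<le> \<eta> / c * T \<and>
        \<bar>launch_speed s (s + T) - excess / 2 * T\<bar> \<le> \<eta> / c * T" and "T0 \<le> T"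
    then have V: "\<bar>?V - excess / 2 * T\<bar> \<le> \<eta> / c * T" "0 < T" using T0_pos by auto
    have "\<bar>?V\<^sup>2 - (excess / 2 * T)\<^sup>2\<bar> \<le> (force_bound * T + excess / 2 * T) * \<bar>?V - excess / 2 * T\<bar>"
      using landing_speed_le[of "s + T" s] \<open>T0 \<le> T\<close> V(2) excess_pos
      by (intro abs_power2_diff_le) auto
    also have "\<dots> = c * T * \<bar>?V - excess / 2 * T\<bar>" by (simp add: c_def distrib_right)
    also have "\<dots> \<le> c * T * (\<eta> / c * T)" using V \<open>0 < c\<close> by (intro mult_left_mono) auto
    also have "\<dots> = \<eta> * T\<^sup>2" using \<open>0 < c\<close> by (simp add: power2_eq_square)
    finally show "\<bar>?V\<^sup>2 - (excess / 2 * T)\<^sup>2\<bar> \<le> \<eta> * T\<^sup>2" .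
  qed
qed

lemma arc_action_excess_le:
  assumes "T0 < T1" "T1 \<le> T"
    and square: "\<And>r. T1 \<le> r \<Longrightarrow> \<bar>(landing_speed s (s + r))\<^sup>2 - (excess / 2 * r)\<^sup>2\<bar> \<le> \<eta> * r\<^sup>2"
  shows "\<bar>(arc_action s (s + T) + excess\<^sup>2 / 24 * T ^ 3)
      - (arc_action s (s + T1) + excess\<^sup>2 / 24 * T1 ^ 3)\<bar>
    \<le> \<eta> / 2 * T\<^sup>2 * (T - T1)"
proof -
  have "0 < T1" using assms T0_pos by simp
  have "0 \<le> \<eta> * T1\<^sup>2" using square[of T1] by linarith
  then have "0 \<le> \<eta>" using \<open>0 < T1\<close> by (simp add: zero_le_mult_iff)
  let ?\<psi> = "\<lambda>r. arc_action s (s + r) + excess\<^sup>2 / 24 * r ^ 3"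
  let ?D = "\<lambda>r. - (1 / 2 * (landing_speed s (s + r))\<^sup>2) + excess\<^sup>2 / 24 * (3 * r\<^sup>2)"
  have "(?\<psi> has_real_derivative ?D r) (at r within {T1..T})" if "r \<in> {T1..T}" for r
  proof -
    have "((\<lambda>r. arc_action s (s + r)) has_real_derivative
        - (1 / 2 * (landing_speed s (s + r))\<^sup>2)) (at r)"
      using arc_action_deriv_right[of "r + s" s] that assms by (simp add: DERIV_shift add.commute)
    moreover have "((\<lambda>r. excess\<^sup>2 / 24 * r ^ 3) has_real_derivative excess\<^sup>2 / 24 * (3 * r\<^sup>2)) (at r)"
      by (auto intro!: derivative_eq_intros)
    ultimately show ?thesis by (rule has_field_derivative_at_within[OF DERIV_add])
  qed
  moreover have "norm (?D r) \<le> \<eta> / 2 * T\<^sup>2" if "r \<in> {T1..T}" for r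
  proof -
    have "\<bar>(landing_speed s (s + r))\<^sup>2 - (excess / 2 * r)\<^sup>2\<bar> \<le> \<eta> * r\<^sup>2" using that
      by (intro square) simp
    also have "\<dots> \<le> \<eta> * T\<^sup>2" using that \<open>0 \<le> \<eta>\<close> \<open>0 < T1\<close> by (intro mult_left_mono power_mono) auto
    finally have "\<bar>(landing_speed s (s + r))\<^sup>2 - (excess / 2 * r)\<^sup>2\<bar> / 2 \<le> \<eta> / 2 * T\<^sup>2" by simp
    moreover have "?D r = - ((landing_speed s (s + r))\<^sup>2 - (excess / 2 * r)\<^sup>2) / 2"
      by (simp add: power_mult_distrib power_divide field_simps)
    ultimately show ?thesis by (simp only: real_norm_def abs_divide abs_minus_cancel abs_numeral)
  qed
  ultimately have "norm (?\<psi> T - ?\<psi> T1) \<le> \<eta> / 2 * T\<^sup>2 * norm (T - T1)"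
    using assms by (intro field_differentiable_bound[where S = "{T1..T}"]) auto
  then show ?thesis using assms by simp
qed

lemma eventually_arc_action:
  assumes "0 < \<eta>"
  shows "\<forall>\<^sub>F T in at_top. \<forall>s. \<bar>arc_action s (s + T) + excess\<^sup>2 / 24 * T ^ 3\<bar> \<le> \<eta> * T ^ 3"
proof -
  obtain T1 where T1: "T0 < T1"
    "\<And>T s. T1 \<le> T \<Longrightarrow> \<bar>(landing_speed s (s + T))\<^sup>2 - (excess / 2 * T)\<^sup>2\<bar> \<le> \<eta> * T\<^sup>2"
    using eventually_conj[OF eventually_gt_at_top[of T0] eventually_landing_speed_square[OF assms]]
    unfolding eventually_at_top_linorder by blast
  define B where "B = 2 * force_bound * (force_bound * T1\<^sup>2) * T1 + excess\<^sup>2 / 24 * T1 ^ 3"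
  have "\<bar>arc_action s (s + T1) + excess\<^sup>2 / 24 * T1 ^ 3\<bar> \<le> B" for s
    using arc_action_le[of "s + T1" s]
      abs_triangle_ineq[of "arc_action s (s + T1)" "excess\<^sup>2 / 24 * T1 ^ 3"]
      T1(1) T0_pos by (simp add: B_def)
  note start = this
  have "filterlim (\<lambda>T :: real. \<eta> / 2 * T ^ 3) at_top at_top"
    using assms by (intro filterlim_tendsto_pos_mult_at_top[OF tendsto_const] filterlim_pow_at_top
        filterlim_ident) auto
  then have "\<forall>\<^sub>F T in at_top. B \<le> \<eta> / 2 * T ^ 3" by (simp add: filterlim_at_top)
  with eventually_ge_at_top[of T1] show ?thesis
  proof (eventually_elim, intro allI)
    fix T s assume "T1 \<le> T" and B: "B \<le> \<eta> / 2 * T ^ 3"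
    have "\<eta> / 2 * T\<^sup>2 * (T - T1) \<le> \<eta> / 2 * T\<^sup>2 * T" using assms T1(1) T0_pos
      by (intro mult_left_mono) auto
    also have "\<dots> = \<eta> / 2 * T ^ 3" by (simp add: power2_eq_square power3_eq_cube)
    finally show "\<bar>arc_action s (s + T) + excess\<^sup>2 / 24 * T ^ 3\<bar> \<le> \<eta> * T ^ 3"
      using arc_action_excess_le[OF T1(1) \<open>T1 \<le> T\<close> T1(2), of s] start[of s] B by linarith
  qed
qed

definition asymptotic_regime :: "real \<Rightarrow> real \<Rightarrow> bool" where
  "asymptotic_regime s t \<longleftrightarrow> T0 < t - s \<and>
     \<bar>landing_speed s t - excess * (t - s) / 2\<bar> \<le> excess * (t - s) / 100 \<and>
     \<bar>launch_speed s t - excess * (t - s) / 2\<bar> \<le> excess * (t - s) / 100 \<and>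
     \<bar>arc_action s t + (excess * (t - s)) ^ 3 / (24 * excess)\<bar>
       \<le> (excess * (t - s)) ^ 3 / (24 * excess) / 10"

lemma eventually_asymptotic_regime:
  "\<forall>\<^sub>F \<tau> in at_top. \<forall>s t. \<tau> \<le> excess * (t - s) \<longrightarrow> asymptotic_regime s t"
proof -
  have "0 < excess / 100" "0 < excess\<^sup>2 / 240" using excess_pos by auto
  note speeds = eventually_speeds[OF this(1)] and action = eventually_arc_action[OF this(2)]
  obtain T1 where T1: "\<And>T s. T1 \<le> T \<Longrightarrow> T0 < T \<and>
      \<bar>landing_speed s (s + T) - excess / 2 * T\<bar> \<le> excess / 100 * T \<and>
      \<bar>launch_speed s (s + T) - excess / 2 * T\<bar> \<le> excess / 100 * T \<and>
      \<bar>arc_action s (s + T) + excess\<^sup>2 / 24 * T ^ 3\<bar> \<le> excess\<^sup>2 / 240 * T ^ 3"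
    using eventually_conj[OF eventually_gt_at_top[of T0] eventually_conj[OF speeds action]]
    unfolding eventually_at_top_linorder by blast
  have cube: "(excess * T) ^ 3 / (24 * excess) = excess\<^sup>2 / 24 * T ^ 3" for T
    using excess_pos by (simp add: power_mult_distrib power2_eq_square power3_eq_cube)
  show ?thesis
    using eventually_ge_at_top[of "excess * T1"]
  proof (eventually_elim, intro allI impI)
    fix \<tau> s t assume "excess * T1 \<le> \<tau>" "\<tau> \<le> excess * (t - s)"
    then have "excess * T1 \<le> excess * (t - s)" by linarith
    then have "T1 \<le> t - s" using excess_pos by simp
    from T1[OF this, of s] show "asymptotic_regime s t" unfolding asymptotic_regime_def cube by simp
  qed
qed

end

section \<open>Chains of arcs\<close>

lemma compact_product_intervals:
  fixes l u :: "'a \<Rightarrow> real"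
  shows "compact {t. \<forall>i. l i \<le> t i \<and> t i \<le> u i}"
proof -
  have "compactin (product_topology (\<lambda>i::'a. euclidean :: real topology) UNIV) (PiE UNIV (\<lambda>i. {l i..u i}))"
    by (subst compactin_PiE) auto
  then have "compact (PiE UNIV (\<lambda>i. {l i..u i}))" by (simp add: euclidean_product_topology)
  moreover have "PiE UNIV (\<lambda>i. {l i..u i}) = {t. \<forall>i. l i \<le> t i \<and> t i \<le> u i}"
    by (auto simp: PiE_def Pi_def)
  ultimately show ?thesis by simp
qed

lemma deriv_at_interval_max:
  assumes f: "(f has_real_derivative D) (at x)" and x: "x \<in> {l..u}"
    and max: "\<And>y. y \<in> {l..u} \<Longrightarrow> f y \<le> f x"
  shows "x < u \<Longrightarrow> D \<le> 0" and "l < x \<Longrightarrow> 0 \<le> D"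
proof -
  show "D \<le> 0" if "x < u"
  proof (rule ccontr)
    assume "\<not> D \<le> 0"
    with DERIV_pos_inc_right[OF f] obtain d where "0 < d" "\<And>h. 0 < h \<Longrightarrow> h < d \<Longrightarrow> f x < f (x + h)"
      by force
    then have "f x < f (x + min (d / 2) (u - x))" using that by simp
    moreover have "x + min (d / 2) (u - x) \<in> {l..u}" using that x \<open>0 < d\<close> by auto
    ultimately show False using max by fastforce
  qed
  show "0 \<le> D" if "l < x"
  proof (rule ccontr)
    assume "\<not> 0 \<le> D"
    with DERIV_neg_dec_left[OF f] obtain d where "0 < d" "\<And>h. 0 < h \<Longrightarrow> h < d \<Longrightarrow> f x < f (x - h)"
      by force
    then have "f x < f (x - min (d / 2) (x - l))" using that by simp
    moreover have "x - min (d / 2) (x - l) \<in> {l..u}" using that x \<open>0 < d\<close> by auto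
    ultimately show False using max by fastforce
  qed
qed

text \<open>The Boolean argument is the sign of an arc.\<close>
locale arc_chain =
  fixes action landing launch :: "bool \<Rightarrow> real \<Rightarrow> real \<Rightarrow> real" and rate :: "bool \<Rightarrow> real" and \<tau> :: real
  assumes rate_pos: "\<And>b. 0 < rate b" and \<tau>_pos: "0 < \<tau>"
    and action_cont:
      "\<And>b. continuous_on {x. \<tau> \<le> rate b * (snd x - fst x)} (\<lambda>x. action b (fst x) (snd x))"
    and landing_cont:
      "\<And>b. continuous_on {x. \<tau> \<le> rate b * (snd x - fst x)} (\<lambda>x. landing b (fst x) (snd x))"
    and launch_cont:
      "\<And>b. continuous_on {x. \<tau> \<le> rate b * (snd x - fst x)} (\<lambda>x. launch b (fst x) (snd x))"
    and action_deriv_right: "\<And>b s t. \<tau> \<le> rate b * (t - s) \<Longrightarrow>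
      (action b s has_real_derivative - (1 / 2 * (landing b s t)\<^sup>2)) (at t)"
    and action_deriv_left: "\<And>b s t. \<tau> \<le> rate b * (t - s) \<Longrightarrow>
      ((\<lambda>s. action b s t) has_real_derivative 1 / 2 * (launch b s t)\<^sup>2) (at s)"
    and landing_asymptotic: "\<And>b s t. \<tau> \<le> rate b * (t - s) \<Longrightarrow>
      \<bar>landing b s t - rate b * (t - s) / 2\<bar> \<le> rate b * (t - s) / 100"
    and launch_asymptotic: "\<And>b s t. \<tau> \<le> rate b * (t - s) \<Longrightarrow>
      \<bar>launch b s t - rate b * (t - s) / 2\<bar> \<le> rate b * (t - s) / 100"
    and action_asymptotic: "\<And>b s t. \<tau> \<le> rate b * (t - s) \<Longrightarrow>
      \<bar>action b s t + (rate b * (t - s)) ^ 3 / (24 * rate b)\<bar>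
        \<le> (rate b * (t - s)) ^ 3 / (24 * rate b) / 10"
begin

definition scaled_gap :: "bool \<Rightarrow> real \<Rightarrow> real \<Rightarrow> real" where
  "scaled_gap b s t = rate b * (t - s)"

definition admissible :: "bool \<Rightarrow> real \<Rightarrow> real \<Rightarrow> bool" where
  "admissible b s t \<longleftrightarrow> \<tau> \<le> scaled_gap b s t \<and> scaled_gap b s t \<le> 5 * \<tau>"

text \<open>Two successive arcs of equal scaled gap \<open>l\<close> have total length \<open>l * pair_scale\<close>.\<close>
definition pair_scale :: real where
  "pair_scale = 1 / rate True + 1 / rate False"

definition min_gap :: real where
  "min_gap = min (\<tau> / rate True) (\<tau> / rate False)"

definition max_gap :: real where
  "max_gap = 5 * \<tau> * pair_scale"

text \<open>Any factor between \<open>0.51\<close> and \<open>0.99\<close> would do in place of \<open>4/5\<close>: the smaller bound makes it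
  profitable to merge short arcs, the larger one to split long arcs.\<close>
definition arc_cost :: real where
  "arc_cost = 4 / 5 * (pair_scale * \<tau> ^ 3)"

definition admissible_on :: "nat \<Rightarrow> nat \<Rightarrow> (nat \<Rightarrow> real) \<Rightarrow> bool" where
  "admissible_on i j t \<longleftrightarrow> (\<forall>k\<in>{i..<j}. admissible (even k) (t k) (t (Suc k)))"

definition chain_value :: "nat \<Rightarrow> nat \<Rightarrow> (nat \<Rightarrow> real) \<Rightarrow> real" where
  "chain_value i j t = (\<Sum>k=i..<j. action (even k) (t k) (t (Suc k)) - arc_cost)"

lemma pair_scale_eq: "pair_scale = 1 / rate b + 1 / rate (\<not> b)"
  by (cases b) (auto simp: pair_scale_def)

lemma pair_scale_pos: "0 < pair_scale" using rate_pos by (simp add: pair_scale_def add_pos_pos)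

lemma min_gap_pos: "0 < min_gap" using rate_pos \<tau>_pos by (simp add: min_gap_def)

lemma max_gap_pos: "0 < max_gap" using \<tau>_pos pair_scale_pos by (simp add: max_gap_def)

lemma admissible_scaled_gap: "admissible b s t \<Longrightarrow> \<tau> \<le> rate b * (t - s)"
  by (simp add: admissible_def scaled_gap_def)

lemma admissible_gap_ge:
  assumes "admissible b s t"
  shows "min_gap \<le> t - s"
proof -
  have "min_gap \<le> \<tau> / rate b" by (cases b) (auto simp: min_gap_def)
  also have "\<dots> \<le> t - s"
    using admissible_scaled_gap[OF assms] rate_pos[of b] by (simp add: field_simps)
  finally show ?thesis .
qed

lemma admissible_gap_le:
  assumes "admissible b s t"
  shows "t - s \<le> max_gap"
proof -
  have "1 / rate b \<le> pair_scale" using rate_pos[of "\<not> b"] by (simp add: pair_scale_eq[of b])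
  then have "5 * \<tau> * (1 / rate b) \<le> max_gap" unfolding max_gap_def using \<tau>_pos
    by (intro mult_left_mono) auto
  moreover have "t - s \<le> 5 * \<tau> * (1 / rate b)"
    using assms rate_pos[of b] by (simp add: admissible_def scaled_gap_def field_simps)
  ultimately show ?thesis by simp
qed

lemma admissible_on_gap:
  assumes "i \<le> j" "admissible_on i j t"
  shows "min_gap * real (j - i) \<le> t j - t i" "t j - t i \<le> max_gap * real (j - i)"
proof -
  have "min_gap * real (j - i) \<le> t j - t i \<and> t j - t i \<le> max_gap * real (j - i)"
    using assms
  proof (induction j rule: dec_induct)
    case (step j)
    then have "admissible (even j) (t j) (t (Suc j))" "admissible_on i j t"
      by (auto simp: admissible_on_def)
    with step admissible_gap_ge admissible_gap_le
    have "min_gap \<le> t (Suc j) - t j" "t (Suc j) - t j \<le> max_gap"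
      "min_gap * real (j - i) \<le> t j - t i" "t j - t i \<le> max_gap * real (j - i)" by blast+
    moreover have "real (Suc j - i) = real (j - i) + 1" using step.hyps by simp
    ultimately show ?case by (simp add: distrib_left)
  qed simp
  then show "min_gap * real (j - i) \<le> t j - t i" "t j - t i \<le> max_gap * real (j - i)" by auto
qed

lemma admissible_on_subset: "admissible_on i j t \<Longrightarrow> i \<le> i' \<Longrightarrow> j' \<le> j \<Longrightarrow> admissible_on i' j' t"
  by (auto simp: admissible_on_def)

lemma admissible_on_mono:
  assumes "i \<le> j" "admissible_on i j t"
  shows "t i \<le> t j"
proof -
  have "0 \<le> min_gap * real (j - i)" using min_gap_pos by simp
  also have "\<dots> \<le> t j - t i" by (rule admissible_on_gap(1)[OF assms])
  finally show ?thesis by simp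
qed

lemma admissible_on_split:
  "i \<le> j \<Longrightarrow> j \<le> k \<Longrightarrow> admissible_on i k t \<longleftrightarrow> admissible_on i j t \<and> admissible_on j k t"
  unfolding admissible_on_def by (simp flip: ball_Un add: ivl_disj_un_two)

lemma chain_value_split:
  "i \<le> j \<Longrightarrow> j \<le> k \<Longrightarrow> chain_value i k t = chain_value i j t + chain_value j k t"
  by (simp add: chain_value_def sum.atLeastLessThan_concat)

lemma
  assumes "even m = even m'" "\<And>k. k \<le> r \<Longrightarrow> t' (m' + k) = t (m + k)"
  shows admissible_on_shift: "admissible_on m' (m' + r) t' \<longleftrightarrow> admissible_on m (m + r) t"
    and chain_value_shift: "chain_value m' (m' + r) t' = chain_value m (m + r) t"
proof -
  have ball: "(\<forall>k\<in>{m..<m + r}. Q k) \<longleftrightarrow> (\<forall>k<r. Q (m + k))" for Q and m :: nat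
    by (metis atLeastLessThan_iff le_Suc_ex nat_add_left_cancel_less le_add1)
  have same: "t' (m' + k) = t (m + k)" "t' (Suc (m' + k)) = t (Suc (m + k))" if "k < r" for k
    using assms(2)[of k] assms(2)[of "Suc k"] that by auto
  show "admissible_on m' (m' + r) t' \<longleftrightarrow> admissible_on m (m + r) t"
    using assms(1) same by (auto simp: admissible_on_def ball)
  show "chain_value m' (m' + r) t' = chain_value m (m + r) t"
    using assms(1) same by (simp add: chain_value_def sum.atLeastLessThan_shift_0[of _ m]
        sum.atLeastLessThan_shift_0[of _ m'])
qed

lemma admissible_on_pair:
  "admissible_on i (i + 2) t \<longleftrightarrow>
     admissible (even i) (t i) (t (i + 1)) \<and> admissible (odd i) (t (i + 1)) (t (i + 2))"
proof -
  have "{i..<i + 2} = {i, i + 1}" by auto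
  then show ?thesis by (simp add: admissible_on_def)
qed

lemma chain_value_pair:
  "chain_value i (i + 2) t =
     action (even i) (t i) (t (i + 1)) + action (odd i) (t (i + 1)) (t (i + 2)) - 2 * arc_cost"
proof -
  have "{i..<i + 2} = {i, i + 1}" by auto
  then show ?thesis by (simp add: chain_value_def)
qed

lemma
  shows admissible_on_two_pairs:
      "admissible_on i (i + 4) t \<longleftrightarrow> admissible_on i (i + 2) t \<and> admissible_on (i + 2) (i + 2 + 2) t"
    and chain_value_two_pairs:
      "chain_value i (i + 4) t = chain_value i (i + 2) t + chain_value (i + 2) (i + 2 + 2) t"
proof -
  have "i + 4 = i + 2 + 2" by simp
  then show "admissible_on i (i + 4) t \<longleftrightarrow> admissible_on i (i + 2) t
      \<and> admissible_on (i + 2) (i + 2 + 2) t"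
    "chain_value i (i + 4) t = chain_value i (i + 2) t + chain_value (i + 2) (i + 2 + 2) t"
    using admissible_on_split[of i "i + 2" "i + 2 + 2" t]
      chain_value_split[of i "i + 2" "i + 2 + 2" t]
    by (simp_all only:)
qed

section \<open>Optimal chains\<close>

definition feasible :: "real \<Rightarrow> nat \<Rightarrow> (nat \<Rightarrow> real) \<Rightarrow> bool" where
  "feasible X n t \<longleftrightarrow> even n \<and> admissible_on 0 n t \<and> t 0 = - X \<and> t n = X"

definition optimal :: "real \<Rightarrow> nat \<Rightarrow> (nat \<Rightarrow> real) \<Rightarrow> bool" where
  "optimal X n t \<longleftrightarrow>
     feasible X n t \<and> (\<forall>n' t'. feasible X n' t' \<longrightarrow> chain_value 0 n' t' \<le> chain_value 0 n t)"

lemma feasible_splice: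
  assumes t: "feasible X n t" and "i + m \<le> n" "even m = even m'"
    and q: "admissible_on i (i + m') q" "\<And>k. k \<le> i \<Longrightarrow> q k = t k" "q (i + m') = t (i + m)"
  obtains n' t' where "feasible X n' t'"
    "chain_value 0 n' t' - chain_value i (i + m') q = chain_value 0 n t - chain_value i (i + m) t"
proof -
  obtain r where n: "n = i + m + r" using assms(2) le_Suc_ex by blast
  define t' where "t' k = (if k \<le> i + m' then q k else t (k + m - m'))" for k
  have tail_eq: "t' (i + m' + k) = t (i + m + k)" for k
    using q(3) by (cases k) (auto simp: t'_def algebra_simps)
  have head: "admissible_on 0 i t' \<longleftrightarrow> admissible_on 0 i t" "chain_value 0 i t' = chain_value 0 i t"
    using q(2) admissible_on_shift[of 0 0 i t' t] chain_value_shift[of 0 0 i t' t]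
    by (auto simp: t'_def)
  have middle: "admissible_on i (i + m') t' \<longleftrightarrow> admissible_on i (i + m') q"
    "chain_value i (i + m') t' = chain_value i (i + m') q"
    using admissible_on_shift[of i i m' t' q] chain_value_shift[of i i m' t' q]
    by (auto simp: t'_def)
  have tail: "admissible_on (i + m') (i + m' + r) t' \<longleftrightarrow> admissible_on (i + m) (i + m + r) t"
    "chain_value (i + m') (i + m' + r) t' = chain_value (i + m) (i + m + r) t"
    using assms(3) tail_eq admissible_on_shift[of "i + m" "i + m'" r t' t]
      chain_value_shift[of "i + m" "i + m'" r t' t] by auto
  have "feasible X (i + m' + r) t'"
    unfolding feasible_def
  proof (intro conjI)
    show "admissible_on 0 (i + m' + r) t'"
      using t q(1) head(1) middle(1) tail(1)
        admissible_on_split[of 0 "i + m" n t] admissible_on_split[of 0 i "i + m" t]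
        admissible_on_split[of 0 "i + m'" "i + m' + r" t'] admissible_on_split[of 0 i "i + m'" t']
      by (auto simp: feasible_def n)
  qed (use t q(2) assms(3) tail_eq[of r] in \<open>auto simp: feasible_def n t'_def\<close>)
  moreover have
    "chain_value 0 (i + m' + r) t' - chain_value i (i + m') q
        = chain_value 0 n t - chain_value i (i + m) t"
    using head(2) middle(2) tail(2)
      chain_value_split[of 0 "i + m" n t] chain_value_split[of 0 i "i + m" t]
      chain_value_split[of 0 "i + m'" "i + m' + r" t'] chain_value_split[of 0 i "i + m'" t']
    by (simp add: n)
  ultimately show ?thesis by (rule that)
qed

lemma optimal_admissible_on:
  assumes "optimal X n t" "j \<le> n"
  shows "admissible_on i j t"
  by (rule admissible_on_subset[of 0 n]) (use assms in \<open>auto simp: optimal_def feasible_def\<close>)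

lemma optimal_replacement_le:
  assumes opt: "optimal X n t" and "i + m \<le> n" "even m = even m'"
    and "admissible_on i (i + m') q" "\<And>k. k \<le> i \<Longrightarrow> q k = t k" "q (i + m') = t (i + m)"
  shows "chain_value i (i + m') q \<le> chain_value i (i + m) t"
proof -
  obtain n' t' where t': "feasible X n' t'"
    "chain_value 0 n' t' - chain_value i (i + m') q = chain_value 0 n t - chain_value i (i + m) t"
    using feasible_splice assms unfolding optimal_def by metis
  have "chain_value 0 n' t' \<le> chain_value 0 n t" using opt t'(1) by (simp add: optimal_def)
  with t'(2) show ?thesis by simp
qed

lemma continuous_on_coordinate_pair:
  fixes f :: "bool \<Rightarrow> real \<Rightarrow> real \<Rightarrow> real" and i j :: 'c
  assumes "continuous_on {x. \<tau> \<le> rate b * (snd x - fst x)} (\<lambda>x. f b (fst x) (snd x))"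
    and "\<And>t. t \<in> S \<Longrightarrow> admissible b (t i) (t j)"
  shows "continuous_on S (\<lambda>t. f b (t i) (t j))"
proof -
  have "continuous_on S (\<lambda>t. (t i, t j))"
    by (intro continuous_on_Pair continuous_on_subset[OF continuous_on_product_coordinates]) auto
  moreover have "(\<lambda>t. (t i, t j)) ` S \<subseteq> {x. \<tau> \<le> rate b * (snd x - fst x)}"
    using assms(2) admissible_scaled_gap by fastforce
  ultimately have "continuous_on S (\<lambda>t. f b (fst (t i, t j)) (snd (t i, t j)))"
    by (rule continuous_on_compose2[OF assms(1)])
  then show ?thesis by simp
qed

lemma closed_admissible:
  fixes i j :: 'c
  shows "closed {t. admissible b (t i) (t j)}"
  unfolding admissible_def scaled_gap_def
  by (intro closed_Collect_conj closed_Collect_le continuous_intros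
    continuous_on_product_coordinates)

definition bounded_chains :: "real \<Rightarrow> nat \<Rightarrow> (nat \<Rightarrow> real) set" where
  "bounded_chains X n = {t. (\<forall>i. - X \<le> t i \<and> t i \<le> X) \<and> admissible_on 0 n t \<and> t 0 = - X \<and> t n = X}"

lemma compact_chain_values: "compact (chain_value 0 n ` bounded_chains X n)"
proof (rule compact_continuous_image)
  have "bounded_chains X n = {t. \<forall>i. - X \<le> t i \<and> t i \<le> X} \<inter>
      ((\<Inter>k\<in>{0..<n}. {t. admissible (even k) (t k) (t (Suc k))}) \<inter> {t. t 0 = - X} \<inter> {t. t n = X})"
    by (auto simp: bounded_chains_def admissible_on_def)
  also have "compact \<dots>"
    by (intro compact_Int_closed compact_product_intervals closed_Int closed_INT ballI
        closed_admissible closed_Collect_eq continuous_intros continuous_on_product_coordinates)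
  finally show "compact (bounded_chains X n)" .
  show "continuous_on (bounded_chains X n) (chain_value 0 n)"
    unfolding chain_value_def
    by (intro continuous_intros continuous_on_coordinate_pair action_cont)
      (auto simp: bounded_chains_def admissible_on_def)
qed

lemma feasible_bounded_chain:
  assumes "feasible X n t"
  obtains t' where "t' \<in> bounded_chains X n" "chain_value 0 n t' = chain_value 0 n t"
proof
  define t' where "t' k = (if k \<le> n then t k else X)" for k
  have t: "admissible_on 0 n t" "t 0 = - X" "t n = X" using assms by (auto simp: feasible_def)
  have "- X \<le> t' k \<and> t' k \<le> X" for k
    using admissible_on_mono[of 0 k t] admissible_on_mono[of k n t] admissible_on_mono[of 0 n t]
      admissible_on_subset[OF t(1)] t by (auto simp: t'_def)
  moreover have same: "t' (0 + k) = t (0 + k)" if "k \<le> n" for k using that by (simp add: t'_def)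
  have "admissible_on 0 n t'" using admissible_on_shift[of 0 0 n t' t, OF refl same] t(1) by simp
  ultimately show "t' \<in> bounded_chains X n" using t by (auto simp: bounded_chains_def t'_def)
  show "chain_value 0 n t' = chain_value 0 n t" using chain_value_shift[of 0 0 n t' t, OF refl same]
    by simp
qed

lemma feasible_length_le:
  assumes "feasible X n t"
  shows "n \<le> nat \<lceil>2 * X / min_gap\<rceil>"
proof -
  have "min_gap * real n \<le> 2 * X" using admissible_on_gap(1)[of 0 n t] assms
    by (simp add: feasible_def)
  then have "real n \<le> 2 * X / min_gap" using min_gap_pos by (simp add: field_simps)
  then show ?thesis by linarith
qed

lemma optimal_exists:
  assumes "feasible X n0 t0"
  obtains n t where "optimal X n t"
proof -
  let ?I = "{n. even n \<and> n \<le> nat \<lceil>2 * X / min_gap\<rceil>}"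
  let ?R = "\<Union>n\<in>?I. chain_value 0 n ` bounded_chains X n"
  have value_in: "chain_value 0 n t \<in> ?R" if t: "feasible X n t" for n t
  proof -
    obtain t' where "t' \<in> bounded_chains X n" "chain_value 0 n t' = chain_value 0 n t"
      using feasible_bounded_chain[OF t] .
    moreover have "n \<in> ?I" using feasible_length_le[OF t] t by (simp add: feasible_def)
    ultimately show ?thesis by (intro UN_I[of n] image_eqI[of _ _ t']) auto
  qed
  have "compact ?R" by (intro compact_UN compact_chain_values) auto
  moreover have "?R \<noteq> {}" using value_in[OF assms] by blast
  ultimately obtain z where "z \<in> ?R" and max: "\<forall>y\<in>?R. y \<le> z" by (blast dest: compact_attains_sup)
  then obtain n t where "even n" "t \<in> bounded_chains X n" "z = chain_value 0 n t" by blast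
  moreover have "chain_value 0 n' t' \<le> z" if "feasible X n' t'" for n' t'
    using max value_in[OF that] by blast
  ultimately have "optimal X n t" by (auto simp: optimal_def feasible_def bounded_chains_def)
  then show ?thesis by (rule that)
qed

definition optimal_joint :: "bool \<Rightarrow> real \<Rightarrow> real \<Rightarrow> real \<Rightarrow> bool" where
  "optimal_joint b s x z \<longleftrightarrow> admissible b s x \<and> admissible (\<not> b) x z \<and>
    (\<forall>y. admissible b s y \<longrightarrow> admissible (\<not> b) y z \<longrightarrow>
      action b s y + action (\<not> b) y z \<le> action b s x + action (\<not> b) x z)"

lemma optimal_imp_optimal_joint:
  assumes opt: "optimal X n t" and i: "i + 2 \<le> n"
  shows "optimal_joint (even i) (t i) (t (i + 1)) (t (i + 2))"
  unfolding optimal_joint_def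
proof (intro conjI allI impI)
  have "admissible_on i (i + 2) t"
    by (rule optimal_admissible_on[OF opt i])
  then show "admissible (even i) (t i) (t (i + 1))" "admissible (odd i) (t (i + 1)) (t (i + 2))"
    unfolding admissible_on_pair by auto
  fix y assume y: "admissible (even i) (t i) y" "admissible (odd i) y (t (i + 2))"
  then have "admissible_on i (i + 2) (t(i + 1 := y))" unfolding admissible_on_pair by simp
  then have "chain_value i (i + 2) (t(i + 1 := y)) \<le> chain_value i (i + 2) t"
    by (intro optimal_replacement_le[OF opt i]) auto
  then show "action (even i) (t i) y + action (odd i) y (t (i + 2))
      \<le> action (even i) (t i) (t (i + 1)) + action (odd i) (t (i + 1)) (t (i + 2))"
    unfolding chain_value_pair by simp
qed

lemma speed_bounds:
  assumes "admissible b s t"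
  shows "49 / 100 * scaled_gap b s t \<le> landing b s t" "landing b s t \<le> 51 / 100 * scaled_gap b s t"
    "49 / 100 * scaled_gap b s t \<le> launch b s t" "launch b s t \<le> 51 / 100 * scaled_gap b s t"
  using landing_asymptotic[OF admissible_scaled_gap[OF assms]]
    launch_asymptotic[OF admissible_scaled_gap[OF assms]]
  unfolding scaled_gap_def abs_le_iff by auto

lemma speed_pos:
  assumes "admissible b s t"
  shows "0 < landing b s t" "0 < launch b s t"
  using speed_bounds(1,3)[OF assms] \<tau>_pos assms by (auto simp: admissible_def)

lemma admissible_joint_iff:
  "admissible b s y \<and> admissible (\<not> b) y z \<longleftrightarrow>
     y \<in> {max (s + \<tau> / rate b) (z - 5 * \<tau> / rate (\<not> b))..
       min (s + 5 * \<tau> / rate b) (z - \<tau> / rate (\<not> b))}"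
  using rate_pos[of b] rate_pos[of "\<not> b"]
  by (simp add: admissible_def scaled_gap_def field_simps) argo

lemma optimal_joint_boundary:
  assumes joint: "optimal_joint b s x z"
  shows "landing b s x < launch (\<not> b) x z \<Longrightarrow> scaled_gap b s x = 5 * \<tau> \<or> scaled_gap (\<not> b) x z = \<tau>"
    and "launch (\<not> b) x z < landing b s x \<Longrightarrow> scaled_gap b s x = \<tau> \<or> scaled_gap (\<not> b) x z = 5 * \<tau>"
proof -
  let ?v = "landing b s x" and ?w = "launch (\<not> b) x z"
  let ?l = "max (s + \<tau> / rate b) (z - 5 * \<tau> / rate (\<not> b))"
    and ?u = "min (s + 5 * \<tau> / rate b) (z - \<tau> / rate (\<not> b))"
  have adm: "admissible b s x" "admissible (\<not> b) x z"
    and max: "\<And>y. y \<in> {?l..?u} \<Longrightarrow> action b s y + action (\<not> b) y z \<le> action b s x + action (\<not> b) x z"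
    using joint unfolding optimal_joint_def admissible_joint_iff[symmetric] by auto
  have x: "x \<in> {?l..?u}" unfolding admissible_joint_iff[symmetric] using adm ..
  have "((\<lambda>y. action b s y + action (\<not> b) y z) has_real_derivative
      (- (1 / 2 * ?v\<^sup>2) + 1 / 2 * ?w\<^sup>2)) (at x)"
    by (intro DERIV_add action_deriv_right action_deriv_left admissible_scaled_gap adm)
  note deriv = deriv_at_interval_max[OF this x max]
  show "scaled_gap b s x = 5 * \<tau> \<or> scaled_gap (\<not> b) x z = \<tau>" if "?v < ?w"
  proof -
    have "?v\<^sup>2 < ?w\<^sup>2" using that speed_pos(1)[OF adm(1)] by (intro power_strict_mono) auto
    then have "x = ?u" using deriv(1) x by force
    then have "x = s + 5 * \<tau> / rate b \<or> x = z - \<tau> / rate (\<not> b)"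
      by (simp add: min_def split: if_splits)
    then show ?thesis using rate_pos[of b] rate_pos[of "\<not> b"] by (auto simp: scaled_gap_def)
  qed
  show "scaled_gap b s x = \<tau> \<or> scaled_gap (\<not> b) x z = 5 * \<tau>" if "?w < ?v"
  proof -
    have "?w\<^sup>2 < ?v\<^sup>2" using that speed_pos(2)[OF adm(2)] by (intro power_strict_mono) auto
    then have "x = ?l" using deriv(2) x by force
    then have "x = s + \<tau> / rate b \<or> x = z - 5 * \<tau> / rate (\<not> b)"
      by (simp add: max_def split: if_splits)
    then show ?thesis using rate_pos[of b] rate_pos[of "\<not> b"] by (auto simp: scaled_gap_def)
  qed
qed

lemma optimal_joint_comparable:
  assumes joint: "optimal_joint b s x z"
  shows "9 / 10 * scaled_gap b s x \<le> scaled_gap (\<not> b) x z"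
    "9 / 10 * scaled_gap (\<not> b) x z \<le> scaled_gap b s x"
proof -
  have adm: "admissible b s x" "admissible (\<not> b) x z" using joint by (auto simp: optimal_joint_def)
  note bounds = speed_bounds[OF adm(1)] speed_bounds[OF adm(2)] adm[unfolded admissible_def] \<tau>_pos
  consider "landing b s x = launch (\<not> b) x z" | "landing b s x < launch (\<not> b) x z"
    | "launch (\<not> b) x z < landing b s x" by linarith
  then have "9 / 10 * scaled_gap b s x \<le> scaled_gap (\<not> b) x z \<and>
      9 / 10 * scaled_gap (\<not> b) x z \<le> scaled_gap b s x"
    using optimal_joint_boundary[OF joint] bounds by cases auto
  then show "9 / 10 * scaled_gap b s x \<le> scaled_gap (\<not> b) x z"
    "9 / 10 * scaled_gap (\<not> b) x z \<le> scaled_gap b s x" by auto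
qed

definition leading_action :: "bool \<Rightarrow> real \<Rightarrow> real" where
  "leading_action b l = l ^ 3 / (24 * rate b)"

lemma leading_action_mono: "0 \<le> l \<Longrightarrow> l \<le> m \<Longrightarrow> leading_action b l \<le> leading_action b m"
  unfolding leading_action_def using rate_pos[of b] by (intro divide_right_mono power_mono) auto

lemma leading_action_pair: "leading_action b l + leading_action (\<not> b) l = l ^ 3 * pair_scale / 24"
  by (simp add: leading_action_def pair_scale_eq[of b] field_simps)

lemma action_bounds:
  assumes "admissible b s t"
  shows "action b s t \<le> - (9 / 10 * leading_action b (scaled_gap b s t))"
    "- (11 / 10 * leading_action b (scaled_gap b s t)) \<le> action b s t"
  using action_asymptotic[OF admissible_scaled_gap[OF assms],
      folded scaled_gap_def leading_action_def]
  unfolding abs_le_iff by auto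

lemma chain_value_pair_le:
  assumes adm: "admissible_on i (i + 2) t" and "0 \<le> m"
    and "m \<le> scaled_gap (even i) (t i) (t (i + 1))" "m \<le> scaled_gap (odd i) (t (i + 1)) (t (i + 2))"
  shows "chain_value i (i + 2) t \<le> - (9 / 10 * (m ^ 3 * pair_scale / 24)) - 2 * arc_cost"
proof -
  have "leading_action (even i) m \<le> leading_action (even i) (scaled_gap (even i) (t i) (t (i + 1)))"
    "leading_action (odd i) m \<le> leading_action (odd i) (scaled_gap (odd i) (t (i + 1)) (t (i + 2)))"
    using assms by (auto intro: leading_action_mono)
  moreover have "action (even i) (t i) (t (i + 1)) \<le>
      - (9 / 10 * leading_action (even i) (scaled_gap (even i) (t i) (t (i + 1))))"
    "action (odd i) (t (i + 1)) (t (i + 2)) \<le>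
      - (9 / 10 * leading_action (odd i) (scaled_gap (odd i) (t (i + 1)) (t (i + 2))))"
    using adm by (auto simp only: admissible_on_pair intro: action_bounds(1))
  ultimately show ?thesis
    using leading_action_pair[of "even i" m] unfolding chain_value_pair by linarith
qed

lemma balanced_pair:
  assumes l: "\<tau> \<le> l" "l \<le> 5 * \<tau>"
    and q: "q (i + 1) = q i + l / rate (even i)" "q (i + 2) = q i + l * pair_scale"
  shows "admissible_on i (i + 2) q"
    "- (11 / 10 * (l ^ 3 * pair_scale / 24)) - 2 * arc_cost \<le> chain_value i (i + 2) q"
proof -
  have gaps: "scaled_gap (even i) (q i) (q (i + 1)) = l"
    "scaled_gap (odd i) (q (i + 1)) (q (i + 2)) = l"
    unfolding q pair_scale_eq[of "even i"] using rate_pos[of "even i"] rate_pos[of "odd i"]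
    by (auto simp: scaled_gap_def distrib_left)
  show "admissible_on i (i + 2) q" unfolding admissible_on_pair admissible_def gaps using l by simp
  then show "- (11 / 10 * (l ^ 3 * pair_scale / 24)) - 2 * arc_cost \<le> chain_value i (i + 2) q"
    using action_bounds(2)[of "even i" "q i" "q (i + 1)"]
      action_bounds(2)[of "odd i" "q (i + 1)" "q (i + 2)"]
      leading_action_pair[of "even i" l] unfolding chain_value_pair admissible_on_pair gaps by simp
qed

lemma
  shows pair_length_ge: "m \<le> scaled_gap b s x \<Longrightarrow> m \<le> scaled_gap (\<not> b) x z \<Longrightarrow> m * pair_scale \<le> z - s"
    and pair_length_le: "scaled_gap b s x \<le> m \<Longrightarrow> scaled_gap (\<not> b) x z \<le> m \<Longrightarrow> z - s \<le> m * pair_scale"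
proof -
  have split: "m * pair_scale = m / rate b + m / rate (\<not> b)"
    by (simp add: pair_scale_eq[of b] distrib_left)
  note rates = rate_pos[of b] rate_pos[of "\<not> b"]
  show "m * pair_scale \<le> z - s" if "m \<le> scaled_gap b s x" "m \<le> scaled_gap (\<not> b) x z"
  proof -
    have "m / rate b \<le> x - s" "m / rate (\<not> b) \<le> z - x" using that rates
      by (auto simp: scaled_gap_def field_simps)
    then show ?thesis unfolding split by linarith
  qed
  show "z - s \<le> m * pair_scale" if "scaled_gap b s x \<le> m" "scaled_gap (\<not> b) x z \<le> m"
  proof -
    have "x - s \<le> m / rate b" "z - x \<le> m / rate (\<not> b)" using that rates
      by (auto simp: scaled_gap_def field_simps)
    then show ?thesis unfolding split by linarith
  qed
qed

text \<open>Two almost maximal gaps are better replaced by four equal ones, because the action is of cubic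
  order in the gap.\<close>
lemma optimal_not_long:
  assumes opt: "optimal X n t" and i: "i + 2 \<le> n"
  shows "scaled_gap (even i) (t i) (t (i + 1)) < 9 / 2 * \<tau>
      \<or> scaled_gap (odd i) (t (i + 1)) (t (i + 2)) < 9 / 2 * \<tau>"
proof (rule ccontr)
  assume "\<not> ?thesis"
  then have long: "9 / 2 * \<tau> \<le> scaled_gap (even i) (t i) (t (i + 1))"
    "9 / 2 * \<tau> \<le> scaled_gap (odd i) (t (i + 1)) (t (i + 2))" by auto
  have adm: "admissible_on i (i + 2) t"
    by (rule optimal_admissible_on[OF opt i])
  define l where "l = (t (i + 2) - t i) / (2 * pair_scale)"
  have "9 / 2 * \<tau> * pair_scale \<le> t (i + 2) - t i" "t (i + 2) - t i \<le> 5 * \<tau> * pair_scale"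
    using pair_length_ge[OF long] adm
      pair_length_le[of "even i" "t i" "t (i + 1)" "5 * \<tau>" "t (i + 2)"]
    unfolding admissible_on_pair admissible_def by auto
  then have l: "9 / 4 * \<tau> \<le> l" "l \<le> 5 / 2 * \<tau>" using pair_scale_pos
    by (auto simp: l_def field_simps)
  then have l_range: "\<tau> \<le> l" "l \<le> 5 * \<tau>" using \<tau>_pos by auto
  define q where "q = t(i + 1 := t i + l / rate (even i), i + 2 := t i + l * pair_scale,
    i + 3 := t i + l * pair_scale + l / rate (even i), i + 4 := t (i + 2))"
  have "t (i + 2) = t i + l * pair_scale + l * pair_scale" using pair_scale_pos by (simp add: l_def)
  then have q: "q (i + 1) = q i + l / rate (even i)" "q (i + 2) = q i + l * pair_scale"
    "q (i + 2 + 1) = q (i + 2) + l / rate (even (i + 2))"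
    "q (i + 2 + 2) = q (i + 2) + l * pair_scale"
    by (simp_all add: q_def)
  note first = balanced_pair[OF l_range q(1,2)] and second = balanced_pair[OF l_range q(3,4)]
  have "admissible_on i (i + 4) q" using first(1) second(1) admissible_on_two_pairs by blast
  moreover have "q k = t k" if "k \<le> i" for k using that by (simp add: q_def)
  moreover have "q (i + 4) = t (i + 2)" by (simp add: q_def)
  ultimately have "chain_value i (i + 4) q \<le> chain_value i (i + 2) t"
    by (intro optimal_replacement_le[OF opt i]) simp_all
  moreover have "chain_value i (i + 2) t
      \<le> - (9 / 10 * ((9 / 2 * \<tau>) ^ 3 * pair_scale / 24)) - 2 * arc_cost"
    using chain_value_pair_le[OF adm _ long] \<tau>_pos by simp
  moreover have "l ^ 3 * pair_scale \<le> (5 / 2 * \<tau>) ^ 3 * pair_scale"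
    using l l_range \<tau>_pos pair_scale_pos by (intro mult_right_mono power_mono) auto
  ultimately have "9 / 10 * ((9 / 2 * \<tau>) ^ 3 * pair_scale / 24)
      \<le> 22 / 10 * ((5 / 2 * \<tau>) ^ 3 * pair_scale / 24) + 2 * arc_cost"
    using first(2) second(2) chain_value_two_pairs[of i q] by linarith
  moreover have "0 < pair_scale * \<tau> ^ 3" using pair_scale_pos \<tau>_pos by simp
  ultimately show False by (simp add: arc_cost_def power_mult_distrib power_divide)
qed

text \<open>Four almost minimal gaps are better merged into two, because of the cost per arc.\<close>
lemma optimal_not_short:
  assumes opt: "optimal X n t" and i: "i + 4 \<le> n"
  shows "\<exists>k\<in>{i..<i + 4}. 7 / 5 * \<tau> < scaled_gap (even k) (t k) (t (k + 1))"
proof (rule ccontr)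
  assume "\<not> ?thesis"
  then have short: "scaled_gap (even k) (t k) (t (k + 1)) \<le> 7 / 5 * \<tau>" if "i \<le> k" "k < i + 4" for k
    using that by force
  have adm: "admissible_on k (k + 2) t" if "k \<le> i + 2" for k
    using i that by (intro optimal_admissible_on[OF opt]) simp
  have pair: "\<tau> * pair_scale \<le> t (k + 2) - t k" "t (k + 2) - t k \<le> 7 / 5 * \<tau> * pair_scale"
    "chain_value k (k + 2) t \<le> - 2 * arc_cost" if "k \<in> {i, i + 2}" for k
  proof -
    have "admissible_on k (k + 2) t" using that adm by auto
    moreover have "0 \<le> pair_scale * \<tau> ^ 3" using \<tau>_pos pair_scale_pos by simp
    ultimately show "\<tau> * pair_scale \<le> t (k + 2) - t k" "chain_value k (k + 2) t \<le> - 2 * arc_cost"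
      using pair_length_ge[of \<tau> "even k" "t k" "t (k + 1)" "t (k + 2)"]
        chain_value_pair_le[of k t \<tau>] \<tau>_pos
      unfolding admissible_on_pair admissible_def by auto
    show "t (k + 2) - t k \<le> 7 / 5 * \<tau> * pair_scale"
      using pair_length_le[of "even k" "t k" "t (k + 1)" "7 / 5 * \<tau>" "t (k + 2)"]
        short[of k] short[of "k + 1"] that
      by auto
  qed
  define l where "l = (t (i + 4) - t i) / pair_scale"
  have "2 * \<tau> * pair_scale \<le> t (i + 4) - t i" "t (i + 4) - t i \<le> 14 / 5 * \<tau> * pair_scale"
    using pair(1,2)[of i] pair(1,2)[of "i + 2", unfolded add.assoc] by auto
  then have l: "2 * \<tau> \<le> l" "l \<le> 14 / 5 * \<tau>" using pair_scale_pos by (auto simp: l_def field_simps)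
  then have l_range: "\<tau> \<le> l" "l \<le> 5 * \<tau>" using \<tau>_pos by auto
  define q where "q = t(i + 1 := t i + l / rate (even i), i + 2 := t (i + 4))"
  have q: "q (i + 1) = q i + l / rate (even i)" "q (i + 2) = q i + l * pair_scale"
    using pair_scale_pos by (simp_all add: q_def l_def)
  note merged = balanced_pair[OF l_range q]
  have "q k = t k" if "k \<le> i" for k using that by (simp add: q_def)
  moreover have "q (i + 2) = t (i + 4)" by (simp add: q_def)
  ultimately have "chain_value i (i + 2) q \<le> chain_value i (i + 4) t"
    using merged(1) by (intro optimal_replacement_le[OF opt i]) simp_all
  moreover have "l ^ 3 * pair_scale \<le> (14 / 5 * \<tau>) ^ 3 * pair_scale"
    using l l_range \<tau>_pos pair_scale_pos by (intro mult_right_mono power_mono) auto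
  ultimately have "2 * arc_cost \<le> 11 / 10 * ((14 / 5 * \<tau>) ^ 3 * pair_scale / 24)"
    using merged(2) pair(3)[of i] pair(3)[of "i + 2"] chain_value_two_pairs[of i t] by simp
  moreover have "0 < pair_scale * \<tau> ^ 3" using pair_scale_pos \<tau>_pos by simp
  ultimately show False by (simp add: arc_cost_def power_mult_distrib power_divide)
qed

lemma optimal_speeds_match:
  assumes opt: "optimal X n t" and n: "4 \<le> n" and i: "i + 2 \<le> n"
  shows "landing (even i) (t i) (t (i + 1)) = launch (odd i) (t (i + 1)) (t (i + 2))"
proof (rule ccontr)
  assume unmatched: "\<not> ?thesis"
  define gap where "gap k = scaled_gap (even k) (t k) (t (k + 1))" for k
  have gap_Suc: "gap (k + 1) = scaled_gap (odd k) (t (k + 1)) (t (k + 2))" for k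
    by (simp add: gap_def)
  have comparable: "9 / 10 * gap k \<le> gap (k + 1)" "9 / 10 * gap (k + 1) \<le> gap k"
    if "k + 2 \<le> n" for k
    using optimal_joint_comparable[OF optimal_imp_optimal_joint[OF opt that]]
    unfolding gap_Suc gap_def[of k] by auto
  have "gap i = 5 * \<tau> \<or> gap (i + 1) = 5 * \<tau> \<or> gap i = \<tau> \<or> gap (i + 1) = \<tau>"
    using unmatched optimal_joint_boundary[OF optimal_imp_optimal_joint[OF opt i]]
    unfolding gap_Suc gap_def[of i]
    by linarith
  moreover have "gap i < 9 / 2 * \<tau> \<or> gap (i + 1) < 9 / 2 * \<tau>"
    using optimal_not_long[OF opt i] unfolding gap_Suc gap_def[of i] .
  ultimately have short: "gap i \<le> 10 / 9 * \<tau>" "gap (i + 1) \<le> 10 / 9 * \<tau>"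
    using comparable[OF i] \<tau>_pos by auto
  define j where "j = min i (n - 4)"
  have j: "j + 4 \<le> n" "i = j \<or> i = j + 1 \<or> i = j + 2" using n i by (auto simp: j_def)
  then have "gap j \<le> 7 / 5 * \<tau> \<and> gap (j + 1) \<le> 7 / 5 * \<tau>
      \<and> gap (j + 2) \<le> 7 / 5 * \<tau> \<and> gap (j + 3) \<le> 7 / 5 * \<tau>"
    using comparable[of j] comparable[of "j + 1"] comparable[of "j + 2"] short \<tau>_pos
    by (auto simp: eval_nat_numeral)
  moreover obtain k where "k \<in> {j..<j + 4}" "7 / 5 * \<tau> < gap k"
    using optimal_not_short[OF opt j(1)] unfolding gap_def by blast
  moreover from this have "k = j \<or> k = j + 1 \<or> k = j + 2 \<or> k = j + 3" by auto
  ultimately show False by auto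
qed

end

section \<open>Bi-infinite chains\<close>

context arc_chain
begin

lemma feasible_exists: "\<exists>t. feasible (pair_scale * \<tau> * real N) (2 * N) t"
proof -
  define X where "X = pair_scale * \<tau> * real N"
  define t where
    "t k = - X + real (k div 2) * (2 * \<tau> * pair_scale) + (if odd k then 2 * \<tau> / rate True else 0)" for k
  have "admissible_on 0 (2 * M) t" for M
  proof (induction M)
    case (Suc M)
    have "admissible_on (2 * M) (2 * M + 2) t"
      using \<tau>_pos by (intro balanced_pair(1)[where l = "2 * \<tau>"]) (auto simp: t_def algebra_simps)
    with Suc show ?case using admissible_on_split[of 0 "2 * M" "2 * M + 2" t] by simp
  qed (simp add: admissible_on_def)
  then have "feasible X (2 * N) t" by (simp add: feasible_def t_def X_def)
  then show ?thesis unfolding X_def by blast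
qed

definition matched :: "(int \<Rightarrow> real) \<Rightarrow> int \<Rightarrow> bool" where
  "matched s i \<longleftrightarrow>
     admissible (even i) (s i) (s (i + 1)) \<and> admissible (odd i) (s (i + 1)) (s (i + 2)) \<and>
     landing (even i) (s i) (s (i + 1)) = launch (odd i) (s (i + 1)) (s (i + 2))"

lemma admissible_on_dist_le:
  assumes "admissible_on 0 n t" "j \<le> n" "k \<le> n"
  shows "\<bar>t k - t j\<bar> \<le> max_gap * \<bar>real k - real j\<bar>"
proof -
  have increasing: "\<bar>t k - t j\<bar> \<le> max_gap * \<bar>real k - real j\<bar>" if "j \<le> k" "k \<le> n" for j k
  proof -
    have "admissible_on j k t" using assms(1) that by (auto intro: admissible_on_subset)
    then show ?thesis
      using admissible_on_gap(2)[OF that(1)] admissible_on_mono[OF that(1)] that(1)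
      by (simp add: of_nat_diff)
  qed
  show ?thesis
    using increasing[of j k] increasing[of k j] assms
    by (cases "j \<le> k") (auto simp: abs_minus_commute)
qed

lemma feasible_pivot:
  assumes t: "feasible X n t" and "0 < X"
  obtains j where "even j" "j \<le> n" "t j \<le> 0" "- (2 * max_gap) \<le> t j"
proof -
  have n: "even n" "admissible_on 0 n t" "t 0 = - X" "t n = X" using t by (auto simp: feasible_def)
  define J where "J = {j. even j \<and> j \<le> n \<and> t j \<le> 0}"
  have "finite J" by (rule finite_subset[of _ "{..n}"]) (auto simp: J_def)
  have "0 \<in> J" using n(3) \<open>0 < X\<close> by (simp add: J_def)
  then have "Max J \<in> J" using Max_in[OF \<open>finite J\<close>] by blast
  then have j: "even (Max J)" "Max J \<le> n" "t (Max J) \<le> 0" by (simp_all add: J_def)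
  then have "Max J \<noteq> n" using n(4) \<open>0 < X\<close> by auto
  moreover have "n \<noteq> Max J + 1" using j(1) n(1) by auto
  ultimately have "Max J + 2 \<le> n" using j(2) by simp
  moreover have "Max J + 2 \<notin> J" using Max_ge[OF \<open>finite J\<close>, of "Max J + 2"] by auto
  ultimately have "0 < t (Max J + 2)" "\<bar>t (Max J + 2) - t (Max J)\<bar> \<le> max_gap * 2"
    using admissible_on_dist_le[OF n(2) j(2), of "Max J + 2"] j(1) by (auto simp: J_def)
  then have "- (2 * max_gap) \<le> t (Max J)" by linarith
  then show ?thesis using that j by blast
qed

lemma optimal_matched:
  assumes opt: "optimal X n t" and k: "k + 2 \<le> n" and "4 \<le> n" and parity: "even (int k) = even i"
    and s: "s i = t k" "s (i + 1) = t (k + 1)" "s (i + 2) = t (k + 2)"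
  shows "matched s i"
proof -
  have "even k = even i" using parity by simp
  then show ?thesis
    using optimal_speeds_match[OF opt \<open>4 \<le> n\<close> k] optimal_imp_optimal_joint[OF opt k]
    unfolding matched_def s optimal_joint_def by simp
qed

lemma matched_segment:
  fixes M :: nat
  shows "\<exists>s. (\<forall>i. \<bar>s i\<bar> \<le> max_gap * (\<bar>real_of_int i\<bar> + 2)) \<and> (\<forall>i. \<bar>i\<bar> \<le> int M \<longrightarrow> matched s i)"
proof -
  define X where "X = max_gap * real (M + 5)"
  have "X = pair_scale * \<tau> * real (5 * (M + 5))" by (simp add: X_def max_gap_def)
  then obtain t0 where "feasible X (2 * (5 * (M + 5))) t0" using feasible_exists by metis
  then obtain n t where opt: "optimal X n t" by (rule optimal_exists)
  then have t: "feasible X n t" "admissible_on 0 n t" "t 0 = - X" "t n = X"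
    by (auto simp: optimal_def feasible_def)
  have "0 < X" using max_gap_pos by (simp add: X_def)
  then obtain j where j: "even j" "j \<le> n" "t j \<le> 0" "- (2 * max_gap) \<le> t j"
    using feasible_pivot[OF t(1)] by blast
  have "max_gap * (real M + 3) = X - 2 * max_gap" by (simp add: X_def algebra_simps)
  also have "\<dots> \<le> max_gap * real j" using admissible_on_dist_le[OF t(2) j(2), of 0] t(3) j(4) by simp
  finally have j_ge: "M + 3 \<le> j" using max_gap_pos by simp
  have "max_gap * real (M + 5) \<le> max_gap * real (n - j)"
    using admissible_on_dist_le[OF t(2) j(2), of n] t(4) j(2,3) by (simp add: X_def of_nat_diff)
  then have n_ge: "M + 5 \<le> n - j" using max_gap_pos by simp
  define index where "index i = nat (max 0 (min (int n) (int j + i)))" for i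
  define s where "s i = t (index i)" for i
  have "\<bar>s i\<bar> \<le> max_gap * (\<bar>real_of_int i\<bar> + 2)" for i
  proof -
    have "\<bar>t (index i) - t j\<bar> \<le> max_gap * \<bar>real (index i) - real j\<bar>"
      using t(2) j(2) by (intro admissible_on_dist_le) (auto simp: index_def)
    also have "\<dots> \<le> max_gap * \<bar>real_of_int i\<bar>"
      using max_gap_pos j(2) by (intro mult_left_mono) (auto simp: index_def)
    finally show ?thesis using j(3,4) by (simp add: s_def distrib_left)
  qed
  moreover have "matched s i" if i: "\<bar>i\<bar> \<le> int M" for i
  proof -
    have "int (index i) = int j + i" using i j_ge n_ge by (simp add: index_def)
    moreover have "index (i + 1) = index i + 1" "index (i + 2) = index i + 2" "index i + 2 \<le> n"
      using i j_ge n_ge by (auto simp: index_def)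
    ultimately show ?thesis
      using j(1) n_ge by (intro optimal_matched[OF opt, of "index i"]) (auto simp: s_def)
  qed
  ultimately show ?thesis by blast
qed

lemma closed_matched: "closed {s. matched s i}"
proof -
  let ?S = "{s. admissible (even i) (s i) (s (i + 1))} \<inter>
    {s. admissible (odd i) (s (i + 1)) (s (i + 2))}"
  let ?f = "\<lambda>s. landing (even i) (s i) (s (i + 1)) - launch (odd i) (s (i + 1)) (s (i + 2))"
  have "continuous_on ?S ?f"
    by (intro continuous_on_diff continuous_on_coordinate_pair landing_cont launch_cont) auto
  moreover have "closed ?S" by (intro closed_Int closed_admissible)
  ultimately have "closed (?S \<inter> ?f -` {0})" by (intro continuous_closed_preimage) auto
  moreover have "?S \<inter> ?f -` {0} = {s. matched s i}" by (auto simp: matched_def)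
  ultimately show ?thesis by simp
qed

text \<open>Tychonoff's theorem passes to the limit \<open>X \<rightarrow> \<infinity>\<close>.\<close>
lemma matched_sequence_exists: "\<exists>s. \<forall>i. matched s i"
proof -
  let ?K = "{s :: int \<Rightarrow> real.
    \<forall>i. - (max_gap * (\<bar>real_of_int i\<bar> + 2)) \<le> s i \<and> s i \<le> max_gap * (\<bar>real_of_int i\<bar> + 2)}"
  have "?K \<inter> (\<Inter>i. {s. matched s i}) \<noteq> {}"
  proof (rule compact_imp_fip_image)
    show "compact ?K" by (rule compact_product_intervals)
    show "closed {s. matched s i}" for i by (rule closed_matched)
    show "?K \<inter> (\<Inter>i\<in>I. {s. matched s i}) \<noteq> {}" if "finite I" for I :: "int set"
    proof -
      have "bdd_above (abs ` I)" using that by simp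
      then obtain M where M: "\<And>i. i \<in> I \<Longrightarrow> \<bar>i\<bar> \<le> M" unfolding bdd_above_def by blast
      obtain s where "\<And>i. \<bar>s i\<bar> \<le> max_gap * (\<bar>real_of_int i\<bar> + 2)"
        "\<And>i. \<bar>i\<bar> \<le> int (nat M) \<Longrightarrow> matched s i"
        using matched_segment[of "nat M"] by blast
      with M have "s \<in> ?K \<inter> (\<Inter>i\<in>I. {s. matched s i})" by (force simp: abs_le_iff minus_le_iff)
      then show ?thesis by blast
    qed
  qed
  then show ?thesis by auto
qed

end

section \<open>Concave saturation\<close>

lemma strictly_convex_on_imp_convex_on:
  assumes "strictly_convex_on S f"
  shows "convex_on S f"
proof (rule convex_onI)
  show "convex S" using assms by (simp add: strictly_convex_on_def)
  fix l x y :: real assume l: "0 < l" "l < 1" and xy: "x \<in> S" "y \<in> S"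
  show "f ((1 - l) *\<^sub>R x + l *\<^sub>R y) \<le> (1 - l) * f x + l * f y"
  proof (cases "x = y")
    case True
    then show ?thesis by (simp add: algebra_simps)
  next
    case False
    then have "f ((1 - l) * x + l * y) < (1 - l) * f x + l * f y"
      using assms l xy unfolding strictly_convex_on_def by blast
    then show ?thesis by simp
  qed
qed

lemma convex_on_reflect:
  fixes f :: "'a :: real_vector \<Rightarrow> real"
  assumes f: "convex_on S f"
  shows "convex_on (uminus ` S) (\<lambda>x. f (- x))"
proof (rule convex_onI)
  show "convex (uminus ` S)" using convex_on_imp_convex[OF f] by (rule convex_negations)
  fix l :: real and x y assume "0 < l" "l < 1" "x \<in> uminus ` S" "y \<in> uminus ` S"
  then show "f (- ((1 - l) *\<^sub>R x + l *\<^sub>R y)) \<le> (1 - l) * f (- x) + l * f (- y)"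
    using convex_onD[OF f, of l "- x" "- y"] by auto
qed

lemma concave_on_le_tangent:
  assumes g: "concave_on A g" and "connected A" "c \<in> interior A" "x \<in> A"
    and "(g has_real_derivative D) (at c within A)"
  shows "g x - g c \<le> D * (x - c)"
  using convex_on_imp_above_tangent[OF g[unfolded concave_on_def] assms(2-4)
    DERIV_minus[OF assms(5)]]
  by (simp add: algebra_simps)

context
  fixes g g' :: "real \<Rightarrow> real"
  assumes deriv: "\<And>x. (g has_real_derivative g' x) (at x)" and deriv_cont: "continuous_on UNIV g'"
    and mono_g: "mono g" and concave: "concave_on {0<..} g"
begin

private lemma le_tangent: "0 < c \<Longrightarrow> 0 < x \<Longrightarrow> g x - g c \<le> g' c * (x - c)"
  using concave_on_le_tangent[OF concave _ _ _ has_field_derivative_at_within[OF deriv]]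
  by (auto simp: interior_open)

private lemma deriv_nonneg: "0 \<le> g' x"
  using mono_on_imp_deriv_nonneg[of UNIV g "g' x" x] mono_g deriv by simp

private lemma deriv_antimono:
  assumes "0 \<le> x" "x \<le> y"
  shows "g' y \<le> g' x"
proof -
  have interior: "g' y \<le> g' x" if "0 < x" "x < y" for x y
  proof -
    have "g' y * (y - x) \<le> g' x * (y - x)"
      using le_tangent[of x y] le_tangent[of y x] that by (simp add: algebra_simps)
    then show ?thesis using that by simp
  qed
  have "g' y \<le> g' 0" if "0 < y"
  proof (rule tendsto_lowerbound)
    show "(g' \<longlongrightarrow> g' 0) (at_right 0)"
      using deriv_cont by (auto simp: continuous_on_def intro: tendsto_within_subset)
    show "\<forall>\<^sub>F w in at_right 0. g' y \<le> g' w"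
      using eventually_at_right_less[of 0] eventually_at_right_real[OF that]
      by eventually_elim (use interior in auto)
  qed simp
  then show ?thesis using interior[of x y] assms by (cases "x = y"; cases "x = 0") auto
qed

lemma concave_diff_le:
  assumes "0 \<le> z" "z \<le> x" "z \<le> y"
  shows "\<bar>g x - g y\<bar> \<le> g' z * \<bar>x - y\<bar>"
proof -
  have "norm (g x - g y) \<le> g' z * norm (x - y)"
    using deriv_nonneg deriv_antimono assms
    by (intro field_differentiable_bound[of "{z..}" g g']
      has_field_derivative_at_within[OF deriv]) auto
  then show ?thesis by simp
qed

lemma saturation_deriv_decay:
  assumes lim: "(g \<longlongrightarrow> g_inf) at_top" and "0 < \<eta>"
  shows "\<forall>\<^sub>F z in at_top. z * g' z \<le> \<eta>"
proof -
  have "filterlim (\<lambda>z :: real. z * (1 / 2)) at_top at_top"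
    by (rule filterlim_at_top_mult_tendsto_pos[OF tendsto_const _ filterlim_ident]) simp
  then have "((\<lambda>z. 2 * (g z - g (z * (1 / 2)))) \<longlongrightarrow> 2 * (g_inf - g_inf)) at_top"
    by (intro tendsto_intros lim filterlim_compose[OF lim])
  then have "\<forall>\<^sub>F z in at_top. 2 * (g z - g (z * (1 / 2))) < \<eta>"
    using order_tendstoD(2) \<open>0 < \<eta>\<close> by fastforce
  with eventually_gt_at_top[of 0] show ?thesis
  proof eventually_elim
    case (elim z)
    then show ?case using le_tangent[of z "z * (1 / 2)"] by (simp add: algebra_simps)
  qed
qed

end

lemma asymptotic_average_integral_le:
  assumes p: "continuous_on UNIV p" "\<And>x. \<bar>p x\<bar> \<le> p_max"
    and avg: "has_asymptotic_average p A" and \<eta>: "0 < \<eta>"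
  shows "\<exists>B. \<forall>x y. x \<le> y \<longrightarrow> \<bar>integral {x..y} p - A * (y - x)\<bar> \<le> \<eta> * (y - x) + B"
proof -
  have "\<forall>\<^sub>F T in at_top. 0 < T \<and> (\<forall>t. dist ((1 / T) * integral {t..t + T} p) A < \<eta>)"
    using eventually_conj[OF eventually_gt_at_top
      uniform_limitD[OF avg[unfolded has_asymptotic_average_def] \<eta>]]
    by simp
  then obtain T0 where T0: "\<And>T t. T0 \<le> T \<Longrightarrow> 0 < T \<and> \<bar>(1 / T) * integral {t..t + T} p - A\<bar> < \<eta>"
    by (auto simp: eventually_at_top_linorder dist_real_def)
  then have "0 < T0" by blast
  have p_max_nonneg: "0 \<le> p_max" using p(2)[of 0] by linarith
  show ?thesis
  proof (intro exI[of _ "(p_max + \<bar>A\<bar>) * T0"] allI impI)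
    fix x y :: real assume "x \<le> y"
    show "\<bar>integral {x..y} p - A * (y - x)\<bar> \<le> \<eta> * (y - x) + (p_max + \<bar>A\<bar>) * T0"
    proof (cases "T0 \<le> y - x")
      case True
      then have "0 < y - x" "\<bar>(1 / (y - x)) * integral {x..y} p - A\<bar> < \<eta>" using T0[of "y - x" x]
        by auto
      then have "\<bar>y - x\<bar> * \<bar>(1 / (y - x)) * integral {x..y} p - A\<bar> \<le> (y - x) * \<eta>"
        by (intro mult_mono) auto
      then have "\<bar>integral {x..y} p - A * (y - x)\<bar> \<le> \<eta> * (y - x)"
        using \<open>0 < y - x\<close> unfolding abs_mult[symmetric]
        by (simp add: right_diff_distrib mult.commute)
      moreover have "0 \<le> (p_max + \<bar>A\<bar>) * T0" using \<open>0 < T0\<close> p_max_nonneg by simp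
      ultimately show ?thesis by linarith
    next
      case False
      have "\<bar>integral {x..y} p\<bar> \<le> p_max * (y - x)"
        using integral_bound[OF \<open>x \<le> y\<close>, of p p_max] continuous_on_subset[OF p(1)] p(2) by auto
      moreover have "\<bar>A * (y - x)\<bar> = \<bar>A\<bar> * (y - x)" using \<open>x \<le> y\<close> by (simp add: abs_mult)
      ultimately have "\<bar>integral {x..y} p - A * (y - x)\<bar> \<le> (p_max + \<bar>A\<bar>) * (y - x)"
        unfolding distrib_right by linarith
      also have "\<dots> \<le> (p_max + \<bar>A\<bar>) * T0" using False p_max_nonneg by (intro mult_left_mono) auto
      finally show ?thesis using \<eta> \<open>x \<le> y\<close> by (simp add: add_increasing)
    qed
  qed
qed

lemma has_asymptotic_average_cmult:
  assumes "has_asymptotic_average p A"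
  shows "has_asymptotic_average (\<lambda>x. c * p x) (c * A)"
proof -
  have "uniform_limit UNIV (\<lambda>T t. c * ((1 / T) * integral {t..t + T} p)) (\<lambda>_. c * A) at_top"
    using assms unfolding has_asymptotic_average_def
    by (intro bounded_linear.uniform_limit[OF bounded_linear_mult_right])
  then show ?thesis by (simp add: has_asymptotic_average_def mult.left_commute)
qed

lemma saturating_oscillatorI:
  assumes deriv: "\<And>x. (g has_real_derivative g' x) (at x)" "continuous_on UNIV g'"
    and g: "mono g" "g 0 = 0" "concave_on {0<..} g" and lim: "(g \<longlongrightarrow> g_inf) at_top"
    and p: "continuous_on UNIV p" "\<And>x. \<bar>p x\<bar> \<le> p_max" and avg: "has_asymptotic_average p A"
    and "A < g_inf"
  shows "saturating_oscillator g p g_inf A (g' 0) p_max"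
proof
  show "continuous_on UNIV g" using deriv(1) by (intro DERIV_continuous_on) auto
  show "0 \<le> g x \<and> g x \<le> g_inf" if "0 \<le> x" for x
  proof
    show "0 \<le> g x" using monoD[OF g(1) that] g(2) by simp
    show "g x \<le> g_inf"
      by (rule tendsto_lowerbound[OF lim])
        (auto intro: eventually_mono[OF eventually_ge_at_top[of x]] monoD[OF g(1)])
  qed
  show "\<bar>g x - g y\<bar> \<le> g' 0 * \<bar>x - y\<bar>" if "0 \<le> x" "0 \<le> y" for x y
    using concave_diff_le[OF deriv g(1,3) _ that] by simp
  show "\<exists>Y>0. \<forall>z\<ge>Y. \<forall>x\<ge>z. \<forall>y\<ge>z. z * \<bar>g x - g y\<bar> \<le> \<eta> * \<bar>x - y\<bar>" if \<eta>: "0 < \<eta>" for \<eta>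
  proof -
    obtain Y where Y: "\<And>z. Y \<le> z \<Longrightarrow> 0 < z \<and> z * g' z \<le> \<eta>"
      using eventually_conj[OF eventually_gt_at_top[of 0]
        saturation_deriv_decay[OF deriv g(1,3) lim \<eta>]]
      unfolding eventually_at_top_linorder by blast
    have "z * \<bar>g x - g y\<bar> \<le> \<eta> * \<bar>x - y\<bar>" if z: "Y \<le> z" "z \<le> x" "z \<le> y" for x y z
    proof -
      have "z * \<bar>g x - g y\<bar> \<le> z * (g' z * \<bar>x - y\<bar>)"
        using concave_diff_le[OF deriv g(1,3) _ z(2,3)] Y[OF z(1)] by (intro mult_left_mono) auto
      also have "\<dots> = z * g' z * \<bar>x - y\<bar>" by simp
      also have "\<dots> \<le> \<eta> * \<bar>x - y\<bar>" using Y[OF z(1)] by (intro mult_right_mono) auto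
      finally show ?thesis .
    qed
    then show ?thesis using Y[of Y] by (intro exI[of _ Y]) auto
  qed
  show "\<exists>B. \<forall>x y. x \<le> y \<longrightarrow> \<bar>integral {x..y} p - A * (y - x)\<bar> \<le> \<eta> * (y - x) + B" if "0 < \<eta>" for \<eta>
    using asymptotic_average_integral_le[OF p avg that] .
qed fact+

section \<open>Gluing\<close>

locale separated_nodes =
  fixes s :: "int \<Rightarrow> real" and \<delta> :: real
  assumes \<delta>_pos: "0 < \<delta>" and separated: "\<And>i. \<delta> \<le> s (i + 1) - s i"
begin

lemma nodes_less_Suc: "s i < s (i + 1)"
  using separated[of i] \<delta>_pos by simp

lemma strict_mono_nodes: "strict_mono s"
proof (rule strict_monoI)
  fix i j :: int assume "i < j"
  then show "s i < s j"
    by (induction j rule: int_gr_induct) (use nodes_less_Suc less_trans in blast)+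
qed

lemma nodes_growth: "s i + \<delta> * real n \<le> s (i + int n)"
proof (induction n)
  case (Suc n)
  then show ?case using separated[of "i + int n"] by (simp add: algebra_simps)
qed simp

lemma node_index_exists: "\<exists>i. s i \<le> x \<and> x < s (i + 1)"
proof (rule ccontr)
  assume no: "\<not> ?thesis"
  obtain n where "(s 0 - x) / \<delta> \<le> real n" using real_arch_simple by blast
  then have "s 0 - x \<le> \<delta> * real n" using \<delta>_pos by (simp add: field_simps)
  then have low: "s (- int n) \<le> x" using nodes_growth[of "- int n" n] by simp
  have all: "s i \<le> x" if "- int n \<le> i" for i
    using that by (induction i rule: int_ge_induct) (use low no in \<open>auto simp: not_less\<close>)
  obtain m where "(x - s 0) / \<delta> < real m" using reals_Archimedean2 by blast
  then have "x - s 0 < \<delta> * real m" using \<delta>_pos by (simp add: field_simps)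
  then show False using nodes_growth[of 0 m] all[of "int m"] by simp
qed

definition node_index :: "real \<Rightarrow> int" where
  "node_index x = (SOME i. s i \<le> x \<and> x < s (i + 1))"

definition glue :: "(int \<Rightarrow> real \<Rightarrow> real) \<Rightarrow> real \<Rightarrow> real" where
  "glue y x = y (node_index x) x"

lemma node_index: "s (node_index x) \<le> x" "x < s (node_index x + 1)"
  unfolding node_index_def using someI_ex[OF node_index_exists[of x]] by auto

lemma node_index_eq:
  assumes "s i \<le> x" "x < s (i + 1)"
  shows "node_index x = i"
proof -
  have "s i < s (node_index x + 1)" "s (node_index x) < s (i + 1)" using node_index[of x] assms
    by auto
  then show ?thesis using strict_mono_less[OF strict_mono_nodes] by auto
qed

lemma glue_eq:
  assumes match: "\<And>i. y i (s (i + 1)) = y (i + 1) (s (i + 1))" and x: "x \<in> {s i..s (i + 1)}"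
  shows "glue y x = y i x"
proof (cases "x = s (i + 1)")
  case True
  then have "node_index x = i + 1" using nodes_less_Suc[of "i + 1"] by (intro node_index_eq) auto
  then show ?thesis using match[of i] True by (simp add: glue_def)
qed (use x node_index_eq in \<open>auto simp: glue_def\<close>)

lemma glue_has_real_derivative:
  assumes match: "\<And>i. y i (s (i + 1)) = y (i + 1) (s (i + 1))"
    "\<And>i. y' i (s (i + 1)) = y' (i + 1) (s (i + 1))"
    and deriv: "\<And>i x. x \<in> {s i..s (i + 1)}
        \<Longrightarrow> (y i has_real_derivative y' i x) (at x within {s i..s (i + 1)})"
  shows "(glue y has_real_derivative glue y' x) (at x)"
proof -
  have within: "(glue y has_real_derivative glue y' x) (at x within {s i..s (i + 1)})"
    if x: "x \<in> {s i..s (i + 1)}" for i x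
    using has_derivative_transform[OF x _ deriv[OF x, unfolded has_field_derivative_def],
      of "glue y"]
      glue_eq[of y, OF match(1)] glue_eq[of y', OF match(2) x]
    unfolding has_field_derivative_def by auto
  define i where "i = node_index x"
  have i: "s i \<le> x" "x < s (i + 1)" using node_index by (auto simp: i_def)
  have left: "s (i - 1) < s i" using nodes_less_Suc[of "i - 1"] by simp
  show ?thesis
  proof (cases "x = s i")
    case True
    have "(glue y has_real_derivative glue y' x) (at x within {s (i - 1)..s i})"
      using within[of x "i - 1"] True left by simp
    moreover have "(glue y has_real_derivative glue y' x) (at x within {s i..s (i + 1)})"
      using within[of x i] i by simp
    ultimately have "(glue y has_real_derivative glue y' x)
        (at x within {s (i - 1)..s i} \<union> {s i..s (i + 1)})"
      unfolding has_field_derivative_iff unfolding at_within_union by (rule filterlim_sup)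
    moreover have "{s (i - 1)..s i} \<union> {s i..s (i + 1)} = {s (i - 1)..s (i + 1)}" using i left True
      by auto
    ultimately show ?thesis using at_within_Icc_at[of "s (i - 1)" x "s (i + 1)"] i left True by simp
  next
    case False
    then show ?thesis using within[of x i] at_within_Icc_at[of "s i" x "s (i + 1)"] i by simp
  qed
qed

end

lemma Linf_norm_ge:
  assumes u: "continuous_on UNIV u"
  shows "ereal \<bar>u x\<bar> \<le> Linf_norm u"
proof (rule ccontr)
  assume "\<not> ?thesis"
  then have less: "Linf_norm u < ereal \<bar>u x\<bar>" by simp
  let ?S = "{t. Linf_norm u < ereal \<bar>u t\<bar>}"
  have "AE t in lebesgue. ereal \<bar>u t\<bar> \<le> Linf_norm u" unfolding Linf_norm_def by (rule esssup_AE)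
  then have "AE t in lebesgue. t \<notin> ?S" by (auto elim: eventually_mono)
  moreover have "open ?S" by (intro open_Collect_less continuous_intros u continuous_on_ereal)
  moreover from this have "?S \<in> sets lebesgue" by simp
  ultimately have "open ?S" "negligible ?S" unfolding negligible_iff_null_sets
    by (simp_all add: AE_iff_null_sets)
  then show False using open_not_negligible[of ?S] less by auto
qed

lemma in_Linf_bounded:
  assumes u: "continuous_on UNIV u" and B: "\<And>x. \<bar>u x\<bar> \<le> B"
  shows "in_Linf u"
proof -
  have measurable: "u \<in> borel_measurable lebesgue"
    using borel_measurable_continuous_onI[OF u]
    by (simp add: borel_measurable_if_I measurable_completion)
  have "Linf_norm u \<le> ereal B"
    unfolding Linf_norm_def using measurable B by (intro esssup_I) auto
  then show ?thesis using measurable by (auto simp: in_Linf_def)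
qed

section \<open>Arcs of both signs\<close>

definition arc_sign :: "bool \<Rightarrow> real" where "arc_sign b = (if b then 1 else - 1)"

lemma arc_sign_square: "arc_sign b * (arc_sign b * x) = x"
  and abs_arc_sign: "\<bar>arc_sign b\<bar> = 1"
  and arc_sign_not: "arc_sign (\<not> b) = - arc_sign b"
  by (auto simp: arc_sign_def)

lemma signed_saturating_oscillator:
  fixes g p :: "real \<Rightarrow> real"
  assumes g: "C2_real g" "strict_mono g" "g 0 = 0" "strictly_concave_on {0<..} g"
    "strictly_convex_on {..<0} g"
    and lim: "(g \<longlongrightarrow> g_minus) at_bot" "(g \<longlongrightarrow> g_plus) at_top"
    and p: "continuous_on UNIV p" "\<And>x. \<bar>p x\<bar> \<le> p_max"
    and avg: "has_asymptotic_average p A" "g_minus < A" "A < g_plus"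
  shows "saturating_oscillator (\<lambda>x. arc_sign b * g (arc_sign b * x)) (\<lambda>x. arc_sign b * p x)
     (if b then g_plus else - g_minus) (arc_sign b * A) (deriv g 0) p_max"
proof -
  have deriv: "(g has_real_derivative deriv g x) (at x)" for x
    using g(1) by (auto simp: C2_real_def differentiable_on_def DERIV_deriv_iff_real_differentiable)
  have deriv_cont: "continuous_on UNIV (deriv g)"
    using g(1) by (auto simp: C2_real_def intro: differentiable_imp_continuous_on)
  have concave: "concave_on {0<..} (\<lambda>x. arc_sign b * g (arc_sign b * x))"
  proof (cases b)
    case True
    then show ?thesis
      using strictly_convex_on_imp_convex_on g(4)
      by (simp add: strictly_concave_on_def concave_on_def arc_sign_def)
  next
    case False
    then show ?thesis
      using convex_on_reflect[OF strictly_convex_on_imp_convex_on[OF g(5)]]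
      by (simp add: concave_on_def arc_sign_def)
  qed
  have "saturating_oscillator (\<lambda>x. arc_sign b * g (arc_sign b * x)) (\<lambda>x. arc_sign b * p x)
     (if b then g_plus else - g_minus) (arc_sign b * A) (deriv g (arc_sign b * 0)) p_max"
  proof (rule saturating_oscillatorI[where g' = "\<lambda>x. deriv g (arc_sign b * x)"])
    show "((\<lambda>x. arc_sign b * g (arc_sign b * x)) has_real_derivative deriv g (arc_sign b * x)) (at x)"
      for x
      using DERIV_cmult[OF DERIV_chain2[OF deriv DERIV_cmult_Id], of "arc_sign b" "arc_sign b" x]
      by (simp add: arc_sign_square mult.commute)
    show "continuous_on UNIV (\<lambda>x. deriv g (arc_sign b * x))"
      by (rule continuous_on_compose2[OF deriv_cont]) (auto intro!: continuous_intros)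
    show "mono (\<lambda>x. arc_sign b * g (arc_sign b * x))"
      using strict_mono_mono[OF g(2)] by (auto simp: mono_def arc_sign_def)
    show "((\<lambda>x. arc_sign b * g (arc_sign b * x)) \<longlongrightarrow> (if b then g_plus else - g_minus)) at_top"
      using lim by (auto simp: arc_sign_def filterlim_at_bot_mirror intro: tendsto_minus)
    show "continuous_on UNIV (\<lambda>x. arc_sign b * p x)" by (intro continuous_intros p)
    show "\<bar>arc_sign b * p x\<bar> \<le> p_max" for x using p(2) by (simp add: abs_mult abs_arc_sign)
    show "has_asymptotic_average (\<lambda>x. arc_sign b * p x) (arc_sign b * A)"
      by (rule has_asymptotic_average_cmult[OF avg(1)])
  qed (use g(3) avg concave in \<open>auto simp: arc_sign_def\<close>)
  then show ?thesis by simp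
qed

locale signed_oscillator =
  fixes g p :: "real \<Rightarrow> real" and g_inf avg Lip p_max T0 :: "bool \<Rightarrow> real"
  assumes arc_threshold: "\<And>b. arc_threshold (\<lambda>x. arc_sign b * g (arc_sign b * x)) (\<lambda>x. arc_sign b * p x)
    (g_inf b) (avg b) (Lip b) (p_max b) (T0 b)"
begin

sublocale side: arc_threshold "\<lambda>x. arc_sign b * g (arc_sign b * x)" "\<lambda>x. arc_sign b * p x"
  "g_inf b" "avg b" "Lip b" "p_max b" "T0 b" for b
  by (rule arc_threshold)

lemma eventually_arc_chain:
  "\<forall>\<^sub>F \<tau> in at_top. arc_chain side.arc_action side.landing_speed side.launch_speed side.excess \<tau> \<and>
     (\<forall>b s t. \<tau> \<le> side.excess b * (t - s) \<longrightarrow> T0 b < t - s)"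
proof -
  have "\<forall>\<^sub>F \<tau> in at_top. \<forall>b s t. \<tau> \<le> side.excess b * (t - s) \<longrightarrow> side.asymptotic_regime b s t"
    by (intro eventually_all_finite side.eventually_asymptotic_regime)
  with eventually_gt_at_top[of 0] show ?thesis
  proof eventually_elim
    case (elim \<tau>)
    then have T0: "T0 b < t - s" if "\<tau> \<le> side.excess b * (t - s)" for b s t
      using that by (simp add: side.asymptotic_regime_def)
    have domain: "{x. \<tau> \<le> side.excess b * (snd x - fst x)} \<subseteq> {x. T0 b \<le> snd x - fst x}" for b
      using T0 less_imp_le by blast
    have "arc_chain side.arc_action side.landing_speed side.launch_speed side.excess \<tau>"
    proof unfold_locales
      fix b s t assume "\<tau> \<le> side.excess b * (t - s)"
      then have "T0 b < t - s" by (rule T0)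
      then show
        "(side.arc_action b s has_real_derivative - (1 / 2 * (side.landing_speed b s t)\<^sup>2)) (at t)"
        "((\<lambda>s. side.arc_action b s t) has_real_derivative 1 / 2 * (side.launch_speed b s t)\<^sup>2) (at s)"
        by (rule side.arc_action_deriv_right side.arc_action_deriv_left)+
    qed (use elim side.excess_pos in \<open>auto simp: side.asymptotic_regime_def
        intro: continuous_on_subset[OF _ domain] side.continuous_on_arc_action
          side.continuous_on_landing_speed side.continuous_on_launch_speed\<close>)
    with T0 show ?case by blast
  qed
qed

context
  fixes \<tau> :: real and s :: "int \<Rightarrow> real"
  assumes chain: "arc_chain side.arc_action side.landing_speed side.launch_speed side.excess \<tau>"
    and threshold: "\<And>b s t. \<tau> \<le> side.excess b * (t - s) \<Longrightarrow> T0 b < t - s"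
    and matched: "\<And>i. arc_chain.matched side.landing_speed side.launch_speed side.excess \<tau> s i"
begin

interpretation chain: arc_chain side.arc_action side.landing_speed side.launch_speed side.excess \<tau>
  by (rule chain)

private lemma admissible: "chain.admissible (even i) (s i) (s (i + 1))"
  using matched[of i] by (simp add: chain.matched_def)

interpretation separated_nodes s chain.min_gap
  using chain.min_gap_pos chain.admissible_gap_ge[OF admissible] by unfold_locales

private definition piece :: "int \<Rightarrow> real \<Rightarrow> real" where
  "piece i x = arc_sign (even i) * side.arc (even i) (s i) (s (i + 1)) x"

private definition piece_deriv :: "int \<Rightarrow> real \<Rightarrow> real" where
  "piece_deriv i x = arc_sign (even i) * side.arc_deriv (even i) (s i) (s (i + 1)) x"

private lemma positive_arc:
  "side.positive_arc (even i) (s i) (s (i + 1)) (side.arc (even i) (s i) (s (i + 1)))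
     (side.arc_deriv (even i) (s i) (s (i + 1)))"
  using threshold[OF chain.admissible_scaled_gap[OF admissible[of i]]]
  by (intro side.positive_arc_arc) simp

private lemma piece_second_primitive:
  "second_primitive (s i) (s (i + 1)) (\<lambda>x. p x - g (piece i x)) (piece i) (piece_deriv i)"
  using second_primitive_cmult[OF side.positive_arcD(1)[OF positive_arc[of i]],
    of "arc_sign (even i)"]
  unfolding piece_def piece_deriv_def by (simp add: right_diff_distrib arc_sign_square)

private lemma piece_ends: "piece i (s i) = 0" "piece i (s (i + 1)) = 0"
  using side.positive_arcD(2,3)[OF positive_arc] by (simp_all add: piece_def)

private lemma piece_match: "piece i (s (i + 1)) = piece (i + 1) (s (i + 1))"
  by (simp add: piece_ends)

private lemma piece_deriv_match: "piece_deriv i (s (i + 1)) = piece_deriv (i + 1) (s (i + 1))"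
proof -
  have "side.arc_deriv (odd i) (s (i + 1)) (s (i + 2)) (s (i + 1)) =
      - side.arc_deriv (even i) (s i) (s (i + 1)) (s (i + 1))"
    using matched[of i] unfolding chain.matched_def side.landing_speed_def side.launch_speed_def
    by simp
  moreover have "even (i + 1) = odd i" "i + 1 + 1 = i + 2" by simp_all
  ultimately show ?thesis by (simp only: piece_deriv_def) (simp add: arc_sign_not)
qed

private lemma piece_bounds:
  assumes x: "x \<in> {s i..s (i + 1)}"
  shows "\<bar>piece i x\<bar> \<le> (side.force_bound True + side.force_bound False) * chain.max_gap\<^sup>2"
    and "\<bar>piece_deriv i x\<bar> \<le> (side.force_bound True + side.force_bound False) * chain.max_gap"
proof -
  let ?d = "s (i + 1) - s i"
  have d: "0 < ?d" "?d \<le> chain.max_gap"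
    using nodes_less_Suc chain.admissible_gap_le[OF admissible] by simp_all
  have force: "0 \<le> side.force_bound (even i)"
    "side.force_bound (even i) \<le> side.force_bound True + side.force_bound False"
    using side.force_bound_nonneg by (cases "even i"; simp)+
  have "0 \<le> side.arc (even i) (s i) (s (i + 1)) x"
    by (rule side.arc_profile_nonneg[OF side.positive_arcD(4)[OF positive_arc] x])
  then have "\<bar>piece i x\<bar> \<le> side.force_bound (even i) * ?d\<^sup>2"
    using side.positive_arc_le[OF positive_arc x] d(1)
    by (simp add: piece_def abs_mult abs_arc_sign)
  also have "\<dots> \<le> (side.force_bound True + side.force_bound False) * chain.max_gap\<^sup>2"
    using d force by (intro mult_mono power_mono) auto
  finally show "\<bar>piece i x\<bar> \<le> (side.force_bound True + side.force_bound False) * chain.max_gap\<^sup>2" .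
  have "\<bar>piece_deriv i x\<bar> \<le> side.force_bound (even i) * ?d"
    using side.positive_arc_deriv_le[OF positive_arc x] d(1)
    by (simp add: piece_deriv_def abs_mult abs_arc_sign)
  also have "\<dots> \<le> (side.force_bound True + side.force_bound False) * chain.max_gap"
    using d force by (intro mult_mono) auto
  finally show "\<bar>piece_deriv i x\<bar>
      \<le> (side.force_bound True + side.force_bound False) * chain.max_gap" .
qed

private lemma glue_piece_deriv: "(glue piece has_real_derivative glue piece_deriv x) (at x)"
  by (intro glue_has_real_derivative piece_match piece_deriv_match
    second_primitiveD(1)[OF piece_second_primitive])

private lemma glue_piece_deriv_deriv:
  "(glue piece_deriv has_real_derivative p x - g (glue piece x)) (at x)"
proof -
  have "(glue piece_deriv has_real_derivative glue (\<lambda>i x. p x - g (piece i x)) x) (at x)"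
    by (rule glue_has_real_derivative[OF piece_deriv_match _
          second_primitiveD(2)[OF piece_second_primitive]])
      (simp add: piece_match)
  then show ?thesis by (simp add: glue_def)
qed

private lemma glue_piece_large: "\<exists>x. \<tau>\<^sup>2 / (16 * side.excess True) \<le> glue piece x"
proof
  define x where "x = (s 0 + s (0 + 1)) / 2"
  have x: "x \<in> {s 0..s (0 + 1)}" using nodes_less_Suc[of 0] by (simp add: x_def)
  have mid: "x - s 0 = (s (0 + 1) - s 0) / 2" "s (0 + 1) - x = (s (0 + 1) - s 0) / 2"
    by (simp_all add: x_def field_simps)
  let ?r = "side.excess True" and ?d = "s (0 + 1) - s 0"
  have "\<tau>\<^sup>2 \<le> (?r * ?d)\<^sup>2"
    using chain.admissible_scaled_gap[OF admissible[of 0]] chain.\<tau>_pos by (intro power_mono) auto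
  then have "\<tau>\<^sup>2 / (16 * ?r) \<le> ?r / 4 * ((x - s 0) * (s (0 + 1) - x))"
    unfolding mid using side.excess_pos[of True] by (simp add: field_simps power2_eq_square)
  also have "\<dots> \<le> piece 0 x"
    using side.arc_profile_ge[OF side.positive_arcD(4)[OF positive_arc[of 0]] x]
    by (simp add: piece_def arc_sign_def)
  also have "\<dots> = glue piece x" using glue_eq[OF piece_match x] by simp
  finally show "\<tau>\<^sup>2 / (16 * ?r) \<le> glue piece x" .
qed

private lemma infinite_glue_piece_zeros: "infinite {t. glue piece t = 0}"
proof -
  have "infinite (range s)"
    using strict_mono_imp_inj_on[OF strict_mono_nodes] infinite_UNIV_int
    by (simp add: finite_image_iff)
  moreover have "glue piece (s i) = 0" for i
    using glue_eq[of piece "s i" i, OF piece_match] nodes_less_Suc[of i] by (simp add: piece_ends)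
  then have "range s \<subseteq> {t. glue piece t = 0}" by auto
  ultimately show ?thesis using finite_subset by blast
qed

lemma glued_solution:
  "\<exists>u. is_global_solution g p u \<and> in_Linf u \<and> in_Linf (deriv u) \<and>
     ereal (\<tau>\<^sup>2 / (16 * side.excess True)) \<le> Linf_norm u \<and> infinite {t. u t = 0}"
proof (intro exI conjI)
  let ?u = "glue piece" and ?u' = "glue piece_deriv"
  have deriv: "deriv ?u = ?u'" "deriv ?u' = (\<lambda>x. p x - g (?u x))"
    using glue_piece_deriv glue_piece_deriv_deriv by (auto intro!: DERIV_imp_deriv)
  have diff: "?u differentiable_on UNIV" "?u' differentiable_on UNIV"
    using glue_piece_deriv glue_piece_deriv_deriv
    by (auto simp: differentiable_on_def real_differentiable_def)
  then show "is_global_solution g p ?u" by (simp add: is_global_solution_def deriv)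
  have cont: "continuous_on UNIV ?u" "continuous_on UNIV ?u'"
    using diff by (auto intro: differentiable_imp_continuous_on)
  have "x \<in> {s (node_index x)..s (node_index x + 1)}" for x
    using node_index[of x] by auto
  note bounds = piece_bounds[OF this, folded glue_def]
  show "in_Linf ?u" by (rule in_Linf_bounded[OF cont(1) bounds(1)])
  show "in_Linf (deriv ?u)" unfolding deriv by (rule in_Linf_bounded[OF cont(2) bounds(2)])
  obtain x where "\<tau>\<^sup>2 / (16 * side.excess True) \<le> ?u x" using glue_piece_large by blast
  then have "ereal (\<tau>\<^sup>2 / (16 * side.excess True)) \<le> ereal \<bar>?u x\<bar>" by simp
  also have "\<dots> \<le> Linf_norm ?u" by (rule Linf_norm_ge[OF cont(1)])
  finally show "ereal (\<tau>\<^sup>2 / (16 * side.excess True)) \<le> Linf_norm ?u" .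
  show "infinite {t. ?u t = 0}" by (rule infinite_glue_piece_zeros)
qed

end

lemma large_solution_exists:
  "\<exists>u. is_global_solution g p u \<and> in_Linf u \<and> in_Linf (deriv u) \<and> ereal R \<le> Linf_norm u \<and>
     infinite {t. u t = 0}"
proof -
  have "filterlim (\<lambda>\<tau> :: real. 1 / (16 * side.excess True) * \<tau> ^ 2) at_top at_top"
    using side.excess_pos[of True]
    by (intro filterlim_tendsto_pos_mult_at_top[OF tendsto_const] filterlim_pow_at_top
      filterlim_ident) auto
  then have "\<forall>\<^sub>F \<tau> in at_top. R \<le> \<tau>\<^sup>2 / (16 * side.excess True)" by (simp add: filterlim_at_top)
  from eventually_happens'[OF trivial_limit_at_top_linorder
      eventually_conj[OF eventually_arc_chain this]]
  obtain \<tau> where R: "R \<le> \<tau>\<^sup>2 / (16 * side.excess True)"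
    and chain: "arc_chain side.arc_action side.landing_speed side.launch_speed side.excess \<tau>"
    and threshold: "\<And>b s t. \<tau> \<le> side.excess b * (t - s) \<Longrightarrow> T0 b < t - s"
    by blast
  obtain s where "\<And>i. arc_chain.matched side.landing_speed side.launch_speed side.excess \<tau> s i"
    using arc_chain.matched_sequence_exists[OF chain] by blast
  from glued_solution[OF chain threshold this] obtain u where u: "is_global_solution g p u"
    "in_Linf u" "in_Linf (deriv u)" "infinite {t. u t = 0}"
    "ereal (\<tau>\<^sup>2 / (16 * side.excess True)) \<le> Linf_norm u"
    by blast
  have "ereal R \<le> ereal (\<tau>\<^sup>2 / (16 * side.excess True))" using R by simp
  then have "ereal R \<le> Linf_norm u" using u(5) by (rule order_trans)
  with u show ?thesis by blast
qed

end

theorem theorem2p1: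
  fixes g p :: "real \<Rightarrow> real" and g_minus g_plus A :: real
  assumes "C2_real g"
    and "bounded (range g)"
    and "strict_mono g"
    and "g 0 = 0"
    and "strictly_concave_on {0<..} g"
    and "strictly_convex_on {..<0} g"
    and "(g \<longlongrightarrow> g_minus) at_bot"
    and "(g \<longlongrightarrow> g_plus) at_top"
    and "continuous_on UNIV p"
    and "bounded (range p)"
    and "has_asymptotic_average p A"
    and "g_minus < A"
    and "A < g_plus"
  shows "\<exists>u :: nat \<Rightarrow> real \<Rightarrow> real.
    (\<forall>m. is_global_solution g p (u m) \<and> in_Linf (u m) \<and> in_Linf (deriv (u m))) \<and>
    ((\<lambda>m. Linf_norm (u m)) \<longlonglongrightarrow> \<infinity>) \<and>
    (\<forall>m. infinite {t. u m t = 0})"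
proof -
  obtain p_max where p_max: "\<And>x. \<bar>p x\<bar> \<le> p_max" using assms(10) by (auto simp: bounded_iff)
  let ?g_inf = "\<lambda>b. if b then g_plus else - g_minus"
  have "\<exists>T0. arc_threshold (\<lambda>x. arc_sign b * g (arc_sign b * x)) (\<lambda>x. arc_sign b * p x) (?g_inf b)
      (arc_sign b * A) (deriv g 0) p_max T0" for b
    by (intro saturating_oscillator.arc_threshold_exists signed_saturating_oscillator p_max assms)
  then obtain T0 where
    "signed_oscillator g p ?g_inf (\<lambda>b. arc_sign b * A) (\<lambda>_. deriv g 0) (\<lambda>_. p_max) T0"
    unfolding signed_oscillator_def by metis
  then have "\<exists>u. is_global_solution g p u \<and> in_Linf u \<and> in_Linf (deriv u) \<and>
      ereal (real m) \<le> Linf_norm u \<and> infinite {t. u t = 0}" for m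
    by (rule signed_oscillator.large_solution_exists)
  then obtain u where u: "\<And>m. is_global_solution g p (u m) \<and> in_Linf (u m) \<and> in_Linf (deriv (u m)) \<and>
      ereal (real m) \<le> Linf_norm (u m) \<and> infinite {t. u m t = 0}"
    by metis
  have "(\<lambda>m. Linf_norm (u m)) \<longlonglongrightarrow> \<infinity>"
    by (rule tendsto_sandwich[OF _ _ id_nat_ereal_tendsto_PInf tendsto_const]) (use u in auto)
  with u show ?thesis by blast
qed

end
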